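(* Let $n\ge 2$, let $q$ be a power of a prime $p$, and let $\mathcal{S}\subset\mathbb{P}^n$ be an absolutely irreducible nondegenerate hypersurface defined over $\mathbb{F}_q$ by a homogeneous polynomial $F$, with Gauss map $\Gamma$, such that $p\nmid\deg(\mathcal{S})$ and $\sum_{i=0}^n\frac{\partial F}{\partial X_i}X_i^q$ is a nonzero polynomial. Suppose that $\mathcal{S}$ is $\mathbb{F}_q$-Frobenius nonclassical and that $\Gamma$ admits coordinates of the form $\Gamma=(U_0^{p^r}:\cdots:U_n^{p^r})$ with $r>0$ and $p^r<q$, where $(U_0:\cdots:U_n)$ is a generically finite and separable rational map. Then $\Gamma$ is purely inseparable. Moreover, in this case $\mathcal{S}=\mathcal{S}''$, and if $\Gamma'$ is the Gauss map of $\mathcal{S}'$, then $\Gamma'\circ\Gamma=\Phi_q$.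
   Context: $\Phi_q$ is the $\mathbb{F}_q$-Frobenius map (raising coordinates to the $q$-th power). $\mathcal{S}$ is $\mathbb{F}_q$-Frobenius nonclassical if $\Phi_q(P)\in T_P(\mathcal{S})$ (the tangent hyperplane) for every nonsingular point $P$ of $\mathcal{S}$; equivalently, if $F$ divides $\sum_i\frac{\partial F}{\partial X_i}X_i^q$. The Gauss map $\Gamma$ of $\mathcal{S}$ is the rational map to the dual projective space $(\mathbb{P}^n)'$ sending a nonsingular point $P$ to the dual of $T_P(\mathcal{S})$, given by the partial derivatives of $F$. The (strict) dual $\mathcal{S}'$ is the Zariski closure of the image of $\Gamma$, and $\mathcal{S}''=(\mathcal{S}')'$, with the bidual projective space identified with $\mathbb{P}^n$. A generically finite rational map is separable (resp. purely inseparable) if the extension of function fields of the source over that of the closure of the image is separable (resp. purely inseparable). Equality $\Gamma'\circ\Gamma=\Phi_q$ is as rational maps on $\mathcal{S}$. *)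

theory Defs
  imports
    "HOL-Library.Poly_Mapping"
    "HOL-Algebra.Finite_Extensions"
    "HOL-Algebra.Algebraic_Closure_Type"
begin

section \<open>Polynomials in the variables \<open>X\<^sub>0, X\<^sub>1, \<dots>\<close>\<close>

text \<open>
  A polynomial is a finitely supported map from exponent vectors to coefficients.  The variables
  are indexed by all of \<open>nat\<close>; the restriction to \<open>X\<^sub>0, \<dots>, X\<^sub>n\<close> is part of the predicate
  \<open>homogeneous\<close> below.  Units, divisibility and irreducibility of a polynomial in
  \<open>X\<^sub>0, \<dots>, X\<^sub>n\<close> do not change when further variables are added.
\<close>

type_synonym 'a mpol = "(nat \<Rightarrow>\<^sub>0 nat) \<Rightarrow>\<^sub>0 'a"

definition mconst :: "'a::zero \<Rightarrow> 'a mpol" where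
  "mconst c = Poly_Mapping.single 0 c"

definition mvar :: "nat \<Rightarrow> 'a::zero_neq_one mpol" where
  "mvar i = Poly_Mapping.single (Poly_Mapping.single i 1) 1"

definition meval :: "'a::comm_semiring_1 mpol \<Rightarrow> (nat \<Rightarrow> 'a) \<Rightarrow> 'a" where
  "meval A x = (\<Sum>m\<in>Poly_Mapping.keys A. Poly_Mapping.lookup A m *
                 (\<Prod>i\<in>Poly_Mapping.keys m. x i ^ Poly_Mapping.lookup m i))"

definition msubst :: "'a::comm_semiring_1 mpol \<Rightarrow> (nat \<Rightarrow> 'a mpol) \<Rightarrow> 'a mpol" where
  "msubst A U = (\<Sum>m\<in>Poly_Mapping.keys A. mconst (Poly_Mapping.lookup A m) *
                 (\<Prod>i\<in>Poly_Mapping.keys m. U i ^ Poly_Mapping.lookup m i))"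

text \<open>In a monomial without \<open>X\<^sub>i\<close> the subtraction of exponents truncates, but then the
  coefficient is \<open>0\<close>.\<close>

definition partial :: "nat \<Rightarrow> 'a::comm_semiring_1 mpol \<Rightarrow> 'a mpol" where
  "partial i A = (\<Sum>m\<in>Poly_Mapping.keys A.
     Poly_Mapping.single (m - Poly_Mapping.single i 1)
       (of_nat (Poly_Mapping.lookup m i) * Poly_Mapping.lookup A m))"

text \<open>The zero polynomial is homogeneous of every degree.\<close>

definition homogeneous :: "nat \<Rightarrow> nat \<Rightarrow> 'a::zero mpol \<Rightarrow> bool" where
  "homogeneous n d A \<longleftrightarrow> (\<forall>m\<in>Poly_Mapping.keys A.
     Poly_Mapping.keys m \<subseteq> {..n} \<and> (\<Sum>i\<le>n. Poly_Mapping.lookup m i) = d)"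

definition base_change :: "'k::field mpol \<Rightarrow> 'k alg_closure mpol" where
  "base_change A = Poly_Mapping.map to_ac A"


section \<open>Projective space over an algebraically closed field\<close>

text \<open>
  A point of \<open>\<P>\<^sup>n\<close> is the set of all its homogeneous coordinate vectors.  The dual space is
  identified with \<open>\<P>\<^sup>n\<close> by the dual coordinates, so that \<open>(a\<^sub>0 : \<dots> : a\<^sub>n)\<close> stands for
  the hyperplane \<open>\<Sum> a\<^sub>i X\<^sub>i = 0\<close>.
\<close>

definition hcoords :: "nat \<Rightarrow> (nat \<Rightarrow> 'a::zero) set" where
  "hcoords n = {x. (\<exists>i\<le>n. x i \<noteq> 0) \<and> (\<forall>i>n. x i = 0)}"

definition ppoint :: "(nat \<Rightarrow> 'a::field) \<Rightarrow> (nat \<Rightarrow> 'a) set" where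
  "ppoint x = {y. \<exists>c. c \<noteq> 0 \<and> y = (\<lambda>i. c * x i)}"

definition pspace :: "nat \<Rightarrow> (nat \<Rightarrow> 'a::field) set set" where
  "pspace n = ppoint ` hcoords n"

definition vanishes_on :: "nat \<Rightarrow> (nat \<Rightarrow> 'a::field) set set \<Rightarrow> 'a mpol \<Rightarrow> bool" where
  "vanishes_on n Y A \<longleftrightarrow> (\<forall>x\<in>hcoords n. ppoint x \<in> Y \<longrightarrow> meval A x = 0)"

definition zariski_closure ::
    "nat \<Rightarrow> (nat \<Rightarrow> 'a::field) set set \<Rightarrow> (nat \<Rightarrow> 'a) set set" where
  "zariski_closure n Y = {P \<in> pspace n. \<forall>d A. homogeneous n d A \<longrightarrow> vanishes_on n Y A
                            \<longrightarrow> vanishes_on n {P} A}"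

definition hypersurface :: "nat \<Rightarrow> 'a::field mpol \<Rightarrow> (nat \<Rightarrow> 'a) set set" where
  "hypersurface n F = {ppoint x | x. x \<in> hcoords n \<and> meval F x = 0}"

text \<open>\<open>Y\<close> is the irreducible hypersurface with (reduced) equation \<open>F\<close>, over the
  algebraically closed field of coefficients.\<close>

definition irreducible_equation ::
    "nat \<Rightarrow> 'a::alg_closed_field mpol \<Rightarrow> (nat \<Rightarrow> 'a) set set \<Rightarrow> bool" where
  "irreducible_equation n F Y \<longleftrightarrow>
     (\<exists>d. homogeneous n d F) \<and> Factorial_Ring.irreducible F \<and> Y = hypersurface n F"

definition nondegenerate :: "nat \<Rightarrow> (nat \<Rightarrow> 'a::field) set set \<Rightarrow> bool" where
  "nondegenerate n Y \<longleftrightarrow> (\<forall>L. homogeneous n 1 L \<and> L \<noteq> 0 \<longrightarrow> \<not> vanishes_on n Y L)"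

text \<open>Here \<open>x\<close> is a coordinate vector of a point of \<open>F = 0\<close>.\<close>

definition nonsingular_at :: "nat \<Rightarrow> 'a::field mpol \<Rightarrow> (nat \<Rightarrow> 'a) \<Rightarrow> bool" where
  "nonsingular_at n F x \<longleftrightarrow> (\<exists>i\<le>n. meval (partial i F) x \<noteq> 0)"

definition tangent_hyperplane ::
    "nat \<Rightarrow> 'a::field mpol \<Rightarrow> (nat \<Rightarrow> 'a) \<Rightarrow> (nat \<Rightarrow> 'a) set set" where
  "tangent_hyperplane n F x =
     {ppoint y | y. y \<in> hcoords n \<and> (\<Sum>i\<le>n. meval (partial i F) x * y i) = 0}"

definition frobenius_nonclassical :: "nat \<Rightarrow> nat \<Rightarrow> 'a::field mpol \<Rightarrow> bool" where
  "frobenius_nonclassical n q F \<longleftrightarrow>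
     (\<forall>x\<in>hcoords n. meval F x = 0 \<longrightarrow> nonsingular_at n F x \<longrightarrow>
        ppoint (\<lambda>i. x i ^ q) \<in> tangent_hyperplane n F x)"


section \<open>Rational maps\<close>

text \<open>
  A rational map from an irreducible closed set \<open>Y\<close> to \<open>\<P>\<^sup>n\<close> is given by homogeneous
  polynomials \<open>U\<^sub>0, \<dots>, U\<^sub>n\<close> of the same degree, not all vanishing identically on \<open>Y\<close>.
\<close>

definition rational_map ::
    "nat \<Rightarrow> (nat \<Rightarrow> 'a::field) set set \<Rightarrow> (nat \<Rightarrow> 'a mpol) \<Rightarrow> bool" where
  "rational_map n Y U \<longleftrightarrow> (\<exists>d. \<forall>i\<le>n. homogeneous n d (U i)) \<and> (\<exists>i\<le>n. \<not> vanishes_on n Y (U i))"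

definition rational_map_eq ::
    "nat \<Rightarrow> (nat \<Rightarrow> 'a::field) set set \<Rightarrow> (nat \<Rightarrow> 'a mpol) \<Rightarrow> (nat \<Rightarrow> 'a mpol) \<Rightarrow> bool" where
  "rational_map_eq n Y U V \<longleftrightarrow> rational_map n Y U \<and> rational_map n Y V \<and>
     (\<forall>i\<le>n. \<forall>j\<le>n. vanishes_on n Y (U i * V j - U j * V i))"

definition map_image ::
    "nat \<Rightarrow> (nat \<Rightarrow> 'a::field) set set \<Rightarrow> (nat \<Rightarrow> 'a mpol) \<Rightarrow> (nat \<Rightarrow> 'a) set set" where
  "map_image n Y U = {ppoint (\<lambda>i. if i \<le> n then meval (U i) x else 0) | x.
     x \<in> hcoords n \<and> ppoint x \<in> Y \<and> (\<exists>i\<le>n. meval (U i) x \<noteq> 0)}"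

definition rational_comp :: "(nat \<Rightarrow> 'a::comm_semiring_1 mpol) \<Rightarrow> (nat \<Rightarrow> 'a mpol) \<Rightarrow> nat \<Rightarrow> 'a mpol" where
  "rational_comp V U = (\<lambda>i. msubst (V i) U)"

definition gauss_map :: "'a::comm_semiring_1 mpol \<Rightarrow> nat \<Rightarrow> 'a mpol" where
  "gauss_map F = (\<lambda>i. partial i F)"

definition frobenius_map :: "nat \<Rightarrow> nat \<Rightarrow> 'a::comm_semiring_1 mpol" where
  "frobenius_map q = (\<lambda>i. mvar i ^ q)"

text \<open>The dual of the hypersurface with equation \<open>F\<close>; the points of the hypersurface at which
  some coordinate of \<open>gauss_map F\<close> is nonzero are the nonsingular ones.\<close>

definition strict_dual :: "nat \<Rightarrow> 'a::field mpol \<Rightarrow> (nat \<Rightarrow> 'a) set set" where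
  "strict_dual n F = zariski_closure n (map_image n (hypersurface n F) (gauss_map F))"


section \<open>Function fields\<close>

text \<open>
  The function field of an irreducible closed set \<open>Y\<close> consists of the fractions \<open>A/B\<close> of
  homogeneous polynomials of the same degree, \<open>B\<close> not vanishing identically on \<open>Y\<close>,
  where \<open>A/B = C/D\<close> iff \<open>A D - C B\<close> vanishes on \<open>Y\<close>.
\<close>

definition ff_pairs :: "nat \<Rightarrow> (nat \<Rightarrow> 'a::field) set set \<Rightarrow> ('a mpol \<times> 'a mpol) set" where
  "ff_pairs n Y = {(A, B). (\<exists>d. homogeneous n d A \<and> homogeneous n d B) \<and> \<not> vanishes_on n Y B}"

definition ff_rel ::
    "nat \<Rightarrow> (nat \<Rightarrow> 'a::field) set set \<Rightarrow> (('a mpol \<times> 'a mpol) \<times> ('a mpol \<times> 'a mpol)) set" where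
  "ff_rel n Y = {((A, B), (C, D)). (A, B) \<in> ff_pairs n Y \<and> (C, D) \<in> ff_pairs n Y \<and>
                   vanishes_on n Y (A * D - C * B)}"

definition ff_class ::
    "nat \<Rightarrow> (nat \<Rightarrow> 'a::field) set set \<Rightarrow> 'a mpol \<times> 'a mpol \<Rightarrow> ('a mpol \<times> 'a mpol) set" where
  "ff_class n Y f = ff_rel n Y `` {f}"

definition function_field ::
    "nat \<Rightarrow> (nat \<Rightarrow> 'a::field) set set \<Rightarrow> ('a mpol \<times> 'a mpol) set ring" where
  "function_field n Y =
     \<lparr>carrier = ff_pairs n Y // ff_rel n Y,
      monoid.mult = (\<lambda>f g. \<Union>(A, B)\<in>f. \<Union>(C, D)\<in>g. ff_class n Y (A * C, B * D)),
      one = ff_class n Y (1, 1),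
      ring.zero = ff_class n Y (0, 1),
      add = (\<lambda>f g. \<Union>(A, B)\<in>f. \<Union>(C, D)\<in>g. ff_class n Y (A * D + C * B, B * D))\<rparr>"

text \<open>The function field of the closure of the image of \<open>U\<close>, embedded into the function
  field of \<open>Y\<close> by the pullback \<open>A/B \<mapsto> A(U)/B(U)\<close>.\<close>

definition pullback_field ::
    "nat \<Rightarrow> (nat \<Rightarrow> 'a::field) set set \<Rightarrow> (nat \<Rightarrow> 'a mpol) \<Rightarrow> ('a mpol \<times> 'a mpol) set set" where
  "pullback_field n Y U = {ff_class n Y (msubst A U, msubst B U) | A B.
     (A, B) \<in> ff_pairs n (zariski_closure n (map_image n Y U))}"


section \<open>Separable and purely inseparable extensions and rational maps\<close>

text \<open>Univariate polynomials of \<open>HOL-Algebra\<close> are lists of coefficients, leading coefficient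
  first.\<close>

definition formal_deriv :: "('a, 'b) ring_scheme \<Rightarrow> 'a list \<Rightarrow> 'a list" where
  "formal_deriv R f =
     ring.normalize R (map (\<lambda>i. [i] \<cdot>\<^bsub>R\<^esub> ring.coeff R f i) (rev [1..<length f]))"

definition separable_element :: "('a, 'b) ring_scheme \<Rightarrow> 'a set \<Rightarrow> 'a \<Rightarrow> bool" where
  "separable_element R K x \<longleftrightarrow> ring.algebraic R K x \<and>
     isgcd (univ_poly R K) \<one>\<^bsub>univ_poly R K\<^esub> (ring.Irr R K x) (formal_deriv R (ring.Irr R K x))"

definition separable_extension :: "('a, 'b) ring_scheme \<Rightarrow> 'a set \<Rightarrow> bool" where
  "separable_extension R K \<longleftrightarrow> (\<forall>x\<in>carrier R. separable_element R K x)"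

text \<open>Here \<open>p\<close> is the (positive) characteristic of \<open>R\<close>.\<close>

definition purely_inseparable_extension ::
    "nat \<Rightarrow> ('a, 'b) ring_scheme \<Rightarrow> 'a set \<Rightarrow> bool" where
  "purely_inseparable_extension p R K \<longleftrightarrow> (\<forall>x\<in>carrier R. \<exists>e::nat. x [^]\<^bsub>R\<^esub> (p ^ e) \<in> K)"

definition generically_finite ::
    "nat \<Rightarrow> (nat \<Rightarrow> 'a::field) set set \<Rightarrow> (nat \<Rightarrow> 'a mpol) \<Rightarrow> bool" where
  "generically_finite n Y U \<longleftrightarrow> ring.finite_dimension (function_field n Y)
     (pullback_field n Y U) (carrier (function_field n Y))"

definition separable_map ::
    "nat \<Rightarrow> (nat \<Rightarrow> 'a::field) set set \<Rightarrow> (nat \<Rightarrow> 'a mpol) \<Rightarrow> bool" where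
  "separable_map n Y U \<longleftrightarrow> generically_finite n Y U \<and>
     separable_extension (function_field n Y) (pullback_field n Y U)"

definition purely_inseparable_map ::
    "nat \<Rightarrow> (nat \<Rightarrow> 'a::field) set set \<Rightarrow> (nat \<Rightarrow> 'a mpol) \<Rightarrow> bool" where
  "purely_inseparable_map n Y U \<longleftrightarrow> generically_finite n Y U \<and>
     purely_inseparable_extension CHAR('a) (function_field n Y) (pullback_field n Y U)"

end

theory Submission
  imports Defs "HOL-Computational_Algebra.Polynomial"
begin

text \<open>
  Write \<open>P = p\<^sup>r\<close>, \<open>q = q'P\<close> and \<open>F\<^sub>i\<close> for the partial derivatives
  of \<open>F\<close>; congruences are modulo \<open>F\<close>.  The whole proof rests on one computation.  The hypersurface is
  nonclassical, so \<open>\<Sum> F\<^sub>i X\<^sub>i\<^sup>q \<equiv> 0\<close>.  Since \<open>(F\<^sub>i)\<close> is proportional to \<open>(U\<^sub>i\<^sup>P)\<close>, the left-hand side is, up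
  to a factor, the \<open>P\<close>-th power of \<open>\<Sum> U\<^sub>i X\<^sub>i\<^bsup>q'\<^esup>\<close>, and therefore \<open>\<Sum> U\<^sub>i X\<^sub>i\<^bsup>q'\<^esup> \<equiv> 0\<close>.  As \<open>P < q\<close>, the
  number \<open>q'\<close> is divisible by \<open>p\<close>; a derivation \<open>D\<close> along the hypersurface thus treats the
  \<open>X\<^sub>i\<^bsup>q'\<^esup>\<close> as constants, and \<open>\<Sum> D(U\<^sub>i) X\<^sub>i\<^bsup>q'\<^esup> \<equiv> 0\<close>.  In other words, the vector \<open>(X\<^sub>i\<^bsup>q'\<^esup>)\<close> is a
  tangent hyperplane of the image of \<open>U\<close>.

  Let \<open>A\<close> be any equation of the image of \<open>\<Gamma> = (F\<^sub>0 : \<dots> : F\<^sub>n)\<close>.  Taking \<open>P\<close>-th roots of its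
  coefficients gives an equation \<open>B\<close> of the image of \<open>U\<close>, whose gradient at \<open>U\<close> is orthogonal to \<open>U\<close>
  by Euler's relation and to all \<open>D(U)\<close> by the chain rule.  This is where separability enters
  (\<open>gauss_rank\<close>): a derivation that kills the ratios of the \<open>U\<^sub>i\<close> kills everything that is separable
  over them, hence the whole function field, so that the \<open>D(U)\<close> span a space of the largest
  possible dimension and two vectors orthogonal to \<open>U\<close> and to all \<open>D(U)\<close> are proportional.  Raising
  this to the \<open>P\<close>-th power gives the lemma \<open>tangent\<close>: the gradient of every equation of the dual, taken at
  \<open>\<Gamma>\<close>, is proportional to \<open>(X\<^sub>0\<^sup>q, \<dots>, X\<^sub>n\<^sup>q)\<close>.

  Everything follows from it.
  \<^item> The dual is a hypersurface.  An equation exists, because \<open>n + 1\<close> forms on a variety of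
    dimension \<open>n - 1\<close> are algebraically dependent.  A nonzero equation involves every variable: if
    one partial derivative is zero, then they all vanish on the dual, which for an equation of
    smallest degree makes it a \<open>p\<close>-th power.  So no variable can be eliminated between two
    equations, and all of them are multiples of one irreducible \<open>G\<close>.
  \<^item> The gradient of \<open>G\<close> at \<open>\<Gamma>\<close> is not zero and proportional to \<open>(X\<^sub>i\<^sup>q)\<close>, which says that
    \<open>\<Gamma>' \<circ> \<Gamma> = \<Phi>\<^sub>q\<close>.
  \<^item> Consequently \<open>A\<close> is an equation of the bidual iff \<open>A(X\<^sub>0\<^sup>q, \<dots>, X\<^sub>n\<^sup>q) \<equiv> 0\<close> iff \<open>A \<equiv> 0\<close>, because \<open>F\<close> has
    coefficients in \<open>GF(q)\<close>.  So the bidual is the hypersurface itself.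
  \<^item> Every \<open>q\<close>-th power in the function field is a pullback under \<open>\<Phi>\<^sub>q\<close>, hence under \<open>\<Gamma>\<close>, so that \<open>\<Gamma>\<close>
    is purely inseparable.

  The translation between points and polynomials uses that an irreducible polynomial is prime and
  that the polynomials vanishing on \<open>F = 0\<close> are the multiples of \<open>F\<close>.  Both come from Gauss's lemma in
  the form of an elimination statement: if \<open>F\<close> is irreducible and does not divide \<open>A\<close>, then the
  ideal \<open>(F, A)\<close> contains a nonzero polynomial without a given variable of \<open>F\<close>.
\<close>

abbreviation (input) lookup where "lookup \<equiv> Poly_Mapping.lookup"
abbreviation (input) keys where "keys \<equiv> Poly_Mapping.keys"
abbreviation (input) single where "single \<equiv> Poly_Mapping.single"
abbreviation (input) map_coeffs where "map_coeffs \<equiv> Poly_Mapping.map"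

section \<open>Evaluation homomorphisms\<close>

text \<open>
  Evaluations, changes of coefficients, gradings and Frobenius powers are all homomorphisms, so that
  an identity between them need only be checked on constants and variables.
\<close>

definition is_hom :: "('a::comm_ring_1 \<Rightarrow> 'b::comm_ring_1) \<Rightarrow> bool" where
  "is_hom f \<longleftrightarrow> f 1 = 1 \<and> (\<forall>a b. f (a + b) = f a + f b) \<and> (\<forall>a b. f (a * b) = f a * f b)"

lemma is_homI:
  assumes "f 1 = 1" "\<And>a b. f (a + b) = f a + f b" "\<And>a b. f (a * b) = f a * f b"
  shows "is_hom f"
  using assms by (simp add: is_hom_def)

lemma
  assumes "is_hom f"
  shows hom_one: "f 1 = 1"
    and hom_add: "f (a + b) = f a + f b"
    and hom_mult: "f (a * b) = f a * f b"
    and hom_zero: "f 0 = 0"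
    and hom_minus: "f (- a) = - f a"
    and hom_diff: "f (a - b) = f a - f b"
proof -
  show *: "f 1 = 1" "f (a + b) = f a + f b" "f (a * b) = f a * f b" for a b
    using assms by (auto simp: is_hom_def)
  have "f 0 + f 0 = f 0 + 0" using *(2)[of 0 0] by simp
  thus **: "f 0 = 0" by (simp only: add_left_cancel)
  show ***: "f (- a) = - f a" for a using *(2)[of a "- a"] ** by (simp add: eq_neg_iff_add_eq_0 add.commute)
  show "f (a - b) = f a - f b" using *(2)[of a "- b"] *** by simp
qed

lemma hom_sum: "is_hom f \<Longrightarrow> f (\<Sum>i\<in>I. g i) = (\<Sum>i\<in>I. f (g i))"
  by (induction I rule: infinite_finite_induct) (auto simp: hom_zero hom_add)

lemma hom_prod: "is_hom f \<Longrightarrow> f (\<Prod>i\<in>I. g i) = (\<Prod>i\<in>I. f (g i))"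
  by (induction I rule: infinite_finite_induct) (auto simp: hom_one hom_mult)

lemma hom_power: "is_hom f \<Longrightarrow> f (a ^ k) = f a ^ k"
  by (induction k) (auto simp: hom_one hom_mult)

lemma hom_of_nat: "is_hom f \<Longrightarrow> f (of_nat k) = of_nat k"
  by (induction k) (auto simp: hom_one hom_zero hom_add)

lemma is_hom_comp: "is_hom f \<Longrightarrow> is_hom g \<Longrightarrow> is_hom (\<lambda>x. f (g x))"
  by (simp add: is_hom_def)

lemma is_hom_id: "is_hom (\<lambda>x. x)"
  by (simp add: is_hom_def)

definition mono_eval :: "(nat \<Rightarrow> 'b::comm_ring_1) \<Rightarrow> (nat \<Rightarrow>\<^sub>0 nat) \<Rightarrow> 'b" where
  "mono_eval x m = (\<Prod>i\<in>keys m. x i ^ lookup m i)"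

text \<open>
  The target is an arbitrary commutative ring.  The field of coefficients and the polynomial ring
  itself give \<open>meval\<close> and \<open>msubst\<close>; the ring of univariate polynomials over the polynomial ring gives
  the grading by degree and the expansion in powers of one variable.
\<close>

definition geval ::
    "('a::comm_ring_1 \<Rightarrow> 'b::comm_ring_1) \<Rightarrow> (nat \<Rightarrow> 'b) \<Rightarrow> 'a mpol \<Rightarrow> 'b" where
  "geval h x A = (\<Sum>m\<in>keys A. h (lookup A m) * mono_eval x m)"

lemma mono_eval_superset:
  assumes "finite T" "keys m \<subseteq> T"
  shows "mono_eval x m = (\<Prod>i\<in>T. x i ^ lookup m i)"
  unfolding mono_eval_def
  by (rule prod.mono_neutral_left) (use assms in \<open>auto simp: in_keys_iff\<close>)

lemma mono_eval_0 [simp]: "mono_eval x 0 = 1"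
  by (simp add: mono_eval_def)

lemma mono_eval_add: "mono_eval x (m + m') = mono_eval x m * mono_eval x m'"
proof -
  let ?T = "keys m \<union> keys m'"
  have "mono_eval x (m + m') = (\<Prod>i\<in>?T. x i ^ lookup (m + m') i)"
    by (rule mono_eval_superset) (use keys_add[of m m'] in auto)
  also have "\<dots> = (\<Prod>i\<in>?T. x i ^ lookup m i) * (\<Prod>i\<in>?T. x i ^ lookup m' i)"
    by (simp add: lookup_add power_add prod.distrib)
  also have "\<dots> = mono_eval x m * mono_eval x m'"
    by (simp add: mono_eval_superset[of ?T m] mono_eval_superset[of ?T m'])
  finally show ?thesis .
qed

lemma mono_eval_single [simp]: "mono_eval x (single i k) = x i ^ k"
  by (cases "k = 0") (simp_all add: mono_eval_def)

lemma geval_superset: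
  assumes "finite T" "keys A \<subseteq> T" "is_hom h"
  shows "geval h x A = (\<Sum>m\<in>T. h (lookup A m) * mono_eval x m)"
  unfolding geval_def
  by (rule sum.mono_neutral_left) (use assms in \<open>auto simp: in_keys_iff hom_zero\<close>)

lemma geval_zero [simp]: "geval h x 0 = 0"
  by (simp add: geval_def)

lemma geval_add:
  assumes "is_hom h"
  shows "geval h x (A + B) = geval h x A + geval h x B"
proof -
  let ?T = "keys A \<union> keys B"
  have "geval h x (A + B) = (\<Sum>m\<in>?T. h (lookup (A + B) m) * mono_eval x m)"
    by (rule geval_superset) (use keys_add[of A B] assms in auto)
  also have "\<dots> = (\<Sum>m\<in>?T. h (lookup A m) * mono_eval x m)
     + (\<Sum>m\<in>?T. h (lookup B m) * mono_eval x m)"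
    by (simp add: lookup_add hom_add[OF assms] ring_distribs sum.distrib)
  also have "\<dots> = geval h x A + geval h x B"
    using assms by (simp add: geval_superset[of ?T A] geval_superset[of ?T B])
  finally show ?thesis .
qed

lemma geval_sum: "is_hom h \<Longrightarrow> geval h x (\<Sum>i\<in>I. f i) = (\<Sum>i\<in>I. geval h x (f i))"
  by (induction I rule: infinite_finite_induct) (auto simp: geval_add)

lemma geval_single: "is_hom h \<Longrightarrow> geval h x (single m c) = h c * mono_eval x m"
  by (cases "c = 0") (auto simp: geval_def hom_zero)

lemma mpol_expand: "A = (\<Sum>m\<in>keys A. single m (lookup A m))"
  by (rule poly_mapping_eqI) (auto simp: lookup_sum lookup_single when_def in_keys_iff)

lemma mono_as_vars: "single m (c::'a::comm_ring_1) = mconst c * mono_eval mvar m"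
proof -
  have pw: "mvar i ^ k = single (single i k) (1::'a)" for i k
    by (induction k) (simp_all add: mvar_def mult_single single_add[symmetric])
  have "(\<Prod>i\<in>T. mvar i ^ f i) = single (\<Sum>i\<in>T. single i (f i)) (1::'a)"
    if "finite T" for T and f :: "nat \<Rightarrow> nat"
    using that by induction (simp_all add: pw mult_single)
  hence "mono_eval mvar m = single (\<Sum>i\<in>keys m. single i (lookup m i)) (1::'a)"
    by (simp add: mono_eval_def)
  also have "(\<Sum>i\<in>keys m. single i (lookup m i)) = m"
    by (rule mpol_expand[symmetric])
  finally show ?thesis by (simp add: mconst_def mult_single)
qed

lemma geval_mult:
  assumes h: "is_hom h"
  shows "geval h x (A * B) = geval h x A * geval h x B"
proof -
  let ?s = "\<lambda>A m. single m (lookup A m)"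
  have "A * B = (\<Sum>m\<in>keys A. ?s A m) * (\<Sum>m\<in>keys B. ?s B m)"
    by (simp flip: mpol_expand)
  also have "\<dots> = (\<Sum>m\<in>keys A. \<Sum>m'\<in>keys B.
      single (m + m') (lookup A m * lookup B m'))"
    by (simp add: sum_product mult_single)
  finally have "geval h x (A * B) = (\<Sum>m\<in>keys A. \<Sum>m'\<in>keys B.
      (h (lookup A m) * mono_eval x m) * (h (lookup B m') * mono_eval x m'))"
    by (simp add: geval_sum[OF h] geval_single[OF h] hom_mult[OF h] mono_eval_add mult_ac)
  thus ?thesis by (simp add: geval_def sum_product)
qed

lemma geval_mconst [simp]: "is_hom h \<Longrightarrow> geval h x (mconst c) = h c"
  by (simp add: mconst_def geval_single)

lemma geval_mvar [simp]: "is_hom h \<Longrightarrow> geval h x (mvar i) = x i"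
  by (simp add: mvar_def geval_single hom_one)

lemma mconst_0 [simp]: "mconst 0 = 0" and mconst_1 [simp]: "mconst 1 = 1"
  by (simp_all add: mconst_def)

lemma is_hom_geval: "is_hom h \<Longrightarrow> is_hom (geval h x)"
  by (rule is_homI) (auto simp: geval_add geval_mult hom_one simp flip: mconst_1)

lemma is_hom_mconst: "is_hom mconst"
  by (rule is_homI) (auto simp: mconst_def single_add mult_single)

lemma meval_geval: "meval A x = geval (\<lambda>c. c) x A"
  by (simp add: meval_def geval_def mono_eval_def)

lemma msubst_geval: "msubst A U = geval mconst U A"
  by (simp add: msubst_def geval_def mono_eval_def)

lemma is_hom_meval: "is_hom (\<lambda>A. meval A x)"
  unfolding meval_geval by (rule is_hom_geval[OF is_hom_id])

lemmas meval_hom = is_hom_meval[THEN hom_zero] is_hom_meval[THEN hom_one] is_hom_meval[THEN hom_add]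
  is_hom_meval[THEN hom_mult] is_hom_meval[THEN hom_minus] is_hom_meval[THEN hom_sum]
  is_hom_meval[THEN hom_power] is_hom_meval[THEN hom_of_nat]

lemma is_hom_msubst: "is_hom (\<lambda>A. msubst A U)"
  unfolding msubst_geval by (rule is_hom_geval[OF is_hom_mconst])

lemmas msubst_hom = is_hom_msubst[THEN hom_zero] is_hom_msubst[THEN hom_one] is_hom_msubst[THEN hom_add]
  is_hom_msubst[THEN hom_mult] is_hom_msubst[THEN hom_minus] is_hom_msubst[THEN hom_sum]
  is_hom_msubst[THEN hom_power] is_hom_msubst[THEN hom_of_nat]

lemma msubst_mvar [simp]: "msubst (mvar i) U = (U i :: 'a::comm_ring_1 mpol)"
  and msubst_mconst [simp]: "msubst (mconst c) U = (mconst c :: 'a::comm_ring_1 mpol)"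
  by (simp_all add: msubst_geval is_hom_mconst)

lemma meval_mvar [simp]: "meval (mvar i) x = (x i :: 'a::comm_ring_1)"
  and meval_mconst [simp]: "meval (mconst c) x = (c :: 'a::comm_ring_1)"
  by (simp_all add: meval_geval is_hom_id)

lemma geval_hom_comp:
  assumes f: "is_hom f" shows "f (geval h x A) = geval (\<lambda>c. f (h c)) (\<lambda>i. f (x i)) A"
  by (simp add: geval_def hom_sum[OF f] hom_mult[OF f] mono_eval_def hom_prod[OF f] hom_power[OF f])

section \<open>The variables of a polynomial\<close>

definition vars :: "'a::zero mpol \<Rightarrow> nat set" where
  "vars A = (\<Union>m\<in>keys A. keys m)"

lemma finite_vars [simp]: "finite (vars A)"
  by (simp add: vars_def)

lemma vars_zero [simp]: "vars 0 = {}"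
  by (simp add: vars_def)

lemma vars_mconst [simp]: "vars (mconst c) = {}"
  by (auto simp: vars_def mconst_def)

lemma vars_one [simp]: "vars 1 = {}"
  by (simp add: vars_def)

lemma vars_mvar: "vars (mvar i :: 'a::comm_ring_1 mpol) = {i}"
  by (auto simp: vars_def mvar_def)

lemma vars_add: "vars A \<subseteq> V \<Longrightarrow> vars B \<subseteq> V \<Longrightarrow> vars (A + B) \<subseteq> V"
  using keys_add[of A B] unfolding vars_def by blast

lemma vars_uminus [simp]: "vars (- A :: 'a::comm_ring_1 mpol) = vars A"
  by (simp add: vars_def in_keys_iff)

lemma vars_mult:
  assumes "vars A \<subseteq> V" "vars B \<subseteq> V" shows "vars (A * B :: 'a::comm_ring_1 mpol) \<subseteq> V"
proof
  fix i assume "i \<in> vars (A * B)"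
  then obtain m where m: "m \<in> keys (A * B)" "i \<in> keys m"
    by (auto simp: vars_def)
  then obtain a b where ab: "m = a + b" "a \<in> keys A" "b \<in> keys B"
    using keys_mult[of A B] by blast
  hence "i \<in> keys a \<union> keys b"
    using m(2) keys_add[of a b] by blast
  thus "i \<in> V" using ab assms by (auto simp: vars_def)
qed

lemma vars_sum: "(\<And>i. i \<in> I \<Longrightarrow> vars (f i) \<subseteq> V) \<Longrightarrow> vars (\<Sum>i\<in>I. f i) \<subseteq> V"
  by (induction I rule: infinite_finite_induct) (simp_all add: vars_add)

lemma vars_power: "vars A \<subseteq> V \<Longrightarrow> vars (A ^ k :: 'a::comm_ring_1 mpol) \<subseteq> V"
  by (induction k) (simp_all add: vars_mult)

lemma keys_subset_vars: "m \<in> keys A \<Longrightarrow> keys m \<subseteq> vars A"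
  by (auto simp: vars_def)

lemma mpol_induct [consumes 1, case_names const var add mult]:
  fixes A :: "'a::comm_ring_1 mpol"
  assumes "vars A \<subseteq> V" "\<And>c. Q (mconst c)" "\<And>i. i \<in> V \<Longrightarrow> Q (mvar i)"
    "\<And>A B. vars A \<subseteq> V \<Longrightarrow> vars B \<subseteq> V \<Longrightarrow> Q A \<Longrightarrow> Q B \<Longrightarrow> Q (A + B)"
    "\<And>A B. vars A \<subseteq> V \<Longrightarrow> vars B \<subseteq> V \<Longrightarrow> Q A \<Longrightarrow> Q B \<Longrightarrow> Q (A * B)"
  shows "Q A"
proof -
  define Q' where "Q' = (\<lambda>B. vars B \<subseteq> V \<and> Q B)"
  have c: "Q' (mconst c)" for c using assms(2) by (simp add: Q'_def)
  have v: "Q' (mvar i)" if "i \<in> V" for i using assms(3) that by (simp add: Q'_def vars_mvar)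
  have a: "Q' (A + B)" "Q' (A * B)" if "Q' A" "Q' B" for A B
    using that assms(4,5) vars_add[of A V B] vars_mult[of A V B] by (simp_all add: Q'_def)
  have pw: "Q' (A ^ k)" if "Q' A" for A k
    by (induction k) (use c[of 1] a(2) that in auto)
  have pr: "Q' (\<Prod>i\<in>I. f i)" if "\<And>i. i \<in> I \<Longrightarrow> Q' (f i)" for I :: "nat set" and f
    using that by (induction I rule: infinite_finite_induct) (use c[of 1] a(2) in auto)
  have sm: "Q' (\<Sum>i\<in>I. f i)" if "\<And>i. i \<in> I \<Longrightarrow> Q' (f i)" for I :: "(nat \<Rightarrow>\<^sub>0 nat) set" and f
    using that by (induction I rule: infinite_finite_induct) (use c[of 0] a(1) in auto)
  have "Q' (\<Sum>m\<in>keys A. single m (lookup A m))"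
    unfolding mono_as_vars mono_eval_def
    by (intro sm a(2) c pr pw v) (use assms(1) keys_subset_vars in blast)
  thus ?thesis by (simp add: Q'_def flip: mpol_expand)
qed

lemma hom_eq_geval:
  assumes f: "is_hom f" and "vars A \<subseteq> V" "\<And>c. f (mconst c) = h c" "is_hom h" "\<And>i. i \<in> V \<Longrightarrow> f (mvar i) = x i"
  shows "f A = geval h x A"
  using assms(2)
  by (induction rule: mpol_induct)
    (simp_all add: hom_add[OF f] hom_mult[OF f] geval_add geval_mult assms(3-5))

lemma geval_cong:
  assumes "\<And>i. i \<in> vars A \<Longrightarrow> x i = y i" shows "geval h x A = geval h y A"
  unfolding geval_def mono_eval_def
proof (intro sum.cong prod.cong arg_cong2[where f = "(*)"] refl)
  fix m i assume "m \<in> keys A" "i \<in> keys m"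
  hence "i \<in> vars A" using keys_subset_vars by blast
  thus "x i ^ lookup m i = y i ^ lookup m i" using assms by simp
qed

lemma geval_ident: "geval mconst mvar A = A"
  by (rule hom_eq_geval[OF is_hom_id subset_refl, symmetric]) (auto simp: is_hom_mconst)

lemma meval_msubst: "meval (msubst A U) (x :: nat \<Rightarrow> 'a::comm_ring_1) = meval A (\<lambda>i. meval (U i) x)"
  unfolding msubst_geval
  by (subst geval_hom_comp[OF is_hom_meval]) (simp add: meval_geval is_hom_id)

lemma msubst_msubst: "msubst (msubst A U) (W :: nat \<Rightarrow> 'a::comm_ring_1 mpol) = msubst A (\<lambda>i. msubst (U i) W)"
  using geval_hom_comp[OF is_hom_msubst[of W], of mconst U A] by (simp add: msubst_geval is_hom_mconst)

lemma meval_cong: "(\<And>i. i \<in> vars A \<Longrightarrow> x i = (y i :: 'a::comm_ring_1)) \<Longrightarrow> meval A x = meval A y"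
  unfolding meval_geval by (rule geval_cong)

lemma msubst_mvar_id: "msubst (A :: 'a::comm_ring_1 mpol) mvar = A"
  by (simp add: msubst_geval geval_ident)

section \<open>Change of coefficients\<close>

lemma lookup_map: "f 0 = 0 \<Longrightarrow> lookup (map_coeffs f A) m = f (lookup A m)"
  by (simp add: Poly_Mapping.map.rep_eq when_def)

lemma map_as_geval:
  assumes s: "is_hom s" shows "map_coeffs s A = geval (\<lambda>c. mconst (s c)) mvar A"
proof -
  have "map_coeffs s A = (\<Sum>m\<in>keys A. single m (s (lookup A m)))"
    by (rule poly_mapping_eqI) (auto simp: lookup_map hom_zero[OF s] lookup_sum lookup_single when_def in_keys_iff)
  thus ?thesis by (simp add: geval_def mono_as_vars)
qed

lemma is_hom_map: "is_hom s \<Longrightarrow> is_hom (map_coeffs s :: 'a::comm_ring_1 mpol \<Rightarrow> 'b::comm_ring_1 mpol)"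
proof -
  assume s: "is_hom s"
  have *: "map_coeffs s = geval (\<lambda>c. mconst (s c)) mvar"
    by (rule ext) (rule map_as_geval[OF s])
  show ?thesis unfolding * by (rule is_hom_geval[OF is_hom_comp[OF is_hom_mconst s]])
qed

lemma geval_map:
  assumes "is_hom s" "is_hom h" shows "geval h x (map_coeffs s A) = geval (\<lambda>c. h (s c)) x A"
  unfolding map_as_geval[OF assms(1)]
  by (subst geval_hom_comp[OF is_hom_geval[OF assms(2)]]) (simp add: assms)

lemma keys_map_subset: "keys (map_coeffs f A) \<subseteq> keys A"
  by transfer auto

lemma homogeneous_map: "homogeneous n d A \<Longrightarrow> homogeneous n d (map_coeffs f A)"
  using keys_map_subset[of f A] by (auto simp: homogeneous_def)

section \<open>Homogeneous polynomials\<close>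

lemma homogeneous_vars: "homogeneous n d A \<Longrightarrow> vars A \<subseteq> {..n}"
  by (auto simp: homogeneous_def vars_def)

lemma homogeneous_0 [simp]: "homogeneous n d 0"
  by (simp add: homogeneous_def)

lemma homogeneous_add: "homogeneous n d A \<Longrightarrow> homogeneous n d B \<Longrightarrow> homogeneous n d (A + B)"
  using keys_add[of A B] unfolding homogeneous_def by blast

lemma homogeneous_uminus: "homogeneous n d A \<Longrightarrow> homogeneous n d (- A :: 'a::comm_ring_1 mpol)"
  by (auto simp: homogeneous_def in_keys_iff)

lemma homogeneous_diff:
  "homogeneous n d A \<Longrightarrow> homogeneous n d B \<Longrightarrow> homogeneous n d (A - B :: 'a::comm_ring_1 mpol)"
  using homogeneous_add[of n d A "- B"] homogeneous_uminus[of n d B] by simp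

lemma homogeneous_mult:
  assumes "homogeneous n d A" "homogeneous n e B"
  shows "homogeneous n (d + e) (A * B :: 'a::comm_ring_1 mpol)"
  unfolding homogeneous_def
proof
  fix m assume "m \<in> keys (A * B)"
  then obtain a b where ab: "m = a + b" "a \<in> keys A" "b \<in> keys B"
    using keys_mult[of A B] by blast
  thus "keys m \<subseteq> {..n} \<and> (\<Sum>i\<le>n. lookup m i) = d + e"
    using assms keys_add[of a b] unfolding homogeneous_def by (fastforce simp: lookup_add sum.distrib)
qed

lemma homogeneous_mconst: "homogeneous n 0 (mconst c)"
  by (auto simp: homogeneous_def mconst_def)

lemma homogeneous_one: "homogeneous n 0 (1 :: 'a::comm_ring_1 mpol)"
  using homogeneous_mconst[of n "1 :: 'a"] by simp

lemma homogeneous_mvar: "i \<le> n \<Longrightarrow> homogeneous n 1 (mvar i :: 'a::comm_ring_1 mpol)"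
  by (auto simp: homogeneous_def mvar_def lookup_single when_def)

lemma homogeneous_sum:
  "(\<And>i. i \<in> I \<Longrightarrow> homogeneous n d (f i)) \<Longrightarrow> homogeneous n d (\<Sum>i\<in>I. f i :: 'a::comm_ring_1 mpol)"
  by (induction I rule: infinite_finite_induct) (auto intro: homogeneous_add)

lemma homogeneous_power: "homogeneous n d A \<Longrightarrow> homogeneous n (d * k) (A ^ k :: 'a::comm_ring_1 mpol)"
  by (induction k) (auto intro: homogeneous_one homogeneous_mult)

lemma homogeneous_prod:
  "(\<And>i. i \<in> I \<Longrightarrow> homogeneous n (e i) (f i)) \<Longrightarrow> homogeneous n (\<Sum>i\<in>I. e i) (\<Prod>i\<in>I. f i :: 'a::comm_ring_1 mpol)"
  by (induction I rule: infinite_finite_induct) (auto intro: homogeneous_one homogeneous_mult)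

lemma homogeneous_keys_degree:
  assumes "homogeneous n d A" "m \<in> keys A"
  shows "(\<Sum>i\<in>keys m. lookup m i) = d"
proof -
  have "(\<Sum>i\<le>n. lookup m i) = d" "keys m \<subseteq> {..n}"
    using assms by (auto simp: homogeneous_def)
  thus ?thesis by (subst sum.mono_neutral_left[of "{..n}"]) (auto simp: in_keys_iff)
qed

lemma homogeneous_msubst:
  assumes A: "homogeneous n g A" and U: "\<And>i. i \<le> n \<Longrightarrow> homogeneous n' e (U i)"
  shows "homogeneous n' (e * g) (msubst A U :: 'a::comm_ring_1 mpol)"
  unfolding msubst_def
proof (rule homogeneous_sum)
  fix m assume m: "m \<in> keys A"
  have "homogeneous n' (0 + (\<Sum>i\<in>keys m. e * lookup m i))
      (mconst (lookup A m) * (\<Prod>i\<in>keys m. U i ^ lookup m i))"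
    by (intro homogeneous_mult homogeneous_mconst homogeneous_prod homogeneous_power U)
       (use m homogeneous_vars[OF A] in \<open>auto simp: vars_def\<close>)
  thus "homogeneous n' (e * g) \<dots>"
    by (simp add: homogeneous_keys_degree[OF A m] flip: sum_distrib_left)
qed

lemma geval_scale:
  assumes "homogeneous n d A" shows "geval h (\<lambda>i. c * x i) A = c ^ d * geval h x A"
proof -
  have "mono_eval (\<lambda>i. c * x i) m = c ^ d * mono_eval x m" if "m \<in> keys A" for m
    by (simp add: mono_eval_def power_mult_distrib prod.distrib homogeneous_keys_degree[OF assms that] flip: power_sum)
  thus ?thesis by (simp add: geval_def sum_distrib_left mult_ac)
qed

lemma meval_scale: "homogeneous n d A \<Longrightarrow> meval A (\<lambda>i. c * x i :: 'a::comm_ring_1) = c ^ d * meval A x"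
  unfolding meval_geval by (rule geval_scale)

lemma msubst_scale: "homogeneous n d A \<Longrightarrow> msubst A (\<lambda>i. c * x i :: 'a::comm_ring_1 mpol) = c ^ d * msubst A x"
  unfolding msubst_geval by (rule geval_scale)

lemma homogeneous_degree_unique:
  assumes "homogeneous n d A" "homogeneous n e A" "A \<noteq> 0" shows "d = e"
proof -
  obtain m where "m \<in> keys A" using assms(3) by (metis all_not_in_conv keys_eq_empty)
  thus ?thesis using assms(1,2) by (auto simp: homogeneous_def)
qed

lemma homogeneous_0_mconst:
  assumes "homogeneous n 0 A" shows "A = mconst (lookup A 0)"
proof (rule poly_mapping_eqI)
  fix m show "lookup A m = lookup (mconst (lookup A 0)) m"
  proof (cases "m \<in> keys A")
    case True
    hence "keys m \<subseteq> {..n}" "(\<Sum>i\<le>n. lookup m i) = 0"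
      using assms by (auto simp: homogeneous_def)
    hence "lookup m i = 0" for i by (cases "i \<le> n") (auto simp: in_keys_iff subset_iff)
    hence "m = 0" by (simp add: poly_mapping_eqI)
    thus ?thesis by (simp add: mconst_def)
  next
    case False
    thus ?thesis by (auto simp: mconst_def lookup_single when_def in_keys_iff)
  qed
qed

section \<open>The total degree\<close>

text \<open>
  Each variable is multiplied by a new variable, the one of the outer univariate polynomial.  The
  coefficients are then the homogeneous components, and the total degree inherits its additivity
  from the degree of univariate polynomials.
\<close>

definition grade :: "'a::comm_ring_1 mpol \<Rightarrow> 'a mpol poly" where
  "grade = geval (\<lambda>c. [:mconst c:]) (\<lambda>i. monom (mvar i) 1)"

lemma is_hom_pconst: "is_hom (\<lambda>c. [:mconst c:])"
  by (rule is_homI) (auto simp: hom_add[OF is_hom_mconst] hom_mult[OF is_hom_mconst])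

lemma is_hom_grade: "is_hom grade"
  unfolding grade_def by (rule is_hom_geval[OF is_hom_pconst])

lemmas grade_hom = is_hom_grade[THEN hom_zero] is_hom_grade[THEN hom_one] is_hom_grade[THEN hom_add]
  is_hom_grade[THEN hom_mult] is_hom_grade[THEN hom_minus] is_hom_grade[THEN hom_sum]
  is_hom_grade[THEN hom_power] is_hom_grade[THEN hom_of_nat]

lemma is_hom_poly: "is_hom (\<lambda>p. poly p x)"
  by (rule is_homI) auto

lemma grade_at_1: "poly (grade A) 1 = A"
  unfolding grade_def
  by (subst geval_hom_comp[OF is_hom_poly]) (simp add: poly_monom geval_ident)

lemma grade_eq_0_iff [simp]: "grade A = 0 \<longleftrightarrow> A = 0"
  using grade_at_1[of A] by (auto simp: grade_hom)

lemma grade_expand: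
  "grade A = (\<Sum>m\<in>keys A. monom (single m (lookup A m))
      (\<Sum>i\<in>keys m. lookup m i))"
proof -
  have *: "(\<Prod>i\<in>I. monom (f i) (e i)) = monom (\<Prod>i\<in>I. f i) (\<Sum>i\<in>I. e i)"
     for I and f :: "nat \<Rightarrow> 'a mpol" and e :: "nat \<Rightarrow> nat"
    by (induction I rule: infinite_finite_induct) (simp_all add: mult_monom)
  show ?thesis
    unfolding grade_def geval_def mono_eval_def
    by (intro sum.cong refl) (simp add: monom_power * mono_as_vars mono_eval_def smult_monom)
qed

lemma grade_homogeneous: "homogeneous n d A \<Longrightarrow> grade A = monom A d"
proof -
  assume A: "homogeneous n d A"
  have "grade A = (\<Sum>m\<in>keys A. monom (single m (lookup A m)) d)"
    unfolding grade_expand by (intro sum.cong refl) (simp add: homogeneous_keys_degree[OF A])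
  also have "\<dots> = monom (\<Sum>m\<in>keys A. single m (lookup A m)) d"
    by (rule poly_eqI) (simp add: coeff_sum)
  finally show ?thesis by (simp flip: mpol_expand)
qed

lemma homogeneous_coeff_grade:
  assumes "vars A \<subseteq> {..n}" shows "homogeneous n k (coeff (grade A) k)"
proof -
  have "homogeneous n k (coeff (monom (single m (lookup A m))
     (\<Sum>i\<in>keys m. lookup m i)) k)" if "m \<in> keys A" for m
  proof -
    have m: "keys m \<subseteq> {..n}" using assms that by (auto simp: vars_def)
    have "(\<Sum>i\<in>keys m. lookup m i) = (\<Sum>i\<le>n. lookup m i)"
      by (rule sum.mono_neutral_left) (use m in \<open>auto simp: in_keys_iff\<close>)
    thus ?thesis using m by (auto simp: homogeneous_def)
  qed
  thus ?thesis unfolding grade_expand coeff_sum by (rule homogeneous_sum)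
qed

lemma vars_coeff_grade: "vars (coeff (grade A) k) \<subseteq> vars A"
proof -
  have "vars (coeff (monom (single m (lookup A m)) e) k) \<subseteq> vars A"
    if "m \<in> keys A" for m e
    using that by (auto simp: vars_def)
  thus ?thesis unfolding grade_expand coeff_sum by (rule vars_sum)
qed

definition tdeg :: "'a::comm_ring_1 mpol \<Rightarrow> nat" where
  "tdeg A = degree (grade A)"

lemma tdeg_mult: "A \<noteq> 0 \<Longrightarrow> B \<noteq> 0 \<Longrightarrow> tdeg (A * B :: 'a::idom mpol) = tdeg A + tdeg B"
  by (simp add: tdeg_def grade_hom degree_mult_eq)

lemma tdeg_homogeneous: "homogeneous n d A \<Longrightarrow> A \<noteq> 0 \<Longrightarrow> tdeg A = d"
  by (simp add: tdeg_def grade_homogeneous degree_monom_eq)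

lemma tdeg_0_mconst:
  assumes "tdeg A = 0" obtains c where "A = mconst c"
proof -
  obtain n where n: "vars A \<subseteq> {..n}" using finite_nat_iff_bounded_le[of "vars A"] by auto
  obtain B where B: "grade A = [:B:]" using assms unfolding tdeg_def by (rule degree_eq_zeroE)
  hence "A = B" using grade_at_1[of A] by simp
  moreover have "homogeneous n 0 B" using homogeneous_coeff_grade[OF n, of 0] by (simp add: B)
  ultimately show ?thesis using homogeneous_0_mconst that by blast
qed

definition top_part :: "'a::comm_ring_1 mpol \<Rightarrow> 'a mpol" where
  "top_part A = lead_coeff (grade A)"

lemma top_part:
  assumes "A \<noteq> 0" "vars A \<subseteq> {..n}"
  shows "top_part A \<noteq> 0" "homogeneous n (tdeg A) (top_part A)" "vars (top_part A) \<subseteq> vars A"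
  using assms homogeneous_coeff_grade[of A n "tdeg A"] vars_coeff_grade[of A "tdeg A"]
  by (auto simp: top_part_def tdeg_def)

section \<open>Derivations\<close>

definition derivation :: "('a::comm_ring_1 mpol \<Rightarrow> 'a mpol) \<Rightarrow> bool" where
  "derivation D \<longleftrightarrow> (\<forall>A B. D (A + B) = D A + D B) \<and> (\<forall>A B. D (A * B) = D A * B + A * D B)
     \<and> (\<forall>c. D (mconst c) = 0)"

lemma
  assumes "derivation D"
  shows derivation_add: "D (A + B) = D A + D B"
    and derivation_mult: "D (A * B) = D A * B + A * D B"
    and derivation_mconst: "D (mconst c) = 0"
  using assms by (auto simp: derivation_def)

lemma derivation_0: "derivation D \<Longrightarrow> D 0 = 0"
  using derivation_mconst[of D 0] by simp

lemma derivation_1: "derivation D \<Longrightarrow> D 1 = 0"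
  using derivation_mconst[of D 1] by simp

lemma derivation_sum: "derivation D \<Longrightarrow> D (\<Sum>i\<in>I. f i) = (\<Sum>i\<in>I. D (f i))"
  by (induction I rule: infinite_finite_induct) (auto simp: derivation_0 derivation_add)

lemma derivation_power:
  assumes "derivation D" shows "D (A ^ k) = of_nat k * A ^ (k - 1) * D A"
proof (induction k)
  case (Suc k)
  have "D (A ^ Suc k) = D A * A ^ k + of_nat k * (A * A ^ (k - 1)) * D A"
    by (simp add: derivation_mult[OF assms] Suc mult_ac)
  also have "of_nat k * (A * A ^ (k - 1)) = of_nat k * A ^ k"
    by (cases k) auto
  finally show ?case by (simp add: algebra_simps)
qed (simp add: derivation_1[OF assms])

lemma derivation_combination:
  assumes "\<And>i. i \<in> I \<Longrightarrow> derivation (D i)"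
  shows "derivation (\<lambda>A. \<Sum>i\<in>I. T i * D i A)"
proof -
  have "(\<Sum>i\<in>I. T i * D i (A + B)) = (\<Sum>i\<in>I. T i * D i A) + (\<Sum>i\<in>I. T i * D i B)" for A B
    by (subst sum.distrib[symmetric], rule sum.cong) (auto simp: derivation_add[OF assms] algebra_simps)
  moreover have "(\<Sum>i\<in>I. T i * D i (A * B)) = (\<Sum>i\<in>I. T i * D i A) * B + A * (\<Sum>i\<in>I. T i * D i B)" for A B
    unfolding sum_distrib_left sum_distrib_right
    by (subst sum.distrib[symmetric], rule sum.cong) (auto simp: derivation_mult[OF assms] algebra_simps)
  moreover have "(\<Sum>i\<in>I. T i * D i (mconst c)) = 0" for c
    by (rule sum.neutral) (auto simp: derivation_mconst[OF assms])
  ultimately show ?thesis by (simp add: derivation_def)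
qed

lemma derivation_diff:
  assumes "derivation D" "derivation E" shows "derivation (\<lambda>A. S * D A - T * E A)"
  unfolding derivation_def
  by (simp add: derivation_add[OF assms(1)] derivation_add[OF assms(2)] derivation_mult[OF assms(1)]
    derivation_mult[OF assms(2)] derivation_mconst[OF assms(1)] derivation_mconst[OF assms(2)] algebra_simps)

text \<open>
  Read from the target monomial upwards, the formula is free of truncated subtraction.
\<close>

lemma lookup_partial:
  "lookup (partial i A) m =
     of_nat (lookup m i + 1) * lookup A (m + single i 1)"
proof -
  let ?m = "m + single i 1"
  let ?f = "\<lambda>k. of_nat (lookup k i) * lookup A k when k - single i 1 = m"
  have "?f k = 0" if "k \<noteq> ?m" for k
  proof (cases "lookup k i = 0")
    case False
    have "k - single i 1 \<noteq> m"
    proof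
      assume *: "k - single i 1 = m"
      have "k = ?m"
        by (rule poly_mapping_eqI)
           (use False in \<open>auto simp: *[symmetric] lookup_add lookup_minus lookup_single when_def\<close>)
      thus False using that by simp
    qed
    thus ?thesis by simp
  qed simp
  hence "(\<Sum>k\<in>keys A. ?f k) = (\<Sum>k\<in>keys A. if k = ?m then ?f ?m else 0)"
    by (intro sum.cong) auto
  also have "\<dots> = ?f ?m" by (auto simp: in_keys_iff)
  also have "\<dots> = of_nat (lookup m i + 1) * lookup A ?m"
    by (simp add: lookup_add)
  finally show ?thesis by (simp add: partial_def lookup_sum lookup_single)
qed

lemma partial_add: "partial i (A + B) = partial i A + partial i B"
  by (rule poly_mapping_eqI) (simp add: lookup_partial lookup_add algebra_simps)

lemma partial_zero [simp]: "partial i 0 = 0"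
  by (simp add: partial_def)

lemma partial_sum: "partial i (\<Sum>j\<in>I. f j) = (\<Sum>j\<in>I. partial i (f j))"
  by (induction I rule: infinite_finite_induct) (simp_all add: partial_add)

lemma partial_single: "partial i (single m c) =
  single (m - single i 1) (of_nat (lookup m i) * c)"
  by (cases "c = 0") (simp_all add: partial_def)

lemma partial_mult_single:
  fixes c d :: "'a::comm_ring_1"
  shows "partial i (single a c * single b d) =
     partial i (single a c) * single b d
     + single a c * partial i (single b d)"
proof -
  let ?e = "single i 1 :: nat \<Rightarrow>\<^sub>0 nat"
  have 1: "single (a - ?e + b) (of_nat (lookup a i) * c * d)
     = single (a + b - ?e) (of_nat (lookup a i) * c * d)"
  proof (cases "lookup a i = 0")
    case False
    hence "a - ?e + b = a + b - ?e"
      by (intro poly_mapping_eqI) (auto simp: lookup_add lookup_minus lookup_single when_def)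
    thus ?thesis by simp
  qed simp
  have 2: "single (a + (b - ?e)) (c * (of_nat (lookup b i) * d))
     = single (a + b - ?e) (c * (of_nat (lookup b i) * d))"
  proof (cases "lookup b i = 0")
    case False
    hence "a + (b - ?e) = a + b - ?e"
      by (intro poly_mapping_eqI) (auto simp: lookup_add lookup_minus lookup_single when_def)
    thus ?thesis by simp
  qed simp
  have "partial i (single a c * single b d) =
     single (a + b - ?e) (of_nat (lookup a i) * c * d)
     + single (a + b - ?e) (c * (of_nat (lookup b i) * d))"
    unfolding single_add[symmetric] mult_single partial_single lookup_add of_nat_add
    by (simp only: ring_distribs mult_ac)
  thus ?thesis unfolding 1[symmetric] 2[symmetric] by (simp only: partial_single mult_single)
qed

lemma partial_mult:
  fixes A B :: "'a::comm_ring_1 mpol"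
  shows "partial i (A * B) = partial i A * B + A * partial i B"
proof -
  let ?s = "\<lambda>A m. single m (lookup A m :: 'a)"
  have "partial i (A * B) = partial i ((\<Sum>m\<in>keys A. ?s A m) * (\<Sum>m\<in>keys B. ?s B m))"
    by (simp flip: mpol_expand)
  also have "\<dots> = (\<Sum>m\<in>keys A. \<Sum>m'\<in>keys B. partial i (?s A m * ?s B m'))"
    by (simp add: sum_product partial_sum)
  also have "\<dots> = (\<Sum>m\<in>keys A. \<Sum>m'\<in>keys B. partial i (?s A m) * ?s B m')
     + (\<Sum>m\<in>keys A. \<Sum>m'\<in>keys B. ?s A m * partial i (?s B m'))"
    by (simp add: partial_mult_single sum.distrib)
  also have "\<dots> = partial i (\<Sum>m\<in>keys A. ?s A m) * (\<Sum>m\<in>keys B. ?s B m)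
     + (\<Sum>m\<in>keys A. ?s A m) * partial i (\<Sum>m\<in>keys B. ?s B m)"
    by (simp only: partial_sum sum_product)
  finally show ?thesis by (simp flip: mpol_expand)
qed

lemma partial_mconst [simp]: "partial i (mconst c) = 0"
  by (simp add: mconst_def partial_single)

lemma derivation_partial: "derivation (partial i)"
  by (simp add: derivation_def partial_add partial_mult)

lemma partial_mvar: "partial i (mvar j) = (if i = j then 1 else 0 :: 'a::comm_ring_1 mpol)"
  by (auto simp: mvar_def partial_single lookup_single when_def)

lemma keys_partial:
  "m \<in> keys (partial i A) \<Longrightarrow> m + single i 1 \<in> keys A"
  unfolding in_keys_iff lookup_partial by auto

lemma keys_add_nat: "keys (a + b :: nat \<Rightarrow>\<^sub>0 nat) = keys a \<union> keys b"
  by (auto simp: in_keys_iff lookup_add)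

lemma vars_partial: "vars (partial i A) \<subseteq> vars A"
  by (auto simp: vars_def keys_add_nat dest!: keys_partial)

lemma homogeneous_partial:
  assumes "homogeneous n d A" shows "homogeneous n (d - 1) (partial i A)"
  unfolding homogeneous_def
proof
  fix m assume "m \<in> keys (partial i A)"
  hence *: "keys m \<union> {i} \<subseteq> {..n}" "(\<Sum>j\<le>n. lookup (m + single i 1) j) = d"
    using assms keys_partial[of m i A] unfolding homogeneous_def by (fastforce simp: keys_add_nat)+
  have "(\<Sum>j\<le>n. lookup (m + single i 1) j) = (\<Sum>j\<le>n. lookup m j) + 1"
    using *(1) by (simp add: lookup_add sum.distrib lookup_single when_def)
  thus "keys m \<subseteq> {..n} \<and> (\<Sum>j\<le>n. lookup m j) = d - 1" using * by auto
qed

lemma partial_map: "is_hom s \<Longrightarrow> partial i (map_coeffs s A) = map_coeffs s (partial i A)"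
  by (rule poly_mapping_eqI)
    (simp add: lookup_partial lookup_map hom_zero hom_mult hom_add hom_one hom_of_nat)

lemma euler:
  fixes A :: "'a::comm_ring_1 mpol"
  assumes A: "homogeneous n d A" shows "(\<Sum>i\<le>n. mvar i * partial i A) = of_nat d * A"
proof -
  let ?s = "\<lambda>m. single m (lookup A m)"
  have 1: "mvar i * partial i (?s m) = of_nat (lookup m i) * ?s m" for i m
  proof (cases "lookup m i = 0")
    case False
    hence "single i 1 + (m - single i 1) = m"
      by (intro poly_mapping_eqI) (auto simp: lookup_add lookup_minus lookup_single when_def)
    thus ?thesis by (simp add: mvar_def partial_single mult_single flip: single_of_nat)
  qed (simp add: partial_single)
  have "(\<Sum>i\<le>n. mvar i * partial i (\<Sum>m\<in>keys A. ?s m)) =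
     (\<Sum>m\<in>keys A. \<Sum>i\<le>n. of_nat (lookup m i) * ?s m)"
    by (subst sum.swap) (simp add: partial_sum sum_distrib_left 1)
  also have "\<dots> = (\<Sum>m\<in>keys A. of_nat d * ?s m)"
    by (intro sum.cong refl)
       (use A in \<open>auto simp: homogeneous_def simp flip: sum_distrib_right of_nat_sum\<close>)
  finally show ?thesis by (simp flip: mpol_expand sum_distrib_left)
qed

lemma chain_rule:
  assumes D: "derivation D" and A: "vars A \<subseteq> {..n}"
  shows "D (msubst A U) = (\<Sum>i\<le>n. msubst (partial i A) U * D (U i))"
  using A
proof (induction rule: mpol_induct)
  case (const c)
  thus ?case by (simp add: derivation_mconst[OF D] msubst_hom)
next
  case (var i)
  have "(\<Sum>j\<le>n. msubst (partial j (mvar i)) U * D (U j)) = (\<Sum>j\<le>n. if i = j then D (U j) else 0)"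
    by (intro sum.cong refl) (simp add: partial_mvar msubst_hom)
  also have "\<dots> = D (U i)" using var by simp
  finally show ?case by simp
next
  case (add A B)
  thus ?case
    by (simp add: msubst_hom partial_add derivation_add[OF D] ring_distribs sum.distrib)
next
  case (mult A B)
  thus ?case
    by (simp add: msubst_hom partial_mult derivation_mult[OF D]
      ring_distribs sum.distrib sum_distrib_left sum_distrib_right mult_ac)
qed

section \<open>Units and irreducible polynomials\<close>

lemma mconst_dvd_1: "c \<noteq> 0 \<Longrightarrow> mconst (c :: 'a::field) dvd 1"
  by (rule dvdI[of _ _ "mconst (inverse c)"]) (simp flip: hom_mult[OF is_hom_mconst])

lemma tdeg_1 [simp]: "tdeg 1 = 0"
  by (simp add: tdeg_def grade_hom)

lemma dvd_1_imp_tdeg: "(A :: 'a::idom mpol) dvd 1 \<Longrightarrow> tdeg A = 0"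
  by (metis add_is_0 dvd_def mult_not_zero tdeg_1 tdeg_mult zero_neq_one)

lemma tdeg_0_imp_dvd_1: "tdeg (A :: 'a::field mpol) = 0 \<Longrightarrow> A \<noteq> 0 \<Longrightarrow> A dvd 1"
  by (erule tdeg_0_mconst) (auto intro!: mconst_dvd_1)

lemma irreducible_not_power:
  assumes "Factorial_Ring.irreducible (B ^ p :: 'a::idom mpol)" "p \<ge> 2" shows False
proof -
  have "B * B ^ (p - 1) = B ^ p" using assms(2) by (simp flip: power_Suc)
  hence "B dvd 1 \<or> B ^ (p - 1) dvd 1" using assms(1) by (metis irreducibleD)
  moreover have "B dvd B ^ (p - 1)" using assms(2) by (intro dvd_power) auto
  ultimately have "B dvd 1" using dvd_trans by blast
  hence "B ^ p dvd 1" using dvd_power_same[of B 1 p] by simp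
  thus False using assms(1) by (auto simp: irreducible_def)
qed

section \<open>Frobenius\<close>

lemma CHAR_mpol: "CHAR('a::comm_ring_1 mpol) = CHAR('a)"
proof (rule CHAR_eqI)
  show "of_nat CHAR('a) = (0 :: 'a mpol)" by (simp flip: single_of_nat)
  fix k assume "of_nat k = (0 :: 'a mpol)"
  hence "lookup (of_nat k :: 'a mpol) 0 = 0" by simp
  hence "of_nat k = (0 :: 'a)" by (simp add: lookup_of_nat)
  thus "CHAR('a) dvd k" by (simp add: of_nat_eq_0_iff_char_dvd)
qed

lemma is_hom_frobenius:
  assumes "prime CHAR('a::comm_ring_1)" shows "is_hom (\<lambda>c::'a. c ^ CHAR('a) ^ r)"
  by (rule is_homI) (auto simp: power_mult_distrib freshmans_dream'[OF assms refl])

lemma is_hom_frobenius_mpol: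
  assumes "prime CHAR('a::comm_ring_1)" shows "is_hom (\<lambda>c::'a mpol. c ^ CHAR('a) ^ r)"
  using is_hom_frobenius[where 'a = "'a mpol"] assms by (simp add: CHAR_mpol)

lemma msubst_frobenius:
  fixes A :: "'a::comm_ring_1 mpol"
  assumes p: "prime CHAR('a)" and P: "P = CHAR('a) ^ r"
  shows "msubst A U ^ P = msubst (map_coeffs (\<lambda>c. c ^ P) A) (\<lambda>i. U i ^ P)"
  unfolding msubst_geval P
  using geval_hom_comp[OF is_hom_frobenius_mpol[OF p], of mconst U A r]
  by (simp add: geval_map[OF is_hom_frobenius[OF p] is_hom_mconst] hom_power[OF is_hom_mconst])

lemma alg_closed_root:
  assumes "k > 0" shows "\<exists>y::'a::alg_closed_field. y ^ k = c"
  using nth_root_exists[OF assms] by blast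

text \<open>
  This turns an equation satisfied by the powers \<open>U\<^sub>i\<^sup>P\<close> into one that is satisfied by the \<open>U\<^sub>i\<close>.
\<close>

lemma frobenius_twist_surj:
  fixes A :: "'a::alg_closed_field mpol"
  assumes "P > 0" obtains B where "map_coeffs (\<lambda>c. c ^ P) B = A"
    "\<And>n d. homogeneous n d A \<Longrightarrow> homogeneous n d B"
proof -
  obtain g where g: "\<And>c::'a. g c ^ P = c" using alg_closed_root[OF assms] by metis
  have "g 0 = 0" using g[of 0] assms by simp
  hence "map_coeffs (\<lambda>c. c ^ P) (map_coeffs g A) = A"
    using g assms by (intro poly_mapping_eqI) (simp add: lookup_map)
  thus ?thesis using that homogeneous_map by blast
qed

lemma single_power:
  "single (m :: nat \<Rightarrow>\<^sub>0 nat) (c::'a::comm_ring_1) ^ k = single (map_coeffs ((*) k) m) (c ^ k)"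
proof (induction k)
  case 0
  have "map_coeffs (\<lambda>_. 0 :: nat) m = 0" by (rule poly_mapping_eqI) (simp add: lookup_map)
  thus ?case by simp
next
  case (Suc k)
  have "m + map_coeffs ((*) k) m = map_coeffs ((*) (Suc k)) m"
    by (rule poly_mapping_eqI) (simp add: lookup_map lookup_add)
  thus ?case unfolding power_Suc Suc mult_single by (rule arg_cong)
qed

text \<open>
  A vanishing partial derivative forces the exponents of its variable to be multiples of the
  characteristic.  If this happens for all variables, then the \<open>p\<close>-th roots of the coefficients
  give a \<open>p\<close>-th root of the polynomial, because Frobenius is additive.
\<close>

lemma partials_zero_imp_power:
  fixes A :: "'a::alg_closed_field mpol"
  assumes p: "prime CHAR('a)" and V: "\<And>i. i \<in> vars A \<Longrightarrow> partial i A = 0"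
  obtains B where "A = B ^ CHAR('a)" "vars B \<subseteq> vars A"
proof -
  let ?p = "CHAR('a)"
  have p0: "?p > 0" using p prime_gt_0_nat by blast
  obtain g where g: "\<And>c::'a. g c ^ ?p = c" using alg_closed_root[OF p0] by metis
  define B where "B = (\<Sum>m\<in>keys A. single (map_coeffs (\<lambda>k. k div ?p) m) (g (lookup A m)))"
  have dv: "?p dvd lookup m i" if "m \<in> keys A" for m i
  proof (cases "lookup m i = 0")
    case False
    hence "i \<in> vars A" using that by (auto simp: vars_def in_keys_iff)
    hence "lookup (partial i A) (m - single i 1) = 0" using V by simp
    moreover have "m - single i 1 + single i 1 = m"
      using False by (intro poly_mapping_eqI) (auto simp: lookup_add lookup_minus lookup_single when_def)
    moreover have "lookup (m - single i 1) i + 1 = lookup m i"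
      using False by (simp add: lookup_minus)
    ultimately have "of_nat (lookup m i) * lookup A m = 0"
      by (simp only: lookup_partial)
    hence "of_nat (lookup m i) = (0::'a)" using that by (auto simp: in_keys_iff)
    thus ?thesis by (simp add: of_nat_eq_0_iff_char_dvd)
  qed simp
  have "B ^ ?p = (\<Sum>m\<in>keys A. single (map_coeffs (\<lambda>k. k div ?p) m) (g (lookup A m)) ^ ?p)"
    unfolding B_def by (rule freshmans_dream_sum) (use p in \<open>simp_all add: CHAR_mpol\<close>)
  also have "\<dots> = (\<Sum>m\<in>keys A. single m (lookup A m))"
  proof (rule sum.cong[OF refl])
    fix m assume m: "m \<in> keys A"
    have "map_coeffs ((*) ?p) (map_coeffs (\<lambda>k. k div ?p) m) = m"
      by (rule poly_mapping_eqI) (use dv[OF m] in \<open>simp add: lookup_map\<close>)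
    thus "single (map_coeffs (\<lambda>k. k div ?p) m) (g (lookup A m)) ^ ?p
       = single m (lookup A m)"
      by (simp add: single_power g)
  qed
  finally have "B ^ ?p = A" by (simp flip: mpol_expand)
  moreover have "vars B \<subseteq> vars A" unfolding B_def
  proof (rule vars_sum)
    fix m assume m: "m \<in> keys A"
    have "vars (single (map_coeffs (\<lambda>k. k div ?p) m) (g (lookup A m)))
      \<subseteq> keys (map_coeffs (\<lambda>k. k div ?p) m)"
      by (auto simp: vars_def)
    also have "\<dots> \<subseteq> keys m" by (rule keys_map_subset)
    also have "\<dots> \<subseteq> vars A" using keys_subset_vars m by blast
    finally show "vars (single (map_coeffs (\<lambda>k. k div ?p) m) (g (lookup A m))) \<subseteq> vars A" .
  qed
  ultimately show ?thesis using that by metis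
qed

section \<open>Gauss's lemma over a subring\<close>

lemma smult_cancel:
  assumes "smult c p = smult c q" "c \<noteq> (0::'a::idom)" shows "p = q"
proof -
  have "smult c (p - q) = 0" using assms(1) by (simp add: smult_diff_right)
  thus ?thesis using assms(2) by simp
qed

text \<open>
  All polynomials share one type with infinitely many variables, so an induction on the number of
  variables takes place inside it: the polynomials in finitely many of the variables are the
  subring \<open>S\<close>.  Saturation says that divisibility in \<open>S\<close> is divisibility in the whole ring.
\<close>

locale saturated_subring =
  fixes S :: "'a::idom set"
  assumes one_closed: "1 \<in> S"
    and add_closed: "a \<in> S \<Longrightarrow> b \<in> S \<Longrightarrow> a + b \<in> S"
    and uminus_closed: "a \<in> S \<Longrightarrow> - a \<in> S"
    and mult_closed: "a \<in> S \<Longrightarrow> b \<in> S \<Longrightarrow> a * b \<in> S"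
    and saturated: "a \<in> S \<Longrightarrow> a * b \<in> S \<Longrightarrow> a \<noteq> 0 \<Longrightarrow> b \<in> S"
begin

lemma zero_closed: "0 \<in> S"
  using add_closed[OF one_closed uminus_closed[OF one_closed]] by simp

lemma diff_closed: "a \<in> S \<Longrightarrow> b \<in> S \<Longrightarrow> a - b \<in> S"
  using add_closed[of a "- b"] uminus_closed by simp

lemma sum_closed: "(\<And>i. i \<in> I \<Longrightarrow> f i \<in> S) \<Longrightarrow> (\<Sum>i\<in>I. f i) \<in> S"
  by (induction I rule: infinite_finite_induct) (auto intro: zero_closed add_closed)

lemma power_closed: "a \<in> S \<Longrightarrow> a ^ k \<in> S"
  by (induction k) (auto intro: one_closed mult_closed)

definition polys :: "'a poly set" where
  "polys = {p. \<forall>i. coeff p i \<in> S}"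

lemma coeff_closed: "p \<in> polys \<Longrightarrow> coeff p i \<in> S"
  by (simp add: polys_def)

lemma polys_const [simp]: "[:c:] \<in> polys \<longleftrightarrow> c \<in> S"
  by (auto simp: polys_def coeff_pCons zero_closed split: nat.splits intro: spec[of _ 0])

lemma polys_0: "0 \<in> polys" and polys_1: "1 \<in> polys"
  by (auto simp: polys_def zero_closed one_closed coeff_1)

lemma polys_add: "p \<in> polys \<Longrightarrow> q \<in> polys \<Longrightarrow> p + q \<in> polys"
  by (auto simp: polys_def add_closed)

lemma polys_diff: "p \<in> polys \<Longrightarrow> q \<in> polys \<Longrightarrow> p - q \<in> polys"
  by (auto simp: polys_def diff_closed)

lemma polys_mult: "p \<in> polys \<Longrightarrow> q \<in> polys \<Longrightarrow> p * q \<in> polys"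
  by (auto simp: polys_def coeff_mult intro!: sum_closed mult_closed)

lemma polys_smult: "c \<in> S \<Longrightarrow> p \<in> polys \<Longrightarrow> smult c p \<in> polys"
  by (auto simp: polys_def mult_closed)

lemma polys_monom: "c \<in> S \<Longrightarrow> monom c k \<in> polys"
  by (auto simp: polys_def zero_closed)

lemma polys_saturated:
  assumes "p \<in> polys" "p \<noteq> 0" "p * q \<in> polys" shows "q \<in> polys"
  using assms(3)
proof (induction "degree q" arbitrary: q rule: less_induct)
  case less
  show ?case
  proof (cases "q = 0")
    case False
    let ?m = "monom (lead_coeff q) (degree q)"
    have "lead_coeff p * lead_coeff q \<in> S"
      using coeff_closed[OF less.prems, of "degree (p * q)"] by (simp only: lead_coeff_mult)
    hence m: "?m \<in> polys"
      using saturated[of "lead_coeff p"] assms coeff_closed[OF assms(1)] by (auto intro: polys_monom)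
    have "p * (q - ?m) \<in> polys"
      using polys_diff[OF less.prems polys_mult[OF assms(1) m]] by (simp add: algebra_simps)
    moreover have "q - ?m = 0 \<or> degree (q - ?m) < degree q"
      by (rule eq_zero_or_degree_less) (auto intro: degree_diff_le degree_monom_le)
    ultimately have "q - ?m \<in> polys" using less.hyps polys_0 by auto
    thus ?thesis using polys_add[OF _ m, of "q - ?m"] by simp
  qed (simp add: polys_0)
qed

lemma smult_polys_cancel:
  assumes "smult c p \<in> polys" "c \<in> S" "c \<noteq> 0" shows "p \<in> polys"
  using polys_saturated[of "[:c:]" p] assms by simp

text \<open>
  Primality against elements of the subring only: this is what the induction on the variables
  supplies, and primality in the whole ring is what it eventually proves.
\<close>

definition sprime :: "'a \<Rightarrow> bool" where
  "sprime \<pi> \<longleftrightarrow> \<pi> \<in> S \<and> \<pi> \<noteq> 0 \<and> \<not> \<pi> dvd 1 \<and> (\<forall>a\<in>S. \<forall>b\<in>S. \<pi> dvd a * b \<longrightarrow> \<pi> dvd a \<or> \<pi> dvd b)"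

definition splits :: "'a \<Rightarrow> bool" where
  "splits c \<longleftrightarrow> (\<exists>u ps. u dvd 1 \<and> u \<in> S \<and> (\<forall>\<pi>\<in>set ps. sprime \<pi>) \<and> c = u * prod_list ps)"

lemma dvd_add_cancel: "(\<pi>::'a) dvd a \<Longrightarrow> \<pi> dvd a + b \<longleftrightarrow> \<pi> dvd b"
  using dvd_diff[of \<pi> "a + b" a] by (auto intro: dvd_add)

text \<open>
  If neither factor were divisible, then the first coefficients that are not divisible would yield a
  coefficient of the product that is not.
\<close>

lemma sprime_const_poly:
  assumes \<pi>: "sprime \<pi>" and pq: "p \<in> polys" "q \<in> polys" "[:\<pi>:] dvd p * q"
  shows "[:\<pi>:] dvd p \<or> [:\<pi>:] dvd q"
proof (rule ccontr)
  assume "\<not> ?thesis"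
  hence "\<exists>i. \<not> \<pi> dvd coeff p i" "\<exists>j. \<not> \<pi> dvd coeff q j" by (auto simp: const_poly_dvd_iff)
  then obtain i j where i: "\<not> \<pi> dvd coeff p i" "\<And>k. k < i \<Longrightarrow> \<pi> dvd coeff p k"
    and j: "\<not> \<pi> dvd coeff q j" "\<And>k. k < j \<Longrightarrow> \<pi> dvd coeff q k"
    using exists_least_iff[of "\<lambda>i. \<not> \<pi> dvd coeff p i"] exists_least_iff[of "\<lambda>i. \<not> \<pi> dvd coeff q i"]
    by blast
  have "\<pi> dvd coeff (p * q) (i + j)" using pq(3) by (auto simp: const_poly_dvd_iff)
  also have "coeff (p * q) (i + j) = (\<Sum>k\<in>{..i+j} - {i}. coeff p k * coeff q (i + j - k)) + coeff p i * coeff q j"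
    unfolding coeff_mult by (subst sum.remove[of _ i]) auto
  finally have "\<pi> dvd (\<Sum>k\<in>{..i+j} - {i}. coeff p k * coeff q (i + j - k)) + coeff p i * coeff q j" .
  moreover have "\<pi> dvd (\<Sum>k\<in>{..i+j} - {i}. coeff p k * coeff q (i + j - k))"
  proof (rule dvd_sum)
    fix k assume "k \<in> {..i+j} - {i}"
    hence "k < i \<or> i + j - k < j" by auto
    thus "\<pi> dvd coeff p k * coeff q (i + j - k)" using i(2) j(2) by (auto intro: dvd_mult dvd_mult2)
  qed
  ultimately have "\<pi> dvd coeff p i * coeff q j" by (simp add: dvd_add_cancel)
  thus False using \<pi> i(1) j(1) coeff_closed pq(1,2) unfolding sprime_def by blast
qed

text \<open>
  Each prime factor of the constant divides one of the two polynomials and can be cancelled there;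
  the degrees do not change.
\<close>

lemma strip_primes:
  assumes "u dvd 1" "u \<in> S" "\<forall>\<pi>\<in>set ps. sprime \<pi>" "smult (u * prod_list ps) p = Q * D"
    "p \<in> polys" "Q \<in> polys" "D \<in> polys"
  shows "\<exists>Q'\<in>polys. \<exists>D'\<in>polys. p = Q' * D' \<and> degree Q' = degree Q \<and> degree D' = degree D"
  using assms(3-)
proof (induction ps arbitrary: Q D)
  case Nil
  obtain v where v: "u * v = 1" using assms(1) by (metis dvdE)
  have "u \<noteq> 0" using v by auto
  hence "v \<in> S" using saturated[OF assms(2), of v] v one_closed by auto
  moreover have "p = smult v Q * D"
  proof -
    have "smult v (smult u p) = smult v (Q * D)" using Nil by simp
    thus ?thesis using v by (simp add: mult.commute)
  qed
  moreover have "v \<noteq> 0" using v by auto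
  ultimately show ?case using Nil
    by (intro bexI[of _ "smult v Q"] bexI[of _ D]) (auto intro: polys_smult)
next
  case (Cons \<pi> ps)
  have \<pi>: "sprime \<pi>" "\<pi> \<noteq> 0" "\<pi> \<in> S" using Cons.prems by (auto simp: sprime_def)
  have *: "smult \<pi> (smult (u * prod_list ps) p) = Q * D" using Cons.prems(2) by (simp add: mult_ac)
  have "Q * D = [:\<pi>:] * smult (u * prod_list ps) p" by (subst *[symmetric]) (simp add: mult.commute)
  hence "[:\<pi>:] dvd Q * D" by (rule dvdI)
  hence "[:\<pi>:] dvd Q \<or> [:\<pi>:] dvd D" using sprime_const_poly \<pi> Cons.prems by blast
  thus ?case
  proof
    assume "[:\<pi>:] dvd Q"
    then obtain Q1 where Q1: "Q = smult \<pi> Q1" by (auto elim!: dvdE)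
    hence "Q1 \<in> polys" using Cons.prems \<pi> smult_polys_cancel by blast
    moreover have "smult (u * prod_list ps) p = Q1 * D"
      using * unfolding Q1 mult_smult_left by (rule smult_cancel) (rule \<pi>(2))
    ultimately have "\<exists>Q'\<in>polys. \<exists>D'\<in>polys. p = Q' * D' \<and> degree Q' = degree Q1 \<and> degree D' = degree D"
      using Cons by auto
    thus ?thesis using Q1 \<pi> by simp
  next
    assume "[:\<pi>:] dvd D"
    then obtain D1 where D1: "D = smult \<pi> D1" by (auto elim!: dvdE)
    hence "D1 \<in> polys" using Cons.prems \<pi> smult_polys_cancel by blast
    moreover have "smult (u * prod_list ps) p = Q * D1"
      using * unfolding D1 mult_smult_right by (rule smult_cancel) (rule \<pi>(2))
    ultimately have "\<exists>Q'\<in>polys. \<exists>D'\<in>polys. p = Q' * D' \<and> degree Q' = degree Q \<and> degree D' = degree D1"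
      using Cons by auto
    thus ?thesis using D1 \<pi> by simp
  qed
qed

text \<open>
  The prime factors of the constant do not divide \<open>p\<close>, so all of them can be cancelled in \<open>H\<close>.
\<close>

lemma primitive_cancel:
  assumes "u dvd 1" "\<forall>\<pi>\<in>set ps. sprime \<pi>" "smult (u * prod_list ps) a = p * H"
    "p \<in> polys" "H \<in> polys" and prim: "\<And>\<pi>. sprime \<pi> \<Longrightarrow> \<not> [:\<pi>:] dvd p"
  shows "p dvd a"
  using assms(2-5)
proof (induction ps arbitrary: H)
  case Nil
  obtain v where v: "u * v = 1" using assms(1) by (metis dvdE)
  have "smult v (smult u a) = smult v (p * H)" using Nil by simp
  hence "a = p * smult v H" using v by (simp add: mult.commute)
  thus ?case by (rule dvdI)
next
  case (Cons \<pi> ps)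
  have \<pi>: "sprime \<pi>" "\<pi> \<noteq> 0" "\<pi> \<in> S" using Cons.prems by (auto simp: sprime_def)
  have *: "smult \<pi> (smult (u * prod_list ps) a) = p * H" using Cons.prems(2) by (simp add: mult_ac)
  have "p * H = [:\<pi>:] * smult (u * prod_list ps) a" by (subst *[symmetric]) (simp add: mult.commute)
  hence "[:\<pi>:] dvd p * H" by (rule dvdI)
  hence "[:\<pi>:] dvd H" using sprime_const_poly \<pi> Cons.prems prim by blast
  then obtain H1 where H1: "H = smult \<pi> H1" by (auto elim!: dvdE)
  hence "H1 \<in> polys" using Cons.prems \<pi> smult_polys_cancel by blast
  moreover have "smult (u * prod_list ps) a = p * H1"
    using * unfolding H1 mult_smult_right by (rule smult_cancel) (rule \<pi>(2))
  ultimately show ?case using Cons by auto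
qed

lemma pseudo_division:
  assumes D: "D \<in> polys" "D \<noteq> 0" and "p \<in> polys"
  shows "\<exists>k. \<exists>Q\<in>polys. \<exists>R\<in>polys. smult (lead_coeff D ^ k) p = Q * D + R \<and> (R = 0 \<or> degree R < degree D)"
  using assms(3)
proof (induction "if p = 0 then 0 else Suc (degree p)" arbitrary: p rule: less_induct)
  case less
  show ?case
  proof (cases "p = 0 \<or> degree p < degree D")
    case True
    show ?thesis
      by (rule exI[of _ 0], rule bexI[of _ 0], rule bexI[of _ p]) (use True less.prems in \<open>auto simp: polys_0\<close>)
  next
    case False
    let ?m = "monom (lead_coeff p) (degree p - degree D)"
    define p1 where "p1 = smult (lead_coeff D) p - ?m * D"
    have m: "?m \<in> polys" using less.prems coeff_closed polys_monom by blast
    have p1: "p1 \<in> polys" unfolding p1_def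
      using D less.prems m coeff_closed by (intro polys_diff polys_smult polys_mult)
    have "p1 = 0 \<or> degree p1 < degree p"
    proof (rule eq_zero_or_degree_less)
      have "degree (?m * D) \<le> degree p"
        using degree_mult_le[of ?m D] degree_monom_le[of "lead_coeff p" "degree p - degree D"] False by linarith
      thus "degree p1 \<le> degree p" unfolding p1_def by (intro degree_diff_le) auto
      have "coeff (?m * D) (degree p - degree D + degree D) = lead_coeff p * lead_coeff D"
        by (simp only: coeff_monom_mult) simp
      thus "coeff p1 (degree p) = 0" using False unfolding p1_def by simp
    qed
    hence "(if p1 = 0 then 0 else Suc (degree p1)) < (if p = 0 then 0 else Suc (degree p))" using False by auto
    from less.hyps[OF this p1] obtain k Q R where *: "Q \<in> polys" "R \<in> polys"
      "smult (lead_coeff D ^ k) p1 = Q * D + R" "R = 0 \<or> degree R < degree D" by blast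
    have "smult (lead_coeff D ^ Suc k) p = smult (lead_coeff D ^ k) (p1 + ?m * D)"
      unfolding p1_def by (simp add: mult.commute)
    also have "\<dots> = (Q + smult (lead_coeff D ^ k) ?m) * D + R"
      by (simp only: smult_add_right *(3)) (simp add: algebra_simps)
    finally have "smult (lead_coeff D ^ Suc k) p = (Q + smult (lead_coeff D ^ k) ?m) * D + R" .
    moreover have "Q + smult (lead_coeff D ^ k) ?m \<in> polys"
      by (intro polys_add * polys_smult m power_closed coeff_closed D)
    ultimately show ?thesis using * by blast
  qed
qed

context
  fixes f :: "'a poly"
  assumes S_splits: "\<And>c. c \<in> S \<Longrightarrow> c \<noteq> 0 \<Longrightarrow> splits c"
    and f: "f \<in> polys" "degree f > 0"
    and irr: "\<And>Q D. Q \<in> polys \<Longrightarrow> D \<in> polys \<Longrightarrow> f = Q * D \<Longrightarrow> Q dvd 1 \<or> D dvd 1"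
begin

lemma f_not_0: "f \<noteq> 0"
  using f by auto

lemma unit_degree_0: "(p :: 'a poly) dvd 1 \<Longrightarrow> degree p = 0"
  by (metis dvd_1_iff_1 is_unit_poly_iff degree_pCons_0)

lemma f_primitive:
  assumes "sprime \<pi>" shows "\<not> [:\<pi>:] dvd f"
proof
  assume "[:\<pi>:] dvd f"
  then obtain h where h: "f = [:\<pi>:] * h" by blast
  have \<pi>: "\<pi> \<in> S" "\<pi> \<noteq> 0" "\<not> \<pi> dvd 1" using assms by (auto simp: sprime_def)
  have "h \<in> polys" using polys_saturated[of "[:\<pi>:]" h] h f \<pi> by simp
  hence "[:\<pi>:] dvd 1 \<or> h dvd 1" using irr h \<pi> by simp
  moreover have "\<not> [:\<pi>:] dvd 1" using \<pi>(3) by (simp add: one_pCons)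
  moreover have "degree h = degree f" using h \<pi> by simp
  ultimately show False using unit_degree_0 f by auto
qed

lemma gauss_cancel:
  assumes "f dvd smult c a" "c \<in> S" "c \<noteq> 0" "a \<in> polys" shows "f dvd a"
proof -
  obtain u ps where *: "u dvd 1" "\<forall>\<pi>\<in>set ps. sprime \<pi>" "c = u * prod_list ps"
    using S_splits[OF assms(2,3)] unfolding splits_def by blast
  obtain H where H: "smult c a = f * H" using assms(1) by blast
  have "H \<in> polys" using polys_saturated[OF f(1) f_not_0, of H] H polys_smult assms by metis
  thus ?thesis using primitive_cancel[OF *(1,2)] H * f f_primitive by blast
qed

text \<open>
  Let \<open>D\<close> be a nonzero element of smallest degree in the ideal \<open>(f, a)\<close>.  By pseudo-division it divides
  \<open>f\<close> and \<open>a\<close> up to constants.  If its degree were positive, then the irreducible \<open>f\<close> would be \<open>D\<close> up to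
  constants and thus divide \<open>a\<close>.  So \<open>D\<close> is the desired constant.
\<close>

lemma gauss_elimination:
  assumes a: "a \<in> polys" "\<not> f dvd a"
  shows "\<exists>c\<in>S. c \<noteq> 0 \<and> (\<exists>u\<in>polys. \<exists>v\<in>polys. [:c:] = u * f + v * a)"
proof -
  define I where "I = {u * f + v * a | u v. u \<in> polys \<and> v \<in> polys}"
  have I_polys: "D \<in> polys" if "D \<in> I" for D
    using that f a by (auto simp: I_def intro: polys_add polys_mult)
  have fI: "f \<in> I" unfolding I_def using polys_1 polys_0 by (intro CollectI exI[of _ 1] exI[of _ 0]) auto
  have aI: "a \<in> I" unfolding I_def using polys_1 polys_0 by (intro CollectI exI[of _ 0] exI[of _ 1]) auto
  have comb: "p - q * D \<in> I" if "p \<in> I" "D \<in> I" "q \<in> polys" for p q D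
  proof -
    obtain u v u' v' where "p = u * f + v * a" "D = u' * f + v' * a" and *: "u \<in> polys" "v \<in> polys" "u' \<in> polys" "v' \<in> polys"
      using \<open>p \<in> I\<close> \<open>D \<in> I\<close> by (auto simp: I_def)
    hence "p - q * D = (u - q * u') * f + (v - q * v') * a" by (simp add: algebra_simps)
    moreover have "u - q * u' \<in> polys" "v - q * v' \<in> polys"
      using * that(3) by (auto intro: polys_diff polys_mult)
    ultimately show ?thesis unfolding I_def by blast
  qed
  have smI: "smult c p \<in> I" if "p \<in> I" "c \<in> S" for c p
    using comb[OF that(1) that(1), of "[:1 - c:]"] that(2) by (simp add: diff_closed one_closed algebra_simps smult_diff_left)
  define D where "D = arg_min degree (\<lambda>D. D \<in> I \<and> D \<noteq> 0)"
  have "D \<in> I \<and> D \<noteq> 0"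
    unfolding D_def by (rule arg_min_natI[of _ f]) (use fI f_not_0 in auto)
  hence D: "D \<in> I" "D \<noteq> 0" by auto
  have D_min: "degree D \<le> degree D'" if "D' \<in> I" "D' \<noteq> 0" for D'
    unfolding D_def by (rule arg_min_nat_le) (use that in auto)
  have divI: "\<exists>k. \<exists>Q\<in>polys. smult (lead_coeff D ^ k) p = Q * D" if p: "p \<in> I" for p
  proof -
    obtain k Q R where *: "Q \<in> polys" "R \<in> polys" "smult (lead_coeff D ^ k) p = Q * D + R"
      "R = 0 \<or> degree R < degree D" using pseudo_division[of D p] D I_polys p by blast
    have "R = smult (lead_coeff D ^ k) p - Q * D" using *(3) by simp
    hence "R \<in> I" using comb smI p D *(1) I_polys coeff_closed power_closed by metis
    hence "R = 0" using *(4) D_min by fastforce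
    thus ?thesis using * by auto
  qed
  show ?thesis
  proof (cases "degree D = 0")
    case True
    then obtain c where "D = [:c:]" by (rule degree_eq_zeroE)
    thus ?thesis using D I_polys[OF D(1)] unfolding I_def by auto
  next
    case False
    have l: "lead_coeff D ^ k \<in> S" "lead_coeff D ^ k \<noteq> 0" for k
      using D I_polys coeff_closed power_closed by auto
    obtain k Q where Q: "Q \<in> polys" "smult (lead_coeff D ^ k) f = Q * D" using divI[OF fI] by blast
    obtain u ps where up: "u dvd 1" "u \<in> S" "\<forall>\<pi>\<in>set ps. sprime \<pi>" "lead_coeff D ^ k = u * prod_list ps"
      using S_splits[OF l] unfolding splits_def by blast
    obtain Q' D' where QD: "Q' \<in> polys" "D' \<in> polys" "f = Q' * D'" "degree Q' = degree Q" "degree D' = degree D"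
      using strip_primes[OF up(1-3), of f Q D] Q up(4) f(1) I_polys[OF D(1)] by metis
    have "degree Q = 0" using irr[OF QD(1-3)] unit_degree_0 QD False by auto
    then obtain e where e: "Q = [:e:]" by (rule degree_eq_zeroE)
    obtain k2 Q2 where Q2: "Q2 \<in> polys" "smult (lead_coeff D ^ k2) a = Q2 * D" using divI[OF aI] by blast
    have "e \<noteq> 0" using Q(2) e l[of k] f_not_0 by auto
    have "smult (e * lead_coeff D ^ k2) a = Q2 * smult e D"
      using arg_cong[OF Q2(2), of "smult e"] by simp
    also have "smult e D = smult (lead_coeff D ^ k) f" using Q e by simp
    finally have "f dvd smult (e * lead_coeff D ^ k2) a" by (simp add: dvd_smult)
    moreover have "e * lead_coeff D ^ k2 \<in> S" using l Q e mult_closed by simp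
    ultimately have "f dvd a" using gauss_cancel a(1) l[of k2] \<open>e \<noteq> 0\<close> by auto
    thus ?thesis using a(2) by blast
  qed
qed

lemma gauss_prime:
  assumes "a \<in> polys" "b \<in> polys" "f dvd a * b" shows "f dvd a \<or> f dvd b"
proof (rule ccontr)
  assume *: "\<not> ?thesis"
  then obtain c u v where c: "c \<in> S" "c \<noteq> 0" "[:c:] = u * f + v * a"
    using gauss_elimination[of a] assms by blast
  have "smult c b = [:c:] * b" by simp
  also have "\<dots> = (u * f + v * a) * b" unfolding c(3) ..
  also have "\<dots> = f * (u * b) + v * (a * b)" by (simp add: algebra_simps)
  finally have "f dvd smult c b" using assms(3) by simp
  thus False using gauss_cancel[OF _ c(1,2) assms(2)] * by blast
qed

end

end

section \<open>Polynomials in one distinguished variable\<close>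

text \<open>
  The expansion in powers of \<open>X\<^sub>l\<close>, with coefficients in which \<open>X\<^sub>l\<close> does not occur.
\<close>

definition split_var :: "nat \<Rightarrow> 'a::comm_ring_1 mpol \<Rightarrow> 'a mpol poly" where
  "split_var l = geval (\<lambda>c. [:mconst c:]) (\<lambda>i. if i = l then [:0, 1:] else [:mvar i:])"

lemma is_hom_split_var: "is_hom (split_var l)"
  unfolding split_var_def by (rule is_hom_geval[OF is_hom_pconst])

lemmas split_var_hom = is_hom_split_var[THEN hom_zero] is_hom_split_var[THEN hom_one] is_hom_split_var[THEN hom_add]
  is_hom_split_var[THEN hom_mult] is_hom_split_var[THEN hom_minus] is_hom_split_var[THEN hom_sum]
  is_hom_split_var[THEN hom_power] is_hom_split_var[THEN hom_of_nat]

lemma split_var_mvar: "split_var l (mvar i) = (if i = l then [:0, 1:] else [:mvar i:])"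
  and split_var_mconst: "split_var l (mconst c) = [:mconst c:]"
  by (simp_all add: split_var_def is_hom_pconst)

lemma poly_split_var: "poly (split_var l A) (mvar l) = (A :: 'a::comm_ring_1 mpol)"
  unfolding split_var_def
proof (subst geval_hom_comp[OF is_hom_poly])
  have "(\<lambda>i. poly (if i = l then [:0, 1:] else [:mvar i:]) (mvar l)) = (mvar :: nat \<Rightarrow> 'a mpol)"
    by auto
  thus "geval (\<lambda>c. poly [:mconst c:] (mvar l)) (\<lambda>i. poly (if i = l then [:0, 1:] else [:mvar i:]) (mvar l)) A = A"
    by (simp add: geval_ident)
qed

lemma split_var_inj: "split_var l A = split_var l B \<longleftrightarrow> A = B"
  by (metis poly_split_var)

lemma split_var_eq_0 [simp]: "split_var l A = 0 \<longleftrightarrow> A = 0"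
  using split_var_inj[of l A 0] by (simp add: split_var_hom)

lemma split_var_dvd: "split_var l A dvd split_var l B \<longleftrightarrow> A dvd B"
proof
  assume "split_var l A dvd split_var l B"
  then obtain H where "split_var l B = split_var l A * H" by blast
  hence "B = A * poly H (mvar l)" using poly_split_var[of l A] poly_split_var[of l B] by simp
  thus "A dvd B" by simp
qed (auto elim!: dvdE simp: split_var_hom)

lemma split_var_free:
  assumes "l \<notin> vars A" shows "split_var l A = [:A:]"
proof -
  have "is_hom (\<lambda>A. [:A:] :: 'a mpol poly)" by (rule is_homI) auto
  hence "[:A:] = geval (\<lambda>c. [:mconst c:]) (\<lambda>i. if i = l then [:0, 1:] else [:mvar i:]) A"
    by (rule hom_eq_geval[OF _ subset_refl]) (use assms is_hom_pconst in auto)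
  thus ?thesis by (simp add: split_var_def)
qed

lemma vars_coeff_split_var:
  assumes "vars A \<subseteq> insert l V" "l \<notin> V" shows "vars (coeff (split_var l A) i) \<subseteq> V"
  using assms(1)
proof (induction arbitrary: i rule: mpol_induct)
  case (const c)
  thus ?case by (cases i) (auto simp: split_var_mconst)
next
  case (var j)
  thus ?case by (auto simp: split_var_mvar coeff_pCons vars_mvar split: nat.splits)
next
  case (add A B)
  thus ?case by (simp add: split_var_hom vars_add)
next
  case (mult A B)
  thus ?case by (simp add: split_var_hom coeff_mult vars_sum vars_mult)
qed

lemma degree_split_var:
  assumes "l \<in> vars A" shows "degree (split_var l A) > 0"
proof (rule ccontr)
  assume "\<not> degree (split_var l A) > 0"
  then obtain c where c: "split_var l A = [:c:]" by (auto elim: degree_eq_zeroE)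
  hence "A = c" using poly_split_var[of l A] by simp
  moreover have "vars c \<subseteq> vars A - {l}"
    using vars_coeff_split_var[of A l "vars A - {l}" 0] c by auto
  ultimately show False using assms by auto
qed

lemma split_var_poly:
  assumes "\<And>i. l \<notin> vars (coeff p i)" shows "split_var l (poly p (mvar l)) = p"
proof -
  have "split_var l (poly p (mvar l)) = (\<Sum>i\<le>degree p. split_var l (coeff p i) * split_var l (mvar l) ^ i)"
    by (simp add: poly_altdef split_var_hom)
  also have "\<dots> = (\<Sum>i\<le>degree p. smult (coeff p i) (monom 1 1 ^ i))"
    using assms by (simp add: split_var_free split_var_mvar monom_altdef)
  also have "\<dots> = p"
    by (simp add: monom_power smult_monom poly_as_sum_of_monoms)
  finally show ?thesis .
qed

text \<open>
  The degree in each single variable is additive, so no variable cancels in a product.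
\<close>

lemma vars_subset_mult:
  fixes A B :: "'a::idom mpol"
  assumes "A * B \<noteq> 0" shows "vars A \<subseteq> vars (A * B)"
proof
  fix l assume l: "l \<in> vars A"
  show "l \<in> vars (A * B)"
  proof (rule ccontr)
    assume "l \<notin> vars (A * B)"
    hence "split_var l (A * B) = [:A * B:]" by (rule split_var_free)
    hence "degree (split_var l A * split_var l B) = 0" by (simp flip: split_var_hom)
    hence "degree (split_var l A) = 0" using assms by (subst (asm) degree_mult_eq) auto
    thus False using degree_split_var[OF l] by simp
  qed
qed

lemma saturated_subring_vars: "saturated_subring {A :: 'a::idom mpol. vars A \<subseteq> V}"
proof
  fix a b :: "'a mpol" assume *: "a \<in> {A. vars A \<subseteq> V}" "a * b \<in> {A. vars A \<subseteq> V}" "a \<noteq> 0"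
  show "b \<in> {A. vars A \<subseteq> V}"
  proof (cases "b = 0")
    case False
    thus ?thesis using vars_subset_mult[of b a] * by (simp add: mult.commute)
  qed simp
qed (simp_all add: vars_add vars_mult)

lemma irreducible_split_var:
  fixes F :: "'a::idom mpol"
  assumes F: "Factorial_Ring.irreducible F" and l: "l \<notin> V"
    and Q: "Q \<in> saturated_subring.polys {A. vars A \<subseteq> V}" and D: "D \<in> saturated_subring.polys {A. vars A \<subseteq> V}"
    and eq: "split_var l F = Q * D"
  shows "Q dvd 1 \<or> D dvd 1"
proof -
  interpret saturated_subring "{A :: 'a mpol. vars A \<subseteq> V}" by (rule saturated_subring_vars)
  have *: "split_var l (poly p (mvar l)) = p" if "p \<in> polys" for p
    by (rule split_var_poly) (use coeff_closed[OF that] l in auto)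
  have "F = poly Q (mvar l) * poly D (mvar l)" using arg_cong[OF eq, of "\<lambda>p. poly p (mvar l)"]
    by (simp add: poly_split_var)
  hence "poly Q (mvar l) dvd 1 \<or> poly D (mvar l) dvd 1" using F irreducibleD by blast
  hence "split_var l (poly Q (mvar l)) dvd split_var l 1 \<or> split_var l (poly D (mvar l)) dvd split_var l 1"
    by (simp only: split_var_dvd)
  thus ?thesis using * Q D by (simp add: split_var_hom)
qed

text \<open>
  Factorization into primes, by induction on the set of variables.  An irreducible polynomial that
  involves the new variable is prime by Gauss's lemma, the other ones factor by the induction
  hypothesis, and the primes of the smaller ring remain prime in the larger one.  A factorization
  into irreducible polynomials exists by induction on the total degree.
\<close>

lemma splits_vars:
  fixes A :: "'a::field mpol"
  assumes "finite V" "vars A \<subseteq> V" "A \<noteq> 0"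
  shows "saturated_subring.splits {A. vars A \<subseteq> V} A"
  using assms
proof (induction V arbitrary: A rule: finite_induct)
  case empty
  interpret saturated_subring "{A :: 'a mpol. vars A \<subseteq> {}}" by (rule saturated_subring_vars)
  have "homogeneous 0 0 A" using empty by (auto simp: homogeneous_def vars_def)
  hence "A = mconst (lookup A 0)" by (rule homogeneous_0_mconst)
  hence "A dvd 1" using empty mconst_dvd_1 by (metis mconst_0)
  thus ?case unfolding splits_def using empty by (intro exI[of _ A] exI[of _ "[]"]) auto
next
  case (insert l V)
  interpret V: saturated_subring "{A :: 'a mpol. vars A \<subseteq> V}" by (rule saturated_subring_vars)
  interpret W: saturated_subring "{A :: 'a mpol. vars A \<subseteq> insert l V}" by (rule saturated_subring_vars)
  have in_polys: "split_var l B \<in> V.polys" if "vars B \<subseteq> insert l V" for B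
    unfolding V.polys_def using vars_coeff_split_var[OF that insert.hyps(2)] by simp
  have S_splits: "V.splits c" if "c \<in> {A. vars A \<subseteq> V}" "c \<noteq> 0" for c
    using insert.IH that by simp
  have up: "W.sprime \<pi>" if \<pi>: "V.sprime \<pi>" for \<pi>
    unfolding W.sprime_def
  proof (intro conjI ballI impI)
    show "\<pi> \<in> {A. vars A \<subseteq> insert l V}" "\<pi> \<noteq> 0" "\<not> \<pi> dvd 1" using \<pi> by (auto simp: V.sprime_def)
    fix a b assume *: "a \<in> {A. vars A \<subseteq> insert l V}" "b \<in> {A. vars A \<subseteq> insert l V}" "\<pi> dvd a * b"
    have "l \<notin> vars \<pi>" using \<pi> insert.hyps by (auto simp: V.sprime_def)
    hence eq: "split_var l \<pi> = [:\<pi>:]" by (rule split_var_free)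
    have "split_var l \<pi> dvd split_var l (a * b)" using * by (simp add: split_var_dvd)
    hence "[:\<pi>:] dvd split_var l a * split_var l b" by (simp add: eq split_var_hom)
    hence "[:\<pi>:] dvd split_var l a \<or> [:\<pi>:] dvd split_var l b"
      using V.sprime_const_poly[OF \<pi>] in_polys * by blast
    thus "\<pi> dvd a \<or> \<pi> dvd b" by (simp add: split_var_dvd flip: eq)
  qed
  have irr: "W.splits A" if A: "Factorial_Ring.irreducible A" "vars A \<subseteq> insert l V" for A
  proof (cases "l \<in> vars A")
    case True
    have "W.sprime A"
      unfolding W.sprime_def
    proof (intro conjI ballI impI)
      show "A \<in> {A. vars A \<subseteq> insert l V}" "A \<noteq> 0" "\<not> A dvd 1" using A by (auto simp: irreducible_def)
      fix a b assume *: "a \<in> {A. vars A \<subseteq> insert l V}" "b \<in> {A. vars A \<subseteq> insert l V}" "A dvd a * b"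
      have "split_var l A dvd split_var l a \<or> split_var l A dvd split_var l b"
      proof (rule V.gauss_prime[OF S_splits])
        show "split_var l A dvd split_var l a * split_var l b"
          using * by (simp add: split_var_dvd flip: split_var_hom)
      qed (use in_polys A * degree_split_var[OF True] irreducible_split_var[OF A(1) insert.hyps(2)] in auto)
      thus "A dvd a \<or> A dvd b" by (simp add: split_var_dvd)
    qed
    thus ?thesis unfolding W.splits_def by (intro exI[of _ 1] exI[of _ "[A]"]) auto
  next
    case False
    hence "V.splits A" using S_splits A by (auto simp: irreducible_def)
    thus ?thesis unfolding V.splits_def W.splits_def using up by blast
  qed
  show ?case using insert.prems
  proof (induction "tdeg A" arbitrary: A rule: less_induct)
    case less
    show ?case
    proof (cases "A dvd 1 \<or> Factorial_Ring.irreducible A")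
      case True
      moreover have "W.splits A" if "A dvd 1"
        unfolding W.splits_def using that less.prems by (intro exI[of _ A] exI[of _ "[]"]) auto
      ultimately show ?thesis using irr less.prems by blast
    next
      case False
      then obtain B C where BC: "A = B * C" "\<not> B dvd 1" "\<not> C dvd 1"
        using less.prems unfolding irreducible_def by blast
      hence nz: "B \<noteq> 0" "C \<noteq> 0" using less.prems by auto
      have "tdeg B \<noteq> 0" "tdeg C \<noteq> 0" using BC nz tdeg_0_imp_dvd_1 by blast+
      hence "tdeg B < tdeg A" "tdeg C < tdeg A" using tdeg_mult[OF nz] BC by auto
      moreover have "vars B \<subseteq> insert l V" "vars C \<subseteq> insert l V"
        using vars_subset_mult[of B C] vars_subset_mult[of C B] BC less.prems by (auto simp: mult.commute)
      ultimately have "W.splits B" "W.splits C" using less.hyps nz by auto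
      then obtain u ps v qs where *: "u dvd 1" "v dvd 1" "u \<in> {A. vars A \<subseteq> insert l V}" "v \<in> {A. vars A \<subseteq> insert l V}"
        "\<forall>\<pi>\<in>set ps. W.sprime \<pi>" "\<forall>\<pi>\<in>set qs. W.sprime \<pi>" "B = u * prod_list ps" "C = v * prod_list qs"
        unfolding W.splits_def by blast
      have "u * v dvd 1" using mult_dvd_mono[OF *(1,2)] by simp
      thus ?thesis unfolding W.splits_def using * BC W.mult_closed
        by (intro exI[of _ "u * v"] exI[of _ "ps @ qs"]) (auto simp: mult_ac)
    qed
  qed
qed

context
  fixes F :: "'a::field mpol" and l V
  assumes F: "Factorial_Ring.irreducible F" "l \<in> vars F"
    and V: "finite V" "l \<notin> V" "vars F \<subseteq> insert l V"
begin

interpretation saturated_subring "{A :: 'a mpol. vars A \<subseteq> V}" by (rule saturated_subring_vars)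

lemma split_var_in_polys: "vars B \<subseteq> insert l V \<Longrightarrow> split_var l B \<in> polys"
  unfolding polys_def by (intro CollectI allI vars_coeff_split_var V(2))

lemma elimination:
  assumes A: "vars A \<subseteq> insert l V" "\<not> F dvd A"
  obtains c u v where "vars c \<subseteq> V" "c \<noteq> 0" "c = u * F + v * A"
proof -
  have "\<exists>c\<in>{A. vars A \<subseteq> V}. c \<noteq> 0 \<and> (\<exists>u\<in>polys. \<exists>v\<in>polys. [:c:] = u * split_var l F + v * split_var l A)"
    by (rule gauss_elimination) (use splits_vars V A split_var_in_polys degree_split_var[OF F(2)]
        irreducible_split_var[OF F(1) V(2)] in \<open>auto simp: split_var_dvd\<close>)
  then obtain c u v where c: "vars c \<subseteq> V" "c \<noteq> 0" "[:c:] = u * split_var l F + v * split_var l A" by auto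
  have "c = poly u (mvar l) * F + poly v (mvar l) * A"
    using arg_cong[OF c(3), of "\<lambda>p. poly p (mvar l)"] by (simp add: poly_split_var)
  thus ?thesis using that c by blast
qed

lemma irreducible_imp_prime_relative:
  assumes "vars A \<subseteq> insert l V" "vars B \<subseteq> insert l V" "F dvd A * B" shows "F dvd A \<or> F dvd B"
proof -
  have "split_var l F dvd split_var l A \<or> split_var l F dvd split_var l B"
    by (rule gauss_prime) (use splits_vars V assms split_var_in_polys degree_split_var[OF F(2)]
        irreducible_split_var[OF F(1) V(2)] in \<open>auto simp: split_var_dvd simp flip: split_var_hom\<close>)
  thus ?thesis by (simp add: split_var_dvd)
qed

end

lemma vars_nonempty:
  assumes "\<not> A dvd 1" "(A :: 'a::field mpol) \<noteq> 0" shows "vars A \<noteq> {}"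
proof
  assume "vars A = {}"
  hence "homogeneous 0 0 A" by (auto simp: homogeneous_def vars_def)
  hence "A = mconst (lookup A 0)" by (rule homogeneous_0_mconst)
  thus False using assms mconst_dvd_1 by (metis mconst_0)
qed

theorem irreducible_imp_prime_mpol:
  fixes F :: "'a::field mpol"
  assumes F: "Factorial_Ring.irreducible F" shows "prime_elem F"
proof (rule prime_elemI)
  show "F \<noteq> 0" "\<not> F dvd 1" using F by (auto simp: irreducible_def)
  then obtain l where l: "l \<in> vars F" using vars_nonempty by blast
  fix A B assume "F dvd A * B"
  thus "F dvd A \<or> F dvd B"
    by (intro irreducible_imp_prime_relative[OF F l, of "vars F \<union> vars A \<union> vars B - {l}"]) auto
qed

section \<open>Points of a hypersurface\<close>

lemma infinite_alg_closed: "infinite (UNIV :: 'a::alg_closed_field set)"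
proof
  assume fin: "finite (UNIV :: 'a set)"
  let ?q = "\<Prod>a\<in>(UNIV::'a set). [:-a, 1:]"
  have "degree ?q = card (UNIV :: 'a set)" by (subst degree_prod_eq_sum_degree) auto
  moreover have "card (UNIV :: 'a set) > 0" using fin by (simp add: card_gt_0_iff)
  ultimately have "degree (?q + 1) > 0" by (subst degree_add_eq_left) auto
  then obtain x where "poly (?q + 1) x = 0" using alg_closed_imp_poly_has_root by blast
  moreover have "poly ?q x = 0" using fin by (auto simp: poly_prod intro!: bexI[of _ x])
  ultimately show False by simp
qed

lemma is_hom_map_poly:
  assumes "is_hom f" shows "is_hom (map_poly f)"
proof (rule is_homI)
  show "map_poly f (a + b) = map_poly f a + map_poly f b" for a b
    by (rule poly_eqI) (simp add: coeff_map_poly hom_zero[OF assms] hom_add[OF assms])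
  show "map_poly f (a * b) = map_poly f a * map_poly f b" for a b
    by (rule poly_eqI) (simp add: coeff_map_poly hom_zero[OF assms] coeff_mult hom_sum[OF assms] hom_mult[OF assms])
qed (simp add: hom_one[OF assms])

lemma meval_split_var:
  "meval A (x(l := t)) = poly (map_poly (\<lambda>c. meval c x) (split_var l A)) t"
proof -
  have h: "is_hom (\<lambda>A. poly (map_poly (\<lambda>c. meval c x) (split_var l A)) t)"
    by (intro is_hom_comp[OF is_hom_poly] is_hom_comp[OF is_hom_map_poly is_hom_split_var] is_hom_meval)
  show ?thesis unfolding meval_geval
    by (rule hom_eq_geval[OF h subset_UNIV, symmetric, unfolded meval_geval])
       (auto simp: split_var_mconst split_var_mvar map_poly_pCons is_hom_id hom_one[OF is_hom_geval[OF is_hom_id]])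
qed

lemma exists_nonzero_value:
  fixes A :: "'a::alg_closed_field mpol"
  assumes "finite V" "vars A \<subseteq> V" "A \<noteq> 0"
  shows "\<exists>x. meval A x \<noteq> 0 \<and> (\<forall>i. i \<notin> V \<longrightarrow> x i = 0)"
  using assms
proof (induction V arbitrary: A rule: finite_induct)
  case empty
  hence "homogeneous 0 0 A" by (auto simp: homogeneous_def vars_def)
  hence "A = mconst (lookup A 0)" by (rule homogeneous_0_mconst)
  then obtain c where c: "A = mconst c" "c \<noteq> 0" using empty by (metis mconst_0)
  thus ?case by (intro exI[of _ "\<lambda>_. 0"]) (simp add: meval_geval is_hom_id)
next
  case (insert l V)
  let ?c = "lead_coeff (split_var l A)"
  have "?c \<noteq> 0" "vars ?c \<subseteq> V" using insert vars_coeff_split_var[of A l V] by auto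
  then obtain x where x: "meval ?c x \<noteq> 0" "\<forall>i. i \<notin> V \<longrightarrow> x i = 0" using insert.IH by blast
  let ?q = "map_poly (\<lambda>c. meval c x) (split_var l A)"
  have "coeff ?q (degree (split_var l A)) \<noteq> 0"
    using x(1) by (simp add: coeff_map_poly meval_hom)
  hence "?q \<noteq> 0" by auto
  hence "finite {t. poly ?q t = 0}" by (rule poly_roots_finite)
  then obtain t where "poly ?q t \<noteq> 0"
    using infinite_alg_closed ex_new_if_finite by blast
  hence "meval A (x(l := t)) \<noteq> 0" by (simp only: meval_split_var not_False_eq_True)
  moreover have "\<forall>i. i \<notin> insert l V \<longrightarrow> (x(l := t)) i = 0" using x(2) by simp
  ultimately show ?case by blast
qed

text \<open>
  If \<open>F\<close> does not divide \<open>A\<close>, then elimination gives a polynomial \<open>c = u F + v A \<noteq> 0\<close> without \<open>X\<^sub>l\<close>.  Fix the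
  other coordinates such that \<open>c\<close> and the leading coefficient of \<open>F\<close> do not vanish, and solve \<open>F = 0\<close>
  for \<open>X\<^sub>l\<close>.  At the resulting point \<open>A\<close> vanishes and so does \<open>c\<close>, a contradiction.
\<close>

theorem hypersurface_nullstellensatz:
  fixes F :: "'a::alg_closed_field mpol"
  assumes F: "Factorial_Ring.irreducible F" "vars F \<subseteq> {..n}" and n: "n \<ge> 1" and A: "vars A \<subseteq> {..n}"
    and vanish: "\<And>x. x \<in> hcoords n \<Longrightarrow> meval F x = 0 \<Longrightarrow> meval A x = 0"
  shows "F dvd A"
proof (rule ccontr)
  assume nd: "\<not> F dvd A"
  obtain l where l: "l \<in> vars F" using F vars_nonempty[of F] by (auto simp: irreducible_def)
  let ?V = "{..n} - {l}"
  have lV: "insert l ?V = {..n}" using l F(2) by auto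
  obtain c u v where c: "vars c \<subseteq> ?V" "c \<noteq> 0" "c = u * F + v * A"
    by (rule elimination[OF F(1) l, of ?V A]) (use F(2) A nd lV in auto)
  let ?p = "split_var l F"
  have lc: "lead_coeff ?p \<noteq> 0" "vars (lead_coeff ?p) \<subseteq> ?V"
    using F vars_coeff_split_var[of F l ?V] lV by (auto simp: irreducible_def)
  obtain j where j: "j \<in> ?V"
  proof -
    have "card {..n} \<ge> 2" using n by simp
    hence "\<not> {..n} \<subseteq> {l}" using card_mono[of "{l}" "{..n}"] by auto
    thus ?thesis using that by blast
  qed
  \<comment> \<open>The factor \<open>X\<^sub>j\<close> keeps the point away from the origin.\<close>
  have "c * lead_coeff ?p * mvar j \<noteq> 0" using c(2) lc(1) vars_mvar[of j, where 'a = 'a] by auto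
  moreover have "vars (c * lead_coeff ?p * mvar j) \<subseteq> ?V"
    using c(1) lc(2) j by (intro vars_mult) (auto simp: vars_mvar)
  ultimately obtain x where "meval (c * lead_coeff ?p * mvar j) x \<noteq> 0" "\<forall>i. i \<notin> ?V \<longrightarrow> x i = 0"
    using exists_nonzero_value[of ?V "c * lead_coeff ?p * mvar j"] by auto
  hence x: "meval c x \<noteq> 0" "meval (lead_coeff ?p) x \<noteq> 0" "x j \<noteq> 0" "\<And>i. i \<notin> ?V \<Longrightarrow> x i = 0"
    by (auto simp: meval_hom)
  let ?q = "map_poly (\<lambda>c. meval c x) ?p"
  have "degree ?q = degree ?p"
    by (rule map_poly_degree_eq) (use x(2) in simp)
  hence "degree ?q > 0" using degree_split_var[OF l] by simp
  then obtain t where t: "poly ?q t = 0" using alg_closed_imp_poly_has_root by blast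
  have "x(l := t) \<in> hcoords n" unfolding hcoords_def using x(3,4) j l F(2)
    by (auto intro!: exI[of _ j])
  moreover have F0: "meval F (x(l := t)) = 0" using t by (simp only: meval_split_var)
  ultimately have A0: "meval A (x(l := t)) = 0" by (rule vanish)
  have "meval c (x(l := t)) = 0"
    unfolding c(3) meval_hom A0 F0 by simp
  moreover have "meval c (x(l := t)) = meval c x" by (rule meval_cong) (use c(1) in auto)
  ultimately show False using x(1) by simp
qed

section \<open>Homogeneous linear systems modulo a prime\<close>

text \<open>
  Gaussian elimination.  The predicate \<open>Z\<close> is membership in a prime ideal: below it is the ideal of
  multiples of \<open>F\<close>, and the zero ideal of a field when monomials are counted.
\<close>

lemma homogeneous_system:
  fixes Z :: "'a::idom \<Rightarrow> bool" and M :: "'i \<Rightarrow> 'j \<Rightarrow> 'a"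
  assumes Z0: "Z 0" and Z_add: "\<And>a b. Z a \<Longrightarrow> Z b \<Longrightarrow> Z (a + b)" and Z_mult: "\<And>a b. Z b \<Longrightarrow> Z (a * b)"
    and Z_prime: "\<And>a b. Z (a * b) \<Longrightarrow> Z a \<or> Z b" and Z1: "\<not> Z 1"
    and I: "finite I" and J: "finite J" "card I < card J"
  shows "\<exists>t. (\<exists>j\<in>J. \<not> Z (t j)) \<and> (\<forall>i\<in>I. Z (\<Sum>j\<in>J. M i j * t j))"
  using I J
proof (induction I arbitrary: J M rule: finite_induct)
  case empty
  hence "J \<noteq> {}" by auto
  thus ?case using Z1 by (intro exI[of _ "\<lambda>_. 1"]) auto
next
  case (insert i0 I)
  have Z_sum: "Z (\<Sum>j\<in>K. f j)" if "\<And>j. j \<in> K \<Longrightarrow> Z (f j)" for K :: "'j set" and f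
    using that by (induction K rule: infinite_finite_induct) (auto intro: Z0 Z_add)
  show ?case
  proof (cases "\<forall>j\<in>J. Z (M i0 j)")
    case True
    obtain t where t: "\<exists>j\<in>J. \<not> Z (t j)" "\<forall>i\<in>I. Z (\<Sum>j\<in>J. M i j * t j)"
      using insert.IH[of J M] insert.prems insert.hyps by auto
    have "Z (\<Sum>j\<in>J. M i0 j * t j)" using True by (intro Z_sum) (metis Z_mult mult.commute)
    thus ?thesis using t by blast
  next
    case False
    then obtain j0 where j0: "j0 \<in> J" "\<not> Z (M i0 j0)" by blast
    let ?J = "J - {j0}"
    have "card I < card ?J" using insert j0 by simp
    then obtain t where t: "\<exists>j\<in>?J. \<not> Z (t j)"
      "\<forall>i\<in>I. Z (\<Sum>j\<in>?J. (M i0 j0 * M i j - M i j0 * M i0 j) * t j)"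
      using insert.IH[of ?J "\<lambda>i j. M i0 j0 * M i j - M i j0 * M i0 j"] insert.prems by blast
    define s where "s = (\<lambda>j. if j = j0 then - (\<Sum>j\<in>?J. M i0 j * t j) else M i0 j0 * t j)"
    have s_sum: "(\<Sum>j\<in>J. M i j * s j) = (\<Sum>j\<in>?J. (M i0 j0 * M i j - M i j0 * M i0 j) * t j)" for i
    proof -
      have "(\<Sum>j\<in>J. M i j * s j) = M i j0 * s j0 + (\<Sum>j\<in>?J. M i j * s j)"
        using insert.prems j0 by (simp add: sum.remove)
      also have "(\<Sum>j\<in>?J. M i j * s j) = (\<Sum>j\<in>?J. M i j * (M i0 j0 * t j))"
        by (intro sum.cong) (auto simp: s_def)
      also have "M i j0 * s j0 = (\<Sum>j\<in>?J. - (M i j0 * (M i0 j * t j)))"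
        by (simp add: s_def sum_distrib_left sum_negf)
      finally show ?thesis by (simp add: algebra_simps flip: sum.distrib)
    qed
    have "\<exists>j\<in>J. \<not> Z (s j)" using t(1) j0 Z_prime by (auto simp: s_def)
    moreover have "Z (\<Sum>j\<in>J. M i0 j * s j)" by (simp add: s_sum Z0)
    moreover have "\<forall>i\<in>I. Z (\<Sum>j\<in>J. M i j * s j)" using t(2) by (simp add: s_sum)
    ultimately show ?thesis by blast
  qed
qed

section \<open>Derivations along a hypersurface\<close>

lemma msubst_cong_mod:
  fixes F :: "'a::comm_ring_1 mpol"
  assumes "vars A \<subseteq> V" "\<And>i. i \<in> V \<Longrightarrow> F dvd U i - W i"
  shows "F dvd msubst A U - msubst A W"
  using assms(1)
proof (induction rule: mpol_induct)
  case (add A B)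
  have "msubst (A + B) U - msubst (A + B) W = (msubst A U - msubst A W) + (msubst B U - msubst B W)"
    by (simp add: msubst_hom)
  thus ?case using add by simp
next
  case (mult A B)
  have "msubst (A * B) U - msubst (A * B) W =
    (msubst A U - msubst A W) * msubst B U + msubst A W * (msubst B U - msubst B W)"
    by (simp add: msubst_hom algebra_simps)
  thus ?case using mult by (simp add: dvd_add)
qed (use assms(2) in auto)

lemma derivation_dvd:
  assumes "derivation D" "F dvd D F" "F dvd A" shows "F dvd D A"
proof -
  obtain Q where "A = F * Q" using assms(3) by blast
  hence "D A = D F * Q + F * D Q" by (simp add: derivation_mult[OF assms(1)])
  thus ?thesis using assms(2) by (simp add: dvd_add)
qed

lemma euler_msubst:
  fixes A :: "'a::comm_ring_1 mpol"
  assumes "homogeneous n g A"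
  shows "(\<Sum>l\<le>n. msubst (partial l A) U * U l) = of_nat g * msubst A U"
proof -
  have "msubst (\<Sum>l\<le>n. mvar l * partial l A) U = msubst (of_nat g * A) U"
    using euler[OF assms] by simp
  thus ?thesis
    by (simp add: msubst_hom mult.commute)
qed

text \<open>
  The assumption on \<open>D\<close> and the \<open>U\<^sub>l\<close> says that \<open>D\<close> kills their ratios; by Euler's relation, \<open>D\<close> multiplies
  all coefficients \<open>C\<^sub>k(U)\<close> of the relation by one and the same factor.  Hence differentiating the
  relation \<open>\<Sum> C\<^sub>k(U) t\<^sup>k \<equiv> 0\<close> for \<open>t = x/z\<close> leaves only \<open>D(t)\<close> times the derivative of the relation,
  and the latter is not zero.
\<close>

lemma derivation_separable:
  fixes F :: "'a::field mpol"
  assumes F: "prime_elem F" and D: "derivation D" "F dvd D F"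
    and a: "\<not> F dvd U a" and UD: "\<And>l. l \<le> n \<Longrightarrow> F dvd U a * D (U l) - U l * D (U a)"
    and C: "\<And>k. k \<le> N \<Longrightarrow> homogeneous n g (C k)"
    and rel: "F dvd (\<Sum>k\<le>N. msubst (C k) U * (x ^ k * z ^ (N - k)))"
    and sep: "\<not> F dvd (\<Sum>k\<le>N. msubst (C k) U * (of_nat k * x ^ (k - 1) * z ^ (N - k)))"
  shows "F dvd z * D x - x * D z"
proof -
  define c where "c = (\<lambda>k. msubst (C k) U)"
  define y where "y = z * D x - x * D z"
  define P P' where "P = (\<Sum>k\<le>N. c k * (x ^ k * z ^ (N - k)))"
    and "P' = (\<Sum>k\<le>N. c k * (of_nat k * x ^ (k - 1) * z ^ (N - k)))"
  have Dc: "F dvd U a * D (c k) - of_nat g * D (U a) * c k" if k: "k \<le> N" for k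
  proof -
    have "U a * D (c k) = (\<Sum>l\<le>n. msubst (partial l (C k)) U * (U a * D (U l)))"
      unfolding c_def chain_rule[OF D(1) homogeneous_vars[OF C[OF k]]]
      by (simp add: sum_distrib_left mult_ac)
    moreover have "of_nat g * D (U a) * c k = (\<Sum>l\<le>n. msubst (partial l (C k)) U * (U l * D (U a)))"
    proof -
      have "of_nat g * D (U a) * c k = D (U a) * (of_nat g * msubst (C k) U)"
        by (simp add: c_def mult_ac)
      also have "\<dots> = D (U a) * (\<Sum>l\<le>n. msubst (partial l (C k)) U * U l)"
        unfolding euler_msubst[OF C[OF k]] ..
      finally show ?thesis by (simp add: mult_ac sum_distrib_left)
    qed
    ultimately have "U a * D (c k) - of_nat g * D (U a) * c k =
      (\<Sum>l\<le>n. msubst (partial l (C k)) U * (U a * D (U l) - U l * D (U a)))"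
      by (simp add: sum_subtractf right_diff_distrib)
    moreover have "F dvd \<dots>" by (intro dvd_sum dvd_mult UD) simp
    ultimately show ?thesis by metis
  qed
  have mon: "z * D (x ^ k * z ^ (N - k)) =
    (of_nat k * x ^ (k - 1) * z ^ (N - k)) * y + of_nat N * D z * (x ^ k * z ^ (N - k))" if k: "k \<le> N" for k
  proof -
    have 1: "of_nat k * x ^ (k - 1) * x = of_nat k * x ^ k" by (cases k) auto
    have 2: "of_nat (N - k) * z ^ (N - k - 1) * z = of_nat (N - k) * z ^ (N - k)" by (cases "N - k") auto
    have "z * D (x ^ k * z ^ (N - k)) = of_nat k * x ^ (k - 1) * z ^ (N - k) * (z * D x)
        + (of_nat (N - k) * z ^ (N - k - 1) * z) * x ^ k * D z"
      by (simp add: derivation_mult[OF D(1)] derivation_power[OF D(1)] algebra_simps)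
    also have "\<dots> = of_nat k * x ^ (k - 1) * z ^ (N - k) * (z * D x)
        + (of_nat N - of_nat k) * z ^ (N - k) * x ^ k * D z"
      unfolding 2 using k by (simp add: of_nat_diff)
    also have "\<dots> = of_nat k * x ^ (k - 1) * z ^ (N - k) * (z * D x)
       - (of_nat k * x ^ k) * z ^ (N - k) * D z + of_nat N * D z * (x ^ k * z ^ (N - k))"
      by (simp add: algebra_simps)
    also have "\<dots> = of_nat k * x ^ (k - 1) * z ^ (N - k) * (z * D x)
       - (of_nat k * x ^ (k - 1) * x) * z ^ (N - k) * D z + of_nat N * D z * (x ^ k * z ^ (N - k))"
      unfolding 1 ..
    finally show ?thesis by (simp add: y_def algebra_simps)
  qed
  have "z * (U a * D P) = (\<Sum>k\<le>N. z * (x ^ k * z ^ (N - k)) * (U a * D (c k))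
      + U a * c k * (z * D (x ^ k * z ^ (N - k))))"
    by (simp add: P_def derivation_sum[OF D(1)] derivation_mult[OF D(1)] sum_distrib_left algebra_simps)
  also have "\<dots> = (\<Sum>k\<le>N. z * (x ^ k * z ^ (N - k)) * (U a * D (c k) - of_nat g * D (U a) * c k)
      + (of_nat g * D (U a) * z) * (c k * (x ^ k * z ^ (N - k)))
      + (U a * y) * (c k * (of_nat k * x ^ (k - 1) * z ^ (N - k)))
      + (U a * of_nat N * D z) * (c k * (x ^ k * z ^ (N - k))))"
    by (intro sum.cong refl, subst mon) (simp_all add: algebra_simps)
  also have "\<dots> = (\<Sum>k\<le>N. z * (x ^ k * z ^ (N - k)) * (U a * D (c k) - of_nat g * D (U a) * c k))
      + (of_nat g * D (U a) * z) * P + (U a * y) * P' + (U a * of_nat N * D z) * P"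
    unfolding P_def P'_def sum.distrib sum_distrib_left ..
  finally have *: "(U a * y) * P' = z * (U a * D P)
     - (\<Sum>k\<le>N. z * (x ^ k * z ^ (N - k)) * (U a * D (c k) - of_nat g * D (U a) * c k))
     - (of_nat g * D (U a) * z) * P - (U a * of_nat N * D z) * P" by (simp add: algebra_simps)
  have P: "F dvd P" using rel by (simp add: P_def c_def)
  have "F dvd (U a * y) * P'"
    unfolding * by (intro dvd_diff dvd_mult dvd_sum Dc derivation_dvd[OF D] P) auto
  moreover have "\<not> F dvd P'" using sep by (simp add: P'_def c_def)
  ultimately show ?thesis using a prime_elem_dvd_multD[OF F] y_def by blast
qed

text \<open>
  Suppose that \<open>w\<close> and \<open>v\<close> were independent.  The derivations \<open>F\<^sub>c \<partial>\<^sub>b - F\<^sub>b \<partial>\<^sub>c\<close> preserve the equation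
  \<open>F\<close>.  Leaving out \<open>b = c\<close> and one more index \<open>b0\<close>, there are \<open>n - 1\<close> of them.  A combination \<open>D\<close> maps \<open>U\<close>
  to a multiple of \<open>U\<close> iff the \<open>n + 1\<close> numbers \<open>y\<^sub>i = U\<^sub>a D(U\<^sub>i) - U\<^sub>i D(U\<^sub>a)\<close> vanish; but \<open>y\<^sub>a = 0\<close>, and the
  orthogonality to \<open>w\<close> and \<open>v\<close> determines two of the others.  The remaining \<open>n - 2\<close> equations have a
  nontrivial solution \<open>D\<close>.  It kills the ratios of the \<open>U\<^sub>i\<close> and, by separability, all
  \<open>X\<^sub>i / X\<^bsub>b0\<^esub>\<close>.  As it kills \<open>X\<^bsub>b0\<^esub>\<close> itself, it is trivial.
\<close>

lemma gauss_rank: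
  fixes F :: "'a::field mpol"
  assumes F: "prime_elem F" and n: "n \<ge> 2"
    and X: "\<And>i. i \<le> n \<Longrightarrow> \<not> F dvd mvar i"
    and c: "c \<le> n" "\<not> F dvd partial c F"
    and a: "a \<le> n" "\<not> F dvd U a"
    and sep: "\<And>i j. i \<le> n \<Longrightarrow> j \<le> n \<Longrightarrow> \<exists>N g C. (\<forall>k\<le>N. homogeneous n g (C k))
        \<and> F dvd (\<Sum>k\<le>N. msubst (C k) U * (mvar i ^ k * mvar j ^ (N - k)))
        \<and> \<not> F dvd (\<Sum>k\<le>N. msubst (C k) U * (of_nat k * mvar i ^ (k - 1) * mvar j ^ (N - k)))"
    and w: "F dvd (\<Sum>l\<le>n. w l * U l)" "\<And>D. derivation D \<Longrightarrow> F dvd D F \<Longrightarrow> F dvd (\<Sum>l\<le>n. w l * D (U l))"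
    and v: "F dvd (\<Sum>l\<le>n. v l * U l)" "\<And>D. derivation D \<Longrightarrow> F dvd D F \<Longrightarrow> F dvd (\<Sum>l\<le>n. v l * D (U l))"
    and ij: "i \<le> n" "j \<le> n"
  shows "F dvd w i * v j - w j * v i"
proof (rule ccontr)
  assume not: "\<not> F dvd w i * v j - w j * v i"
  have Fprime: "F dvd A \<or> F dvd B" if "F dvd A * B" for A B
    using prime_elem_dvd_multD[OF F that] .
  \<comment> \<open>Both vectors are orthogonal to \<open>U\<close>, so the minors without the index \<open>a\<close> determine the others.\<close>
  obtain k l where kl: "k \<le> n" "l \<le> n" "k \<noteq> a" "l \<noteq> a" "\<not> F dvd w k * v l - w l * v k"
  proof -
    have col: "\<exists>i'\<le>n. i' \<noteq> a \<and> \<not> F dvd w i' * v j' - w j' * v i'"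
      if "\<not> F dvd w a * v j' - w j' * v a" for j'
    proof (rule ccontr)
      assume "\<not> ?thesis"
      hence z: "F dvd w i' * v j' - w j' * v i'" if "i' \<in> {..n} - {a}" for i' using that by auto
      have "(\<Sum>l\<le>n. w l * U l) * v j' - (\<Sum>l\<le>n. v l * U l) * w j' = (\<Sum>l\<le>n. U l * (w l * v j' - w j' * v l))"
        by (simp add: sum_distrib_left right_diff_distrib sum_subtractf mult_ac)
      also have "\<dots> = U a * (w a * v j' - w j' * v a) + (\<Sum>l\<in>{..n} - {a}. U l * (w l * v j' - w j' * v l))"
        using a by (simp add: sum.remove[of _ a])
      finally have "U a * (w a * v j' - w j' * v a) = (\<Sum>l\<le>n. w l * U l) * v j' - (\<Sum>l\<le>n. v l * U l) * w j'
        - (\<Sum>l\<in>{..n} - {a}. U l * (w l * v j' - w j' * v l))" by simp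
      moreover have "F dvd \<dots>" by (intro dvd_diff dvd_sum dvd_mult z dvd_mult2 w(1) v(1))
      ultimately show False using Fprime that a by metis
    qed
    show ?thesis
    proof (cases "i = a \<or> j = a")
      case False
      thus ?thesis using that[of i j] ij not by auto
    next
      case True
      define j' where "j' = (if i = a then j else i)"
      have *: "\<not> F dvd w a * v j' - w j' * v a"
      proof (cases "i = a")
        case False
        hence "w a * v j' - w j' * v a = - (w i * v j - w j * v i)" using True by (simp add: j'_def)
        thus ?thesis using not by (simp only: dvd_minus_iff not_False_eq_True)
      qed (use not in \<open>simp add: j'_def\<close>)
      have "j' \<noteq> a" using * by auto
      moreover have "j' \<le> n" using ij by (simp add: j'_def)
      moreover obtain i' where "i' \<le> n" "i' \<noteq> a" "\<not> F dvd w i' * v j' - w j' * v i'" using col[OF *] by blast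
      ultimately show ?thesis using that by blast
    qed
  qed
  have "k \<noteq> l" using kl(5) by auto
  \<comment> \<open>The combination of all \<open>\<delta> b\<close> with coefficients \<open>X\<^sub>b\<close> is a multiple of the Euler derivation, which
    maps \<open>U\<close> to a multiple of \<open>U\<close>.  Leaving out \<open>b0\<close> excludes it.\<close>
  obtain b0 where b0: "b0 \<le> n" "b0 \<noteq> c" using n by (metis le_0_eq le_trans not_numeral_le_zero zero_le)
  define J where "J = {..n} - {c, b0}"
  define I where "I = {..n} - {a, k, l}"
  define \<delta> where "\<delta> = (\<lambda>b A. partial c F * partial b A - partial b F * partial c A)"
  have \<delta>: "derivation (\<delta> b)" for b
    unfolding \<delta>_def by (intro derivation_diff derivation_partial)
  have "card J = n + 1 - 2" unfolding J_def using b0 c by (subst card_Diff_subset) auto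
  moreover have "card I = n + 1 - 3" unfolding I_def using a kl \<open>k \<noteq> l\<close> by (subst card_Diff_subset) auto
  ultimately have "card I < card J" using n by simp
  moreover have "finite I" "finite J" by (auto simp: I_def J_def)
  ultimately obtain t where t: "\<exists>b\<in>J. \<not> F dvd t b"
    "\<forall>i\<in>I. F dvd (\<Sum>b\<in>J. (U a * \<delta> b (U i) - U i * \<delta> b (U a)) * t b)"
    using homogeneous_system[of "\<lambda>A. F dvd A" I J "\<lambda>i b. U a * \<delta> b (U i) - U i * \<delta> b (U a)"]
      Fprime F by (auto simp: prime_elem_def)
  define D where "D = (\<lambda>A. \<Sum>b\<in>J. t b * \<delta> b A)"
  have D: "derivation D" unfolding D_def by (rule derivation_combination[OF \<delta>])
  have "D F = 0" by (simp add: D_def \<delta>_def)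
  hence DF: "F dvd D F" by simp
  define y where "y = (\<lambda>i. U a * D (U i) - U i * D (U a))"
  have y_sum: "y i = (\<Sum>b\<in>J. (U a * \<delta> b (U i) - U i * \<delta> b (U a)) * t b)" for i
    by (simp add: y_def D_def sum_distrib_left right_diff_distrib sum_subtractf mult_ac)
  have orth: "F dvd u k * y k + u l * y l"
    if u: "F dvd (\<Sum>l\<le>n. u l * U l)" "F dvd (\<Sum>l\<le>n. u l * D (U l))" for u
  proof -
    have eq: "U a * (\<Sum>l\<le>n. u l * D (U l)) - D (U a) * (\<Sum>l\<le>n. u l * U l) = (\<Sum>l\<le>n. u l * y l)"
      by (simp add: y_def sum_distrib_left right_diff_distrib sum_subtractf mult_ac)
    have "F dvd (\<Sum>l\<le>n. u l * y l)" unfolding eq[symmetric] by (intro dvd_diff dvd_mult u)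
    also have "(\<Sum>l\<le>n. u l * y l) = (\<Sum>l\<in>{a, k, l}. u l * y l) + (\<Sum>l\<in>I. u l * y l)"
      unfolding I_def by (subst sum.subset_diff[of "{a, k, l}"]) (use a kl in auto)
    also have "(\<Sum>l\<in>{a, k, l}. u l * y l) = u k * y k + u l * y l"
      using kl \<open>k \<noteq> l\<close> by (simp add: y_def)
    finally have *: "F dvd u k * y k + u l * y l + (\<Sum>l\<in>I. u l * y l)" .
    have "F dvd (\<Sum>l\<in>I. u l * y l)" using t(2) by (intro dvd_sum dvd_mult) (simp add: y_sum)
    thus ?thesis using dvd_diff[OF *, of "\<Sum>l\<in>I. u l * y l"] by simp
  qed
  have ow: "F dvd w k * y k + w l * y l" and ov: "F dvd v k * y k + v l * y l"
    using orth w v D DF by auto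
  have "F dvd y k"
  proof -
    have eq: "(w k * v l - w l * v k) * y k = v l * (w k * y k + w l * y l) - w l * (v k * y k + v l * y l)"
      by (simp add: algebra_simps)
    have "F dvd (w k * v l - w l * v k) * y k" unfolding eq by (intro dvd_diff dvd_mult ow ov)
    thus ?thesis using Fprime kl(5) by blast
  qed
  moreover have "F dvd y l"
  proof -
    have eq: "(w k * v l - w l * v k) * y l = w k * (v k * y k + v l * y l) - v k * (w k * y k + w l * y l)"
      by (simp add: algebra_simps)
    have "F dvd (w k * v l - w l * v k) * y l" unfolding eq by (intro dvd_diff dvd_mult ow ov)
    thus ?thesis using Fprime kl(5) by blast
  qed
  ultimately have y: "F dvd y i" if "i \<le> n" for i
    using t(2) that by (cases "i \<in> I") (auto simp: I_def y_sum[symmetric], simp add: y_def)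
  have "F dvd t b" if b: "b \<in> J" for b
  proof -
    have D_mvar: "D (mvar m) = (if m \<in> J then t m * partial c F else 0)" if "m \<noteq> c" for m
    proof -
      have "D (mvar m) = (\<Sum>b\<in>J. if b = m then t m * partial c F else 0)"
        unfolding D_def \<delta>_def using that by (intro sum.cong refl) (simp add: partial_mvar)
      thus ?thesis by (simp add: J_def)
    qed
    obtain N g C where NC: "\<forall>k\<le>N. homogeneous n g (C k)"
        "F dvd (\<Sum>k\<le>N. msubst (C k) U * (mvar b ^ k * mvar b0 ^ (N - k)))"
        "\<not> F dvd (\<Sum>k\<le>N. msubst (C k) U * (of_nat k * mvar b ^ (k - 1) * mvar b0 ^ (N - k)))"
      using sep[of b b0] b b0 by (auto simp: J_def)
    have "F dvd mvar b0 * D (mvar b) - mvar b * D (mvar b0)"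
      by (rule derivation_separable[OF F D DF a(2) y[unfolded y_def] _ NC(2,3)]) (use NC(1) in auto)
    moreover have "D (mvar b0) = 0" "D (mvar b) = t b * partial c F"
      using D_mvar[of b0] D_mvar[of b] b b0 by (auto simp: J_def)
    ultimately have "F dvd mvar b0 * (t b * partial c F)" by simp
    thus ?thesis using Fprime X[OF b0(1)] c(2) by blast
  qed
  thus False using t(1) by blast
qed

section \<open>Algebraic dependence by counting monomials\<close>

definition monomials :: "nat \<Rightarrow> nat \<Rightarrow> (nat \<Rightarrow>\<^sub>0 nat) set" where
  "monomials n D = {m. keys m \<subseteq> {..n} \<and> (\<Sum>i\<le>n. lookup m i) = D}"

lemma homogeneous_iff_monomials: "homogeneous n D A \<longleftrightarrow> keys A \<subseteq> monomials n D"
  by (auto simp: homogeneous_def monomials_def)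

lemma monomials_le: "m \<in> monomials n D \<Longrightarrow> i \<le> n \<Longrightarrow> lookup m i \<le> D"
  unfolding monomials_def using member_le_sum[of i "{..n}" "lookup m"] by auto

lemma monomials_eqI:
  assumes "m \<in> monomials n D" "m' \<in> monomials n D" "\<And>i. i < n \<Longrightarrow> lookup m i = lookup m' i"
  shows "m = m'"
proof -
  have "(\<Sum>i<n. lookup m i) + lookup m n = (\<Sum>i<n. lookup m' i) + lookup m' n"
    using assms(1,2) unfolding monomials_def by (simp add: lessThan_Suc_atMost[symmetric])
  hence "lookup m n = lookup m' n" using assms(3) by simp
  moreover have "lookup m i = 0" "lookup m' i = 0" if "i > n" for i
    using assms(1,2) that unfolding monomials_def by (auto simp: in_keys_iff subset_iff)
  ultimately show ?thesis using assms(3) by (intro poly_mapping_eqI) (metis linorder_neqE_nat)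
qed

lemma finite_monomials: "finite (monomials n D)"
proof (rule inj_on_finite)
  show "inj_on (\<lambda>m. restrict (lookup m) {..n}) (monomials n D)"
  proof (rule inj_onI)
    fix m m' assume *: "m \<in> monomials n D" "m' \<in> monomials n D"
      "restrict (lookup m) {..n} = restrict (lookup m') {..n}"
    show "m = m'"
    proof (rule monomials_eqI[OF *(1,2)])
      fix i assume "i < n"
      thus "lookup m i = lookup m' i" using fun_cong[OF *(3), of i] by simp
    qed
  qed
  show "(\<lambda>m. restrict (lookup m) {..n}) ` monomials n D \<subseteq> PiE {..n} (\<lambda>_. {..D})"
    using monomials_le by (auto simp: PiE_def)
qed (auto intro: finite_PiE)

text \<open>
  The exponents of \<open>X\<^sub>1, \<dots>, X\<^sub>n\<close> can be any numbers up to \<open>N\<close>; that of \<open>X\<^sub>0\<close> fills up the degree.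
\<close>

lemma card_monomials_lower: "card (monomials n (n * N)) \<ge> (N + 1) ^ n"
proof -
  define mk :: "(nat \<Rightarrow> nat) \<Rightarrow> (nat \<Rightarrow>\<^sub>0 nat)" where "mk = (\<lambda>f. Abs_poly_mapping (\<lambda>i. if i = 0 then n * N - (\<Sum>i\<in>{1..n}. f i) else if i \<le> n then f i else 0))"
  have mk: "lookup (mk f) = (\<lambda>i. if i = 0 then n * N - (\<Sum>i\<in>{1..n}. f i) else if i \<le> n then f i else 0)" for f
    unfolding mk_def by (rule lookup_Abs_poly_mapping, rule finite_subset[of _ "{..n}"]) (auto split: if_splits)
  have "card (PiE {1..n} (\<lambda>_. {..N})) \<le> card (monomials n (n * N))"
  proof (rule card_inj_on_le)
    show "inj_on mk (PiE {1..n} (\<lambda>_. {..N}))"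
    proof (rule inj_onI)
      fix f g assume f: "f \<in> PiE {1..n} (\<lambda>_. {..N})" "g \<in> PiE {1..n} (\<lambda>_. {..N})" "mk f = mk g"
      show "f = g"
      proof (rule PiE_ext[OF f(1,2)])
        fix i assume "i \<in> {1..n}"
        thus "f i = g i" using arg_cong[OF f(3), of "\<lambda>m. lookup m i"] by (simp add: mk)
      qed
    qed
    show "mk ` PiE {1..n} (\<lambda>_. {..N}) \<subseteq> monomials n (n * N)"
    proof
      fix m assume "m \<in> mk ` PiE {1..n} (\<lambda>_. {..N})"
      then obtain f where f: "f \<in> PiE {1..n} (\<lambda>_. {..N})" "m = mk f" by blast
      have "(\<Sum>i\<in>{1..n}. f i) \<le> (\<Sum>i\<in>{1..n}. N)" by (rule sum_mono) (use f in auto)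
      hence le: "(\<Sum>i\<in>{1..n}. f i) \<le> n * N" by simp
      have "(\<Sum>i\<le>n. lookup m i) = lookup m 0 + (\<Sum>i\<in>{1..n}. lookup m i)"
        by (simp add: sum.atMost_shift sum.atLeast1_atMost_eq)
      also have "(\<Sum>i\<in>{1..n}. lookup m i) = (\<Sum>i\<in>{1..n}. f i)"
        by (rule sum.cong) (auto simp: f mk)
      also have "lookup m 0 = n * N - (\<Sum>i\<in>{1..n}. f i)" by (simp add: f mk)
      finally have "(\<Sum>i\<le>n. lookup m i) = n * N" using le by simp
      moreover have "keys m \<subseteq> {..n}" by (auto simp: in_keys_iff f mk split: if_splits)
      ultimately show "m \<in> monomials n (n * N)" by (simp add: monomials_def)
    qed
  qed (rule finite_monomials)
  thus ?thesis by (simp add: card_PiE)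
qed

text \<open>
  A monomial is divisible by \<open>X\<^sub>0\<^sup>d\<close>, or the exponent of \<open>X\<^sub>0\<close> takes one of \<open>d\<close> values.  In the second case,
  \<open>n - 1\<close> further exponents determine the last one.
\<close>

lemma card_monomials_upper:
  assumes "n \<ge> 1" "d \<le> D"
  shows "card (monomials n D) \<le> d * (D + 1) ^ (n - 1) + card (monomials n (D - d))"
proof -
  let ?l = lookup
  define A B where "A = {m \<in> monomials n D. ?l m 0 < d}" and "B = {m \<in> monomials n D. d \<le> ?l m 0}"
  have "card A \<le> card ({..<d} \<times> PiE {1..<n} (\<lambda>_. {..D}))"
  proof (rule card_inj_on_le)
    show "inj_on (\<lambda>m. (?l m 0, restrict (?l m) {1..<n})) A"
    proof (rule inj_onI)
      fix m m' assume *: "m \<in> A" "m' \<in> A" "(?l m 0, restrict (?l m) {1..<n}) = (?l m' 0, restrict (?l m') {1..<n})"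
      show "m = m'"
      proof (rule monomials_eqI[of _ n D])
        fix i assume i: "i < n"
        show "?l m i = ?l m' i"
        proof (cases "i = 0")
          case False
          have "restrict (?l m) {1..<n} i = restrict (?l m') {1..<n} i" using *(3) by simp
          thus ?thesis using i False by simp
        qed (use * in simp)
      qed (use * in \<open>auto simp: A_def\<close>)
    qed
    show "(\<lambda>m. (?l m 0, restrict (?l m) {1..<n})) ` A \<subseteq> {..<d} \<times> PiE {1..<n} (\<lambda>_. {..D})"
      using monomials_le by (auto simp: A_def PiE_def)
  qed (auto intro: finite_PiE)
  also have "\<dots> = d * (D + 1) ^ (n - 1)" by (simp add: card_cartesian_product card_PiE)
  finally have "card A \<le> d * (D + 1) ^ (n - 1)" .
  moreover have "card B \<le> card (monomials n (D - d))"
  proof (rule card_inj_on_le)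
    let ?f = "\<lambda>m. m - single 0 d"
    have restore: "?f m + single 0 d = m" if "m \<in> B" for m
      using that by (intro poly_mapping_eqI) (auto simp: B_def lookup_add lookup_minus lookup_single when_def)
    show "inj_on ?f B" by (rule inj_on_inverseI[of _ "\<lambda>m. m + single 0 d"]) (rule restore)
    show "?f ` B \<subseteq> monomials n (D - d)"
    proof
      fix k assume "k \<in> ?f ` B"
      then obtain m where m: "m \<in> B" "k = ?f m" by blast
      have "(\<Sum>i\<le>n. ?l (k + single 0 d) i) = D" "keys m \<subseteq> {..n}"
        using m(1) restore[OF m(1)] m(2) by (auto simp: B_def monomials_def)
      hence "(\<Sum>i\<le>n. ?l k i) + d = D" "keys k \<subseteq> {..n}"
        using m(2) by (auto simp: lookup_add sum.distrib lookup_single when_def in_keys_iff lookup_minus subset_iff)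
      thus "k \<in> monomials n (D - d)" by (simp add: monomials_def)
    qed
  qed (rule finite_monomials)
  moreover have "card (monomials n D) = card A + card B"
  proof -
    have "monomials n D = A \<union> B" "A \<inter> B = {}" by (auto simp: A_def B_def)
    thus ?thesis using finite_monomials[of n D] by (simp add: card_Un_disjoint)
  qed
  ultimately show ?thesis by linarith
qed

lemma lookup_mconst_mult: "lookup (mconst c * A) m = c * lookup (A :: 'a::comm_ring_1 mpol) m"
  unfolding mconst_def mult_map_scale_conv_mult[symmetric] by (simp add: lookup_map)

text \<open>
  Forms \<open>A\<close> of degree \<open>N\<close> and \<open>Q\<close> of degree \<open>e N - d\<close> with \<open>A(V) = F Q\<close> are the solutions of a linear system
  with one equation for each monomial of degree \<open>e N\<close>.  The number of equations minus the number
  of coefficients of \<open>Q\<close> grows like \<open>N\<^bsup>n - 1\<^esup>\<close>, the number of coefficients of \<open>A\<close> like \<open>N\<^sup>n\<close>.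
\<close>

lemma algebraic_dependence:
  fixes F :: "'a::field mpol"
  assumes n: "n \<ge> 1" and F: "homogeneous n d F" "F \<noteq> 0" and V: "\<And>i. i \<le> n \<Longrightarrow> homogeneous n e (V i)" and e: "e \<ge> 1"
  obtains N A where "A \<noteq> 0" "homogeneous n N A" "F dvd msubst A V"
proof -
  let ?l = lookup
  \<comment> \<open>The least value for which \<open>d (e n)\<^bsup>n-1\<^esup> (N' + 1)\<^bsup>n-1\<^esup> < (N' + 1)\<^sup>n\<close>.\<close>
  define N' where "N' = d * (e * n) ^ (n - 1)"
  define N where "N = n * N'"
  have "d * 1 \<le> N'" unfolding N'_def using n e by (intro mult_left_mono) auto
  moreover have "1 * N' \<le> (e * n) * N'" using e n by (intro mult_le_mono1) simp
  moreover have "(e * n) * N' = e * N" by (simp add: N_def)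
  ultimately have d_le: "d \<le> e * N" by linarith
  have "card (monomials n (e * N)) \<le> d * (e * N + 1) ^ (n - 1) + card (monomials n (e * N - d))"
    by (rule card_monomials_upper[OF n d_le])
  moreover have "d * (e * N + 1) ^ (n - 1) < (N' + 1) ^ n"
  proof -
    have "1 * 1 \<le> e * n" using e n by (intro mult_mono) auto
    hence "e * N + 1 \<le> e * n * (N' + 1)" by (simp add: N_def algebra_simps)
    hence "d * (e * N + 1) ^ (n - 1) \<le> d * (e * n * (N' + 1)) ^ (n - 1)" by (intro mult_left_mono power_mono) auto
    also have "\<dots> = N' * (N' + 1) ^ (n - 1)" by (subst power_mult_distrib) (simp only: N'_def mult.assoc)
    also have "\<dots> < (N' + 1) * (N' + 1) ^ (n - 1)" by simp
    also have "\<dots> = (N' + 1) ^ n" using n by (simp flip: power_Suc)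
    finally show ?thesis .
  qed
  moreover have "(N' + 1) ^ n \<le> card (monomials n N)" unfolding N_def by (rule card_monomials_lower)
  ultimately have "card (monomials n (e * N)) < card (monomials n N) + card (monomials n (e * N - d))" by linarith
  also have "\<dots> = card (monomials n N <+> monomials n (e * N - d))" by (simp add: card_Plus finite_monomials)
  finally have card: "card (monomials n (e * N)) < card (monomials n N <+> monomials n (e * N - d))" .
  define M :: "(nat \<Rightarrow>\<^sub>0 nat) \<Rightarrow> ((nat \<Rightarrow>\<^sub>0 nat) + (nat \<Rightarrow>\<^sub>0 nat)) \<Rightarrow> 'a" where
    "M = (\<lambda>m'. case_sum (\<lambda>m. ?l (mono_eval V m) m') (\<lambda>m. - ?l (mono_eval mvar m * F) m'))"
  obtain t where t: "\<exists>j\<in>monomials n N <+> monomials n (e * N - d). t j \<noteq> 0"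
    "\<forall>m'\<in>monomials n (e * N). (\<Sum>j\<in>monomials n N <+> monomials n (e * N - d). M m' j * t j) = 0"
    using homogeneous_system[of "\<lambda>c::'a. c = 0" "monomials n (e * N)" "monomials n N <+> monomials n (e * N - d)" M] card
    by (auto simp: finite_monomials)
  define A where "A = (\<Sum>m\<in>monomials n N. single m (t (Inl m)))"
  define Q where "Q = (\<Sum>m\<in>monomials n (e * N - d). single m (t (Inr m)))"
  have lA: "?l A m = t (Inl m)" if "m \<in> monomials n N" for m
    using that by (simp add: A_def lookup_sum lookup_single when_def finite_monomials)
  have lQ: "?l Q m = t (Inr m)" if "m \<in> monomials n (e * N - d)" for m
    using that by (simp add: Q_def lookup_sum lookup_single when_def finite_monomials)
  have A: "homogeneous n N A" unfolding A_def by (rule homogeneous_sum) (auto simp: homogeneous_iff_monomials)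
  have Q: "homogeneous n (e * N - d) Q" unfolding Q_def by (rule homogeneous_sum) (auto simp: homogeneous_iff_monomials)
  have "msubst A V - Q * F = 0"
  proof (rule poly_mapping_eqI)
    fix m'
    have "homogeneous n (e * N) (msubst A V - Q * F)"
      using homogeneous_mult[OF Q F(1)] homogeneous_msubst[OF A V] d_le by (intro homogeneous_diff) auto
    hence out: "?l (msubst A V - Q * F) m' = 0" if "m' \<notin> monomials n (e * N)"
      using that by (auto simp: homogeneous_iff_monomials in_keys_iff subset_iff)
    have 1: "?l (msubst A V) m' = (\<Sum>m\<in>monomials n N. M m' (Inl m) * t (Inl m))"
      unfolding A_def msubst_geval
      by (simp add: geval_sum is_hom_mconst geval_single lookup_sum lookup_mconst_mult M_def mult.commute[of _ "t _"])
    have 2: "?l (Q * F) m' = - (\<Sum>m\<in>monomials n (e * N - d). M m' (Inr m) * t (Inr m))"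
      unfolding Q_def mono_as_vars
      by (simp add: sum_distrib_right lookup_sum mult.assoc lookup_mconst_mult M_def sum_negf mult.commute[of "t _"])
    have "?l (msubst A V - Q * F) m' = (\<Sum>j\<in>monomials n N <+> monomials n (e * N - d). M m' j * t j)"
      by (simp add: lookup_minus 1 2 sum.Plus finite_monomials)
    thus "?l (msubst A V - Q * F) m' = ?l 0 m'" using t(2) out by (cases "m' \<in> monomials n (e * N)") auto
  qed
  hence eq: "msubst A V = F * Q" by (simp add: mult.commute)
  have "A \<noteq> 0"
  proof
    assume "A = 0"
    hence "F * Q = 0" using eq by (simp add: msubst_geval)
    hence "Q = 0" using F(2) by simp
    hence "t (Inl m) = 0" if "m \<in> monomials n N" for m using lA[OF that] \<open>A = 0\<close> by simp
    moreover have "t (Inr m) = 0" if "m \<in> monomials n (e * N - d)" for m using lQ[OF that] \<open>Q = 0\<close> by simp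
    ultimately show False using t(1) by auto
  qed
  thus ?thesis using that A eq by auto
qed

section \<open>Homogeneous components of equations\<close>

lemma homogeneous_dvd_component:
  assumes "homogeneous n d F" "F dvd B" shows "F dvd coeff (grade B) k"
proof -
  obtain Q where Q: "B = F * Q" using assms(2) by blast
  have "grade B = monom F d * grade Q" by (simp add: Q grade_hom grade_homogeneous[OF assms(1)])
  thus ?thesis by (simp add: coeff_monom_mult)
qed

text \<open>
  Positivity of \<open>e\<close> keeps components of different degrees of \<open>A\<close> apart after the substitution.
\<close>

lemma component_msubst:
  assumes V: "\<And>i. i \<le> n \<Longrightarrow> homogeneous n e (V i)" and e: "e \<ge> 1" and A: "vars A \<subseteq> {..n}"
  shows "coeff (grade (msubst A V)) (e * k) = msubst (coeff (grade A) k) V"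
proof -
  have "A = (\<Sum>k\<le>degree (grade A). coeff (grade A) k)"
    using grade_at_1[of A] by (simp add: poly_altdef)
  hence "grade (msubst A V) = (\<Sum>k\<le>degree (grade A). grade (msubst (coeff (grade A) k) V))"
    by (metis (no_types, lifting) hom_sum[OF is_hom_grade] hom_sum[OF is_hom_msubst] sum.cong)
  also have "\<dots> = (\<Sum>k\<le>degree (grade A). monom (msubst (coeff (grade A) k) V) (e * k))"
    by (intro sum.cong refl grade_homogeneous[where n = n] homogeneous_msubst[OF homogeneous_coeff_grade[OF A]]) (rule V)
  finally have "coeff (grade (msubst A V)) (e * k)
     = (\<Sum>j\<le>degree (grade A). if j = k then msubst (coeff (grade A) j) V else 0)"
    using e by (simp add: coeff_sum)
  also have "\<dots> = msubst (coeff (grade A) k) V"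
    by (simp add: coeff_eq_0 msubst_hom)
  finally show ?thesis .
qed

section \<open>The dual of a Frobenius nonclassical hypersurface\<close>

lemma prime_dvd_power_mpol:
  assumes "prime_elem (F :: 'a::idom mpol)" "F dvd A ^ k" shows "F dvd A"
  using assms(2)
proof (induction k)
  case 0
  thus ?case using assms(1) by (simp add: prime_elem_def)
next
  case (Suc k)
  thus ?case using prime_elem_dvd_multD[OF assms(1), of A "A ^ k"] by auto
qed

lemma tdeg_power: "A \<noteq> 0 \<Longrightarrow> tdeg (A ^ k :: 'a::idom mpol) = k * tdeg A"
  by (induction k) (auto simp: tdeg_mult)

lemma partial_not_in_vars: "l \<notin> vars A \<Longrightarrow> partial l A = 0"
proof (rule poly_mapping_eqI)
  fix m assume l: "l \<notin> vars A"
  have "m + single l 1 \<notin> keys A"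
    using l keys_subset_vars[of "m + single l 1" A] by (auto simp: keys_add_nat)
  thus "lookup (partial l A) m = lookup 0 m"
    by (simp add: lookup_partial in_keys_iff)
qed

text \<open>
  The hypotheses of the theorem, translated into congruences modulo the prime \<open>F\<close>.  The last
  one is the separability of \<open>X\<^sub>i / X\<^sub>j\<close> over the field generated by the ratios of the \<open>U\<^sub>l\<close>: a
  homogenized algebraic relation whose derivative is not zero.
\<close>

locale separable_power_gauss_map =
  fixes F :: "'a::alg_closed_field mpol" and U :: "nat \<Rightarrow> 'a mpol" and n d p h r q P e :: nat
  assumes n: "n \<ge> 2" and p: "prime p" "CHAR('a) = p" and q: "q = p ^ h"
    and r: "0 < r" "r < h" and P: "P = p ^ r"
    and F: "homogeneous n d F" "Factorial_Ring.irreducible F" and d: "d \<ge> 2"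
    and F_fixed: "map_coeffs (\<lambda>c. c ^ q) F = F"
    and X: "\<And>i. i \<le> n \<Longrightarrow> \<not> F dvd mvar i"
    and nonclassical: "F dvd (\<Sum>i\<le>n. partial i F * mvar i ^ q)"
    and U: "\<And>i. i \<le> n \<Longrightarrow> homogeneous n e (U i)" "\<exists>i\<le>n. \<not> F dvd U i"
    and smooth: "\<exists>i\<le>n. \<not> F dvd partial i F"
    and gauss_U: "\<And>i j. i \<le> n \<Longrightarrow> j \<le> n \<Longrightarrow> F dvd partial i F * U j ^ P - partial j F * U i ^ P"
    and sep: "\<And>i j. i \<le> n \<Longrightarrow> j \<le> n \<Longrightarrow> \<exists>N g C. (\<forall>k\<le>N. homogeneous n g (C k))
        \<and> F dvd (\<Sum>k\<le>N. msubst (C k) U * (mvar i ^ k * mvar j ^ (N - k)))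
        \<and> \<not> F dvd (\<Sum>k\<le>N. msubst (C k) U * (of_nat k * mvar i ^ (k - 1) * mvar j ^ (N - k)))"
begin

abbreviation \<Gamma> :: "nat \<Rightarrow> 'a mpol" where "\<Gamma> \<equiv> \<lambda>i. partial i F"

lemma prime_F: "prime_elem F"
  by (rule irreducible_imp_prime_mpol[OF F(2)])

lemma F_prime: "F dvd A * B \<Longrightarrow> F dvd A \<or> F dvd B"
  by (rule prime_elem_dvd_multD[OF prime_F])

lemma F_prime_power: "F dvd A ^ k \<Longrightarrow> F dvd A"
  by (rule prime_dvd_power_mpol[OF prime_F])

lemma F_not_unit: "\<not> F dvd 1" and F_nonzero: "F \<noteq> 0"
  using prime_F by (auto simp: prime_elem_def)

lemma F_not_dvd_mconst: "c \<noteq> 0 \<Longrightarrow> \<not> F dvd mconst c"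
  using mconst_dvd_1 F_not_unit dvd_trans by blast

lemma p_ge_2: "p \<ge> 2" and P_pos: "P > 0" and q_pos: "q > 0"
  using prime_ge_2_nat[OF p(1)] by (auto simp: P q)

lemma prime_CHAR: "prime CHAR('a)"
  using p by simp

lemma homogeneous_\<Gamma>: "homogeneous n (d - 1) (\<Gamma> i)"
  by (rule homogeneous_partial[OF F(1)])

lemma common_index: obtains a where "a \<le> n" "\<not> F dvd U a" "\<not> F dvd \<Gamma> a"
proof -
  obtain a c where a: "a \<le> n" "\<not> F dvd U a" and c: "c \<le> n" "\<not> F dvd \<Gamma> c" using U(2) smooth by blast
  have "\<not> F dvd \<Gamma> a"
  proof
    assume "F dvd \<Gamma> a"
    hence "F dvd \<Gamma> c * U a ^ P"
      using dvd_add[OF gauss_U[OF c(1) a(1)], of "\<Gamma> a * U c ^ P"] by simp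
    thus False using F_prime F_prime_power a c by blast
  qed
  thus ?thesis using that a by blast
qed

lemma compare_\<Gamma>_U:
  assumes C: "homogeneous n s C" and a: "a \<le> n"
  shows "F dvd U a ^ (P * s) * msubst C \<Gamma> - \<Gamma> a ^ s * msubst C (\<lambda>i. U i ^ P)"
proof -
  have "F dvd msubst C (\<lambda>i. U a ^ P * \<Gamma> i) - msubst C (\<lambda>i. \<Gamma> a * U i ^ P)"
  proof (rule msubst_cong_mod[OF homogeneous_vars[OF C]])
    fix i assume "i \<in> {..n}"
    hence "F dvd \<Gamma> i * U a ^ P - \<Gamma> a * U i ^ P" using gauss_U a by auto
    thus "F dvd U a ^ P * \<Gamma> i - \<Gamma> a * U i ^ P" by (simp add: mult.commute)
  qed
  thus ?thesis by (simp add: msubst_scale[OF C] power_mult)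
qed

text \<open>
  The vectors \<open>(X\<^sub>i\<^bsup>q'\<^esup>)\<close>, with \<open>q = q' P\<close>, and \<open>(B\<^sub>i(U))\<close>, with \<open>B\<close> the form whose coefficients are the
  \<open>P\<close>-th roots of those of \<open>A\<close>, are both orthogonal to \<open>U\<close> and to its derivatives along the
  hypersurface.  By \<open>gauss_rank\<close> they are proportional, and so are their \<open>P\<close>-th powers.
\<close>

lemma tangent:
  assumes A: "homogeneous n g A" "F dvd msubst A \<Gamma>" and ij: "i \<le> n" "j \<le> n"
  shows "F dvd mvar i ^ q * msubst (partial j A) \<Gamma> - mvar j ^ q * msubst (partial i A) \<Gamma>"
proof -
  obtain a where a: "a \<le> n" "\<not> F dvd U a" "\<not> F dvd \<Gamma> a" by (rule common_index)
  obtain B where B: "map_coeffs (\<lambda>c. c ^ P) B = A" "homogeneous n g B"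
    using frobenius_twist_surj[OF P_pos, of A] A(1) by metis
  define q' where "q' = p ^ (h - r)"
  have qq: "q = q' * P" unfolding q q'_def P using r by (simp flip: power_add)
  have mq: "mvar l ^ q = ((mvar l ^ q') ^ P :: 'a mpol)" for l
    by (simp add: qq power_mult)
  have twist: "msubst C U ^ P = msubst (map_coeffs (\<lambda>c. c ^ P) C) (\<lambda>i. U i ^ P)" for C
    by (rule msubst_frobenius[OF prime_CHAR]) (simp add: P p)
  have frob_hom: "is_hom (\<lambda>c::'a. c ^ P)" using is_hom_frobenius[OF prime_CHAR, of r] by (simp add: P p)
  have frob_hom': "is_hom (\<lambda>A::'a mpol. A ^ P)" using is_hom_frobenius_mpol[OF prime_CHAR, of r] by (simp add: P p)
  define w where "w = (\<lambda>i. mvar i ^ q' :: 'a mpol)"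
  define v where "v = (\<lambda>i. msubst (partial i B) U)"
  have BU: "F dvd msubst B U"
  proof -
    have "F dvd U a ^ (P * g) * msubst A \<Gamma>" using A(2) by simp
    hence "F dvd \<Gamma> a ^ g * msubst A (\<lambda>i. U i ^ P)"
      using dvd_diff[OF _ compare_\<Gamma>_U[OF A(1) a(1)], of "U a ^ (P * g) * msubst A \<Gamma>"] by simp
    thus ?thesis using F_prime F_prime_power a(3) twist[of B] B(1) by metis
  qed
  have wU: "F dvd (\<Sum>l\<le>n. w l * U l)"
  proof -
    have "\<Gamma> a * (\<Sum>l\<le>n. w l * U l) ^ P = (\<Sum>l\<le>n. mvar l ^ q * (\<Gamma> a * U l ^ P))"
      unfolding hom_sum[OF frob_hom'] w_def mq
      by (simp add: power_mult_distrib sum_distrib_left mult_ac)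
    also have "\<dots> = U a ^ P * (\<Sum>l\<le>n. \<Gamma> l * mvar l ^ q) - (\<Sum>l\<le>n. mvar l ^ q * (\<Gamma> l * U a ^ P - \<Gamma> a * U l ^ P))"
      by (simp add: sum_distrib_left right_diff_distrib sum_subtractf mult_ac)
    finally have eq: "\<Gamma> a * (\<Sum>l\<le>n. w l * U l) ^ P = \<dots>" .
    have "F dvd \<Gamma> a * (\<Sum>l\<le>n. w l * U l) ^ P"
      unfolding eq by (intro dvd_diff dvd_mult dvd_sum nonclassical gauss_U a) auto
    thus ?thesis using F_prime F_prime_power a(3) by blast
  qed
  have q'0: "of_nat q' = (0 :: 'a mpol)"
  proof -
    have "p dvd q'" unfolding q'_def using r by simp
    hence "CHAR('a mpol) dvd q'" by (simp add: CHAR_mpol p)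
    thus ?thesis by (simp only: of_nat_eq_0_iff_char_dvd)
  qed
  have wD: "F dvd (\<Sum>l\<le>n. w l * D (U l))" if D: "derivation D" "F dvd D F" for D
  proof -
    have "D (\<Sum>l\<le>n. w l * U l) = (\<Sum>l\<le>n. w l * D (U l))"
      by (simp add: derivation_sum[OF D(1)] derivation_mult[OF D(1)] w_def derivation_power[OF D(1)] q'0)
    thus ?thesis using derivation_dvd[OF D wU] by simp
  qed
  have vU: "F dvd (\<Sum>l\<le>n. v l * U l)"
    unfolding v_def euler_msubst[OF B(2)] using BU by simp
  have vD: "F dvd (\<Sum>l\<le>n. v l * D (U l))" if D: "derivation D" "F dvd D F" for D
    using derivation_dvd[OF D BU] by (simp add: v_def chain_rule[OF D(1) homogeneous_vars[OF B(2)]])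
  have "F dvd w i * v j - w j * v i"
    using gauss_rank[OF prime_F n X a(1) a(3) a(1) a(2) sep wU wD vU vD ij] by blast
  hence "F dvd (w i * v j - w j * v i) ^ P" using P_pos by (simp add: dvd_power_iff_le dvd_trans[OF _ dvd_power])
  also have "(w i * v j - w j * v i) ^ P = mvar i ^ q * v j ^ P - mvar j ^ q * v i ^ P"
    by (simp add: hom_diff[OF frob_hom'] power_mult_distrib w_def mq)
  also have v_P: "v i ^ P = msubst (partial i A) (\<lambda>i. U i ^ P)" for i
    unfolding v_def twist B(1)[symmetric] partial_map[OF frob_hom] ..
  finally have *: "F dvd mvar i ^ q * msubst (partial j A) (\<lambda>i. U i ^ P) - mvar j ^ q * msubst (partial i A) (\<lambda>i. U i ^ P)"
    unfolding v_P .
  define s where "s = g - 1"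
  have c: "F dvd U a ^ (P * s) * msubst (partial i A) \<Gamma> - \<Gamma> a ^ s * msubst (partial i A) (\<lambda>i. U i ^ P)" for i
    unfolding s_def by (rule compare_\<Gamma>_U[OF homogeneous_partial[OF A(1)] a(1)])
  have eq: "U a ^ (P * s) * (mvar i ^ q * msubst (partial j A) \<Gamma> - mvar j ^ q * msubst (partial i A) \<Gamma>)
    = mvar i ^ q * (U a ^ (P * s) * msubst (partial j A) \<Gamma> - \<Gamma> a ^ s * msubst (partial j A) (\<lambda>i. U i ^ P))
    - mvar j ^ q * (U a ^ (P * s) * msubst (partial i A) \<Gamma> - \<Gamma> a ^ s * msubst (partial i A) (\<lambda>i. U i ^ P))
    + \<Gamma> a ^ s * (mvar i ^ q * msubst (partial j A) (\<lambda>i. U i ^ P) - mvar j ^ q * msubst (partial i A) (\<lambda>i. U i ^ P))"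
    by (simp add: algebra_simps)
  have "F dvd U a ^ (P * s) * (mvar i ^ q * msubst (partial j A) \<Gamma> - mvar j ^ q * msubst (partial i A) \<Gamma>)"
    unfolding eq by (intro dvd_add dvd_diff dvd_mult c *)
  thus ?thesis using F_prime F_prime_power a(2) by blast
qed

definition in_J :: "'a mpol \<Rightarrow> bool" where
  "in_J A \<longleftrightarrow> A \<noteq> 0 \<and> vars A \<subseteq> {..n} \<and> F dvd msubst A \<Gamma>"

lemma in_J_tdeg: "in_J A \<Longrightarrow> tdeg A > 0"
proof (rule ccontr)
  assume A: "in_J A" "\<not> tdeg A > 0"
  then obtain c where "A = mconst c" using tdeg_0_mconst by blast
  thus False using A F_not_dvd_mconst[of c] by (cases "c = 0") (auto simp: in_J_def)
qed

lemma in_J_top_part: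
  assumes "in_J A" shows "in_J (top_part A)"
proof -
  have A: "A \<noteq> 0" "vars A \<subseteq> {..n}" "F dvd msubst A \<Gamma>" using assms by (auto simp: in_J_def)
  have "F dvd coeff (grade (msubst A \<Gamma>)) ((d - 1) * tdeg A)"
    by (rule homogeneous_dvd_component[OF F(1) A(3)])
  also have "coeff (grade (msubst A \<Gamma>)) ((d - 1) * tdeg A) = msubst (top_part A) \<Gamma>"
    unfolding top_part_def tdeg_def
    by (rule component_msubst[OF homogeneous_\<Gamma> _ A(2)]) (use d in simp)
  finally show ?thesis using top_part[OF A(1,2)] A(2) by (auto simp: in_J_def)
qed

text \<open>
  If an equation does not involve \<open>X\<^sub>l\<close>, then its \<open>l\<close>-th partial derivative is zero, and by \<open>tangent\<close> all
  partial derivatives are equations as well.  When the degree is smallest possible they must be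
  zero, so the equation is a \<open>p\<close>-th power, and its \<open>p\<close>-th root is an equation of smaller degree.
\<close>

lemma in_J_vars:
  assumes "in_J A0" "l \<le> n" shows "l \<in> vars A0"
proof (rule ccontr)
  assume "l \<notin> vars A0"
  define A1 where "A1 = arg_min tdeg (\<lambda>A. in_J A \<and> l \<notin> vars A)"
  have A1: "in_J A1 \<and> l \<notin> vars A1" unfolding A1_def
    by (rule arg_min_natI[of _ A0]) (use assms \<open>l \<notin> vars A0\<close> in auto)
  have min: "tdeg A1 \<le> tdeg B" if "in_J B" "l \<notin> vars B" for B
    unfolding A1_def by (rule arg_min_nat_le) (use that in auto)
  define A where "A = top_part A1"
  have A1': "A1 \<noteq> 0" "vars A1 \<subseteq> {..n}" using A1 by (auto simp: in_J_def)
  have A: "in_J A" "homogeneous n (tdeg A1) A" "l \<notin> vars A" "A \<noteq> 0"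
    using in_J_top_part A1 top_part[OF A1'] by (auto simp: A_def)
  have tA: "tdeg A = tdeg A1" by (rule tdeg_homogeneous[OF A(2,4)])
  have A1_pos: "tdeg A1 > 0" using in_J_tdeg A1 by blast
  have "partial j A = 0" if j: "j \<le> n" for j
  proof (rule ccontr)
    assume nz: "partial j A \<noteq> 0"
    have "F dvd mvar j ^ q * msubst (partial l A) \<Gamma> - mvar l ^ q * msubst (partial j A) \<Gamma>"
      by (rule tangent[OF A(2) _ j assms(2)]) (use A in \<open>auto simp: in_J_def\<close>)
    hence "F dvd mvar l ^ q * msubst (partial j A) \<Gamma>"
      by (simp add: partial_not_in_vars[OF A(3)] msubst_hom)
    hence "F dvd msubst (partial j A) \<Gamma>" using F_prime F_prime_power X[OF assms(2)] by blast
    hence "in_J (partial j A)" using nz vars_partial[of j A] A by (auto simp: in_J_def)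
    moreover have "l \<notin> vars (partial j A)" using vars_partial[of j A] A by auto
    ultimately have "tdeg A1 \<le> tdeg (partial j A)" by (rule min)
    moreover have "tdeg (partial j A) = tdeg A1 - 1"
      by (rule tdeg_homogeneous[OF homogeneous_partial[OF A(2)] nz])
    ultimately show False using A1_pos by simp
  qed
  hence pz: "partial i A = 0" if "i \<in> vars A" for i using that A(1) by (auto simp: in_J_def)
  obtain B where B: "A = B ^ p" "vars B \<subseteq> vars A"
    using partials_zero_imp_power[OF prime_CHAR pz] unfolding p(2) by blast
  have "B \<noteq> 0" using A(4) B(1) p_ge_2 by auto
  moreover have "F dvd msubst B \<Gamma>"
    using A(1) F_prime_power B(1) by (auto simp: in_J_def msubst_hom)
  ultimately have "in_J B" using B A(1) by (auto simp: in_J_def)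
  moreover have "l \<notin> vars B" using B A(3) by auto
  ultimately have "tdeg A1 \<le> tdeg B" by (rule min)
  moreover have "tdeg A = p * tdeg B" using B(1) \<open>B \<noteq> 0\<close> tdeg_power by blast
  moreover have "2 * tdeg B \<le> p * tdeg B" using p_ge_2 by (intro mult_le_mono1)
  ultimately show False using tA A1_pos by linarith
qed

definition dual_equation :: "'a mpol \<Rightarrow> bool" where
  "dual_equation G \<longleftrightarrow> Factorial_Ring.irreducible G \<and> (\<exists>g. homogeneous n g G)
     \<and> (\<forall>A. vars A \<subseteq> {..n} \<longrightarrow> (F dvd msubst A \<Gamma> \<longleftrightarrow> G dvd A))"

text \<open>
  An equation that is not a multiple of \<open>G\<close> would allow the elimination of a variable, against
  \<open>in_J_vars\<close>.
\<close>

lemma irreducible_in_J_imp_dual_equation: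
  assumes G: "Factorial_Ring.irreducible G" "homogeneous n g G" "in_J G"
  shows "dual_equation G"
  unfolding dual_equation_def
proof (intro conjI allI impI iffI)
  fix A :: "'a mpol" assume A: "vars A \<subseteq> {..n}"
  {
    assume *: "F dvd msubst A \<Gamma>"
    show "G dvd A"
    proof (rule ccontr)
      assume nd: "\<not> G dvd A"
      have l: "n \<in> vars G" by (rule in_J_vars[OF G(3)]) simp
      obtain c u v where c: "vars c \<subseteq> {..n} - {n}" "c \<noteq> 0" "c = u * G + v * A"
        by (rule elimination[OF G(1) l, of "{..n} - {n}" A]) (use A nd homogeneous_vars[OF G(2)] in auto)
      have "msubst c \<Gamma> = msubst u \<Gamma> * msubst G \<Gamma> + msubst v \<Gamma> * msubst A \<Gamma>"
        unfolding c(3) by (simp only: msubst_hom)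
      hence "F dvd msubst c \<Gamma>" using * G(3) by (simp add: in_J_def)
      hence "in_J c" using c by (auto simp: in_J_def)
      thus False using in_J_vars[of c n] c(1) by auto
    qed
  }
  assume "G dvd A"
  thus "F dvd msubst A \<Gamma>" using G(3)
    by (auto simp: in_J_def msubst_hom elim!: dvdE)
qed (use G in auto)

text \<open>
  The ideal of equations is prime, so an equation of smallest degree is irreducible.
\<close>

theorem dual_equation_exists: "\<exists>G. dual_equation G"
proof -
  obtain N A0 where A0: "A0 \<noteq> 0" "homogeneous n N A0" "F dvd msubst A0 \<Gamma>"
    by (rule algebraic_dependence[OF _ F(1) F_nonzero, of "d - 1" \<Gamma>])
       (use n d homogeneous_\<Gamma> in auto)
  have A0': "in_J A0" using A0 homogeneous_vars by (auto simp: in_J_def)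
  define A1 where "A1 = arg_min tdeg in_J"
  have A1: "in_J A1" unfolding A1_def by (rule arg_min_natI) (rule A0')
  have min: "tdeg A1 \<le> tdeg B" if "in_J B" for B
    unfolding A1_def by (rule arg_min_nat_le) (rule that)
  define G where "G = top_part A1"
  have A1': "A1 \<noteq> 0" "vars A1 \<subseteq> {..n}" using A1 by (auto simp: in_J_def)
  have G: "in_J G" "homogeneous n (tdeg A1) G" "G \<noteq> 0"
    using in_J_top_part[OF A1] top_part[OF A1'] by (auto simp: G_def)
  have tG: "tdeg G = tdeg A1" by (rule tdeg_homogeneous[OF G(2,3)])
  have "Factorial_Ring.irreducible G"
  proof (rule irreducibleI[OF G(3)])
    show "\<not> G dvd 1" using in_J_tdeg[OF G(1)] dvd_1_imp_tdeg by force
    fix A B assume AB: "G = A * B"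
    hence nz: "A \<noteq> 0" "B \<noteq> 0" using G(3) by auto
    have vars: "vars A \<subseteq> {..n}" "vars B \<subseteq> {..n}"
      using vars_subset_mult[of A B] vars_subset_mult[of B A] G(1,3) AB by (auto simp: in_J_def mult.commute)
    have "F dvd msubst A \<Gamma> * msubst B \<Gamma>" using G(1) by (simp add: in_J_def AB msubst_hom)
    hence "in_J A \<or> in_J B" using F_prime nz vars by (auto simp: in_J_def)
    hence "tdeg A1 \<le> tdeg A \<or> tdeg A1 \<le> tdeg B" using min by blast
    moreover have "tdeg A1 = tdeg A + tdeg B" using tG tdeg_mult[OF nz] AB by simp
    ultimately have "tdeg B = 0 \<or> tdeg A = 0" by linarith
    thus "A dvd 1 \<or> B dvd 1" using tdeg_0_imp_dvd_1 nz by blast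
  qed
  thus ?thesis using irreducible_in_J_imp_dual_equation G by blast
qed

lemma dual_equation_in_J:
  assumes "dual_equation G" shows "in_J G"
proof -
  have "vars G \<subseteq> {..n}" using assms homogeneous_vars by (auto simp: dual_equation_def)
  thus ?thesis using assms by (auto simp: dual_equation_def in_J_def irreducible_def)
qed

text \<open>
  The partial derivatives have smaller degree than \<open>G\<close>, so \<open>G\<close> divides only those that are zero; if all
  of them were zero, then \<open>G\<close> would be a \<open>p\<close>-th power.
\<close>

lemma dual_equation_smooth:
  assumes G: "dual_equation G" obtains l where "l \<le> n" "\<not> F dvd msubst (partial l G) \<Gamma>"
proof -
  obtain g where g: "homogeneous n g G" using G by (auto simp: dual_equation_def)
  have G0: "G \<noteq> 0" using dual_equation_in_J[OF G] by (auto simp: in_J_def)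
  have "tdeg G = g" by (rule tdeg_homogeneous[OF g G0])
  hence g_pos: "g > 0" using in_J_tdeg[OF dual_equation_in_J[OF G]] by simp
  have "\<exists>l\<le>n. \<not> F dvd msubst (partial l G) \<Gamma>"
  proof (rule ccontr)
    assume "\<not> ?thesis"
    hence dv: "G dvd partial l G" if "l \<le> n" for l
      using G that vars_partial[of l G] homogeneous_vars[OF g] by (auto simp: dual_equation_def)
    have "partial l G = 0" if l: "l \<le> n" for l
    proof (rule ccontr)
      assume nz: "partial l G \<noteq> 0"
      obtain H where H: "partial l G = G * H" using dv[OF l] by blast
      hence "tdeg (partial l G) = g + tdeg H" using nz tdeg_mult[of G H] \<open>tdeg G = g\<close> by auto
      moreover have "tdeg (partial l G) = g - 1" by (rule tdeg_homogeneous[OF homogeneous_partial[OF g] nz])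
      ultimately show False using g_pos by simp
    qed
    hence pz: "partial i G = 0" if "i \<in> vars G" for i using that homogeneous_vars[OF g] by auto
    obtain B where "G = B ^ p"
      using partials_zero_imp_power[OF prime_CHAR pz] unfolding p(2) by blast
    thus False using irreducible_not_power[of B p] p_ge_2 G by (auto simp: dual_equation_def)
  qed
  thus ?thesis using that by blast
qed

lemma dual_tangent:
  assumes "dual_equation G" "i \<le> n" "j \<le> n"
  shows "F dvd mvar i ^ q * msubst (partial j G) \<Gamma> - mvar j ^ q * msubst (partial i G) \<Gamma>"
  using assms dual_equation_in_J[OF assms(1)] tangent by (auto simp: dual_equation_def in_J_def)

end

section \<open>Closed sets\<close>

lemma ppoint_self: "x \<in> ppoint x"
  unfolding ppoint_def by (intro CollectI exI[of _ 1]) simp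

lemma ppoint_eqD:
  assumes "ppoint x = ppoint y" obtains c where "c \<noteq> 0" "y = (\<lambda>i. c * x i)"
  using assms ppoint_self[of y] that unfolding ppoint_def by blast

lemma in_hypersurface_iff:
  assumes "homogeneous n d F" "x \<in> hcoords n"
  shows "ppoint x \<in> hypersurface n F \<longleftrightarrow> meval F x = 0"
proof
  assume "ppoint x \<in> hypersurface n F"
  then obtain y where y: "ppoint x = ppoint y" "meval F y = 0" unfolding hypersurface_def by blast
  obtain c where c: "c \<noteq> 0" "y = (\<lambda>i. c * x i)" using ppoint_eqD[OF y(1)] by blast
  thus "meval F x = 0" using y(2) by (simp add: meval_scale[OF assms(1)])
qed (use assms in \<open>auto simp: hypersurface_def\<close>)

lemma vanishes_on_hypersurface_iff:
  assumes "homogeneous n d F"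
  shows "vanishes_on n (hypersurface n F) A \<longleftrightarrow> (\<forall>x\<in>hcoords n. meval F x = 0 \<longrightarrow> meval A x = 0)"
  unfolding vanishes_on_def using in_hypersurface_iff[OF assms] by blast

lemma mem_zariski_closure_iff:
  assumes "x \<in> hcoords n"
  shows "ppoint x \<in> zariski_closure n Y \<longleftrightarrow>
     (\<forall>d A. homogeneous n d A \<longrightarrow> vanishes_on n Y A \<longrightarrow> meval A x = 0)"
proof -
  have "vanishes_on n {ppoint x} A \<longleftrightarrow> meval A x = 0" if "homogeneous n d A" for d A
    unfolding vanishes_on_def using assms that
    by (auto elim!: ppoint_eqD simp: meval_scale)
  thus ?thesis using assms by (auto simp: zariski_closure_def pspace_def)
qed

lemma vanishes_on_zariski_closure_iff:
  assumes "homogeneous n d A"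
  shows "vanishes_on n (zariski_closure n Y) A \<longleftrightarrow> vanishes_on n Y A"
proof
  assume L: "vanishes_on n (zariski_closure n Y) A"
  show "vanishes_on n Y A" unfolding vanishes_on_def
  proof (intro ballI impI)
    fix x assume x: "x \<in> hcoords n" "ppoint x \<in> Y"
    have "ppoint x \<in> zariski_closure n Y"
      unfolding mem_zariski_closure_iff[OF x(1)] using x by (auto simp: vanishes_on_def)
    thus "meval A x = 0" using L x by (auto simp: vanishes_on_def)
  qed
next
  assume R: "vanishes_on n Y A"
  show "vanishes_on n (zariski_closure n Y) A" unfolding vanishes_on_def
    using R assms mem_zariski_closure_iff by blast
qed

lemma closed_set_eqI:
  assumes "A \<subseteq> pspace n" "B \<subseteq> pspace n" "\<And>x. x \<in> hcoords n \<Longrightarrow> ppoint x \<in> A \<longleftrightarrow> ppoint x \<in> B"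
  shows "A = B"
  using assms unfolding pspace_def by blast

lemma hypersurface_subset_pspace: "hypersurface n F \<subseteq> pspace n"
  by (auto simp: hypersurface_def pspace_def)

lemma zariski_closure_subset_pspace: "zariski_closure n Y \<subseteq> pspace n"
  by (auto simp: zariski_closure_def)

locale irreducible_hypersurface =
  fixes F :: "'a::alg_closed_field mpol" and n d :: nat
  assumes n_pos: "n \<ge> 1" and F_homogeneous: "homogeneous n d F" and F_irreducible: "Factorial_Ring.irreducible F"
begin

abbreviation Y :: "(nat \<Rightarrow> 'a) set set" where "Y \<equiv> hypersurface n F"

lemma prime_equation: "prime_elem F"
  by (rule irreducible_imp_prime_mpol[OF F_irreducible])

lemma vanishes_iff: "vars A \<subseteq> {..n} \<Longrightarrow> vanishes_on n Y A \<longleftrightarrow> F dvd A"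
  unfolding vanishes_on_hypersurface_iff[OF F_homogeneous]
  using hypersurface_nullstellensatz[OF F_irreducible homogeneous_vars[OF F_homogeneous] n_pos]
  by (auto elim!: dvdE simp: meval_hom)

lemma vanishes_homogeneous_iff: "homogeneous n g A \<Longrightarrow> vanishes_on n Y A \<longleftrightarrow> F dvd A"
  by (rule vanishes_iff) (rule homogeneous_vars)

text \<open>
  Multiplication by \<open>V\<^sub>a\<close> takes care of the points at which the map is not defined.
\<close>

lemma vanishes_on_image_iff:
  assumes V: "\<And>i. i \<le> n \<Longrightarrow> homogeneous n e (V i)" and a: "a \<le> n" "\<not> F dvd V a"
    and A: "homogeneous n g A"
  shows "vanishes_on n (map_image n Y V) A \<longleftrightarrow> F dvd msubst A V"
proof -
  let ?z = "\<lambda>x i. if i \<le> n then meval (V i) x else 0"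
  have mz: "meval A (?z x) = meval (msubst A V) x" for x
    unfolding meval_msubst by (rule meval_cong) (use homogeneous_vars[OF A] in auto)
  have vars: "vars (msubst A V) \<subseteq> {..n}"
    using homogeneous_vars[OF homogeneous_msubst[OF A V]] by simp
  show ?thesis
  proof
    assume L: "vanishes_on n (map_image n Y V) A"
    have "meval (msubst A V * V a) x = 0" if x: "x \<in> hcoords n" "ppoint x \<in> Y" for x
    proof (cases "meval (V a) x = 0")
      case False
      hence "ppoint (?z x) \<in> map_image n Y V" "?z x \<in> hcoords n"
        using x a(1) by (auto simp: map_image_def hcoords_def)
      hence "meval A (?z x) = 0" using L by (auto simp: vanishes_on_def)
      thus ?thesis by (simp add: mz meval_hom)
    qed (simp add: meval_hom)
    hence "vanishes_on n Y (msubst A V * V a)" by (simp add: vanishes_on_def)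
    moreover have "vars (msubst A V * V a) \<subseteq> {..n}"
      using vars homogeneous_vars[OF V[OF a(1)]] by (rule vars_mult)
    ultimately have "F dvd msubst A V * V a" using vanishes_iff by blast
    thus "F dvd msubst A V" using prime_elem_dvd_multD[OF prime_equation] a(2) by blast
  next
    assume "F dvd msubst A V"
    hence van: "vanishes_on n Y (msubst A V)" using vanishes_iff[OF vars] by simp
    show "vanishes_on n (map_image n Y V) A" unfolding vanishes_on_def
    proof (intro ballI impI)
      fix y assume y: "y \<in> hcoords n" "ppoint y \<in> map_image n Y V"
      then obtain x where x: "ppoint y = ppoint (?z x)" "x \<in> hcoords n" "ppoint x \<in> Y"
        unfolding map_image_def by blast
      obtain c where c: "c \<noteq> 0" "?z x = (\<lambda>i. c * y i)" using ppoint_eqD[OF x(1)] by blast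
      have "meval A (?z x) = 0" using van x by (simp add: mz vanishes_on_def)
      thus "meval A y = 0" using c by (simp add: meval_scale[OF A])
    qed
  qed
qed

lemma closure_image_eq_hypersurface:
  assumes V: "\<And>i. i \<le> n \<Longrightarrow> homogeneous n e (V i)" and a: "a \<le> n" "\<not> F dvd V a"
    and G: "homogeneous n g G" and eqs: "\<And>A. vars A \<subseteq> {..n} \<Longrightarrow> F dvd msubst A V \<longleftrightarrow> G dvd A"
  shows "zariski_closure n (map_image n Y V) = hypersurface n G"
proof (rule closed_set_eqI[OF zariski_closure_subset_pspace hypersurface_subset_pspace])
  fix x :: "nat \<Rightarrow> 'a" assume x: "x \<in> hcoords n"
  have iff: "vanishes_on n (map_image n Y V) A \<longleftrightarrow> G dvd A" if "homogeneous n g' A" for g' A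
    using vanishes_on_image_iff[where V = V and e = e and a = a, OF V a that] eqs homogeneous_vars[OF that] by simp
  have "(\<forall>d A. homogeneous n d A \<longrightarrow> vanishes_on n (map_image n Y V) A \<longrightarrow> meval A x = 0) \<longleftrightarrow> meval G x = 0"
    using iff G by (auto elim!: dvdE simp: meval_hom)
  thus "ppoint x \<in> zariski_closure n (map_image n Y V) \<longleftrightarrow> ppoint x \<in> hypersurface n G"
    unfolding mem_zariski_closure_iff[OF x] in_hypersurface_iff[OF G x] .
qed

end

context separable_power_gauss_map
begin

sublocale irreducible_hypersurface F n d
  by unfold_locales (use n F in auto)

lemma strict_dual_eq:
  assumes "dual_equation G" shows "strict_dual n F = hypersurface n G"
proof -
  obtain a where a: "a \<le> n" "\<not> F dvd \<Gamma> a" using smooth by blast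
  obtain g where g: "homogeneous n g G" using assms by (auto simp: dual_equation_def)
  show ?thesis unfolding strict_dual_def gauss_map_def
    by (rule closure_image_eq_hypersurface[where V = \<Gamma> and e = "d - 1" and a = a, OF homogeneous_\<Gamma> a g])
       (use assms in \<open>auto simp: dual_equation_def\<close>)
qed

text \<open>
  By the Nullstellensatz \<open>G\<close> is a multiple of the generator of the equations of the dual.  So it vanishes
  on the image of \<open>\<Gamma>\<close>, and each irreducible polynomial that does is a generator.
\<close>

lemma irreducible_equation_strict_dual:
  assumes "irreducible_equation n G (strict_dual n F)" shows "dual_equation G"
proof -
  obtain G0 where G0: "dual_equation G0" using dual_equation_exists by blast
  obtain g0 where g0: "homogeneous n g0 G0" using G0 by (auto simp: dual_equation_def)
  obtain g where g: "homogeneous n g G" and irr: "Factorial_Ring.irreducible G"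
    and eq: "hypersurface n G0 = hypersurface n G"
    using assms strict_dual_eq[OF G0] by (auto simp: irreducible_equation_def)
  interpret G0: irreducible_hypersurface G0 n g0
    by unfold_locales (use n g0 G0 in \<open>auto simp: dual_equation_def\<close>)
  have "vanishes_on n (hypersurface n G0) G"
    unfolding eq by (simp add: vanishes_on_hypersurface_iff[OF g])
  hence "G0 dvd G" using G0.vanishes_homogeneous_iff[OF g] by simp
  hence "in_J G" using G0 irr homogeneous_vars[OF g] by (auto simp: in_J_def dual_equation_def irreducible_def)
  thus ?thesis using irreducible_in_J_imp_dual_equation irr g by blast
qed

lemma dual_equation_irreducible_equation:
  "dual_equation G \<Longrightarrow> irreducible_equation n G (strict_dual n F)"
  using strict_dual_eq by (auto simp: irreducible_equation_def dual_equation_def)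

text \<open>
  The coordinates of \<open>\<Gamma>' \<circ> \<Gamma>\<close>.
\<close>

abbreviation \<Psi> :: "'a mpol \<Rightarrow> nat \<Rightarrow> 'a mpol" where
  "\<Psi> G \<equiv> \<lambda>i. msubst (partial i G) \<Gamma>"

lemma frob_q: "is_hom (\<lambda>c::'a. c ^ q)"
  using is_hom_frobenius[OF prime_CHAR, of h] by (simp add: q p)

lemma msubst_frobenius_map:
  "msubst (map_coeffs (\<lambda>c. c ^ q) B) (\<lambda>i. mvar i ^ q) = (B :: 'a mpol) ^ q"
  using msubst_frobenius[OF prime_CHAR, of q h B mvar] by (simp add: q p msubst_mvar_id)

lemma map_frobenius_inj:
  fixes A B :: "'a mpol"
  assumes "map_coeffs (\<lambda>c::'a. c ^ q) A = map_coeffs (\<lambda>c. c ^ q) B" shows "A = B"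
proof -
  have "map_coeffs (\<lambda>c. c ^ q) (A - B) = 0" using assms by (simp add: hom_diff[OF is_hom_map[OF frob_q]])
  hence "lookup (A - B) m ^ q = 0" for m
    using q_pos by (metis lookup_map lookup_zero zero_power)
  hence "A - B = 0" by (intro poly_mapping_eqI) simp
  thus ?thesis by simp
qed

text \<open>
  The twist is an automorphism of the polynomial ring, and it fixes \<open>F\<close>.
\<close>

lemma dvd_frobenius_twist:
  "F dvd map_coeffs (\<lambda>c. c ^ q) B \<longleftrightarrow> F dvd B"
proof
  assume "F dvd map_coeffs (\<lambda>c. c ^ q) B"
  then obtain Q where Q: "map_coeffs (\<lambda>c. c ^ q) B = F * Q" by blast
  obtain Q' where "map_coeffs (\<lambda>c. c ^ q) Q' = Q" using frobenius_twist_surj[OF q_pos, of Q] by blast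
  hence "map_coeffs (\<lambda>c. c ^ q) B = map_coeffs (\<lambda>c. c ^ q) (F * Q')"
    by (simp add: Q hom_mult[OF is_hom_map[OF frob_q]] F_fixed)
  hence "B = F * Q'" by (rule map_frobenius_inj)
  thus "F dvd B" by simp
next
  assume "F dvd B"
  then obtain Q where "B = F * Q" by blast
  thus "F dvd map_coeffs (\<lambda>c. c ^ q) B" by (simp add: hom_mult[OF is_hom_map[OF frob_q]] F_fixed)
qed

lemma dvd_msubst_frobenius: "F dvd msubst A (\<lambda>i. mvar i ^ q) \<longleftrightarrow> F dvd A"
proof -
  obtain B where B: "map_coeffs (\<lambda>c. c ^ q) B = A" using frobenius_twist_surj[OF q_pos, of A] by blast
  have "F dvd B ^ q \<longleftrightarrow> F dvd B" using F_prime_power q_pos by (metis dvd_power dvd_trans)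
  thus ?thesis using msubst_frobenius_map[of B] dvd_frobenius_twist[of B] B by simp
qed

lemma compare_\<Psi>_frobenius:
  assumes G: "dual_equation G" and A: "homogeneous n s A" and l: "l \<le> n"
  shows "F dvd (mvar l ^ q) ^ s * msubst A (\<Psi> G) - \<Psi> G l ^ s * msubst A (\<lambda>i. mvar i ^ q)"
proof -
  have "F dvd msubst A (\<lambda>i. mvar l ^ q * \<Psi> G i) - msubst A (\<lambda>i. \<Psi> G l * mvar i ^ q)"
  proof (rule msubst_cong_mod[OF homogeneous_vars[OF A]])
    fix i assume "i \<in> {..n}"
    thus "F dvd mvar l ^ q * \<Psi> G i - \<Psi> G l * mvar i ^ q"
      using dual_tangent[OF G l, of i] by (simp add: mult.commute)
  qed
  thus ?thesis by (simp add: msubst_scale[OF A])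
qed

text \<open>
  Since \<open>\<Psi>\<close> is proportional to \<open>(X\<^sub>i\<^sup>q)\<close>, the question is whether \<open>A(X\<^sub>0\<^sup>q, \<dots>, X\<^sub>n\<^sup>q)\<close>, the \<open>q\<close>-th power of a twist
  of \<open>A\<close>, is divisible by \<open>F\<close>.
\<close>

lemma dvd_msubst_\<Psi>_iff:
  assumes G: "dual_equation G" and A: "homogeneous n s A"
  shows "F dvd msubst A (\<Psi> G) \<longleftrightarrow> F dvd A"
proof -
  obtain l where l: "l \<le> n" "\<not> F dvd \<Psi> G l" by (rule dual_equation_smooth[OF G])
  let ?a = "(mvar l ^ q) ^ s * msubst A (\<Psi> G)" and ?b = "\<Psi> G l ^ s * msubst A (\<lambda>i. mvar i ^ q)"
  have d: "F dvd ?a - ?b" by (rule compare_\<Psi>_frobenius[OF G A l(1)])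
  have "F dvd ?a \<longleftrightarrow> F dvd ?b" using dvd_diff[OF _ d, of ?a] dvd_add[OF d, of ?b] by auto
  moreover have "F dvd ?a \<longleftrightarrow> F dvd msubst A (\<Psi> G)" using F_prime F_prime_power X[OF l(1)] by (meson dvd_mult)
  moreover have "F dvd ?b \<longleftrightarrow> F dvd msubst A (\<lambda>i. mvar i ^ q)" using F_prime F_prime_power l(2) by (meson dvd_mult)
  ultimately show ?thesis using dvd_msubst_frobenius by simp
qed

text \<open>
  A form \<open>A\<close> vanishes on the image of \<open>\<Gamma>'\<close> iff \<open>G\<close> divides \<open>A(\<Gamma>')\<close> iff \<open>F\<close> divides \<open>A(\<Gamma>' \<circ> \<Gamma>)\<close>, and
  \<open>\<Gamma>' \<circ> \<Gamma>\<close> is \<open>\<Psi>\<close>.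
\<close>

theorem bidual:
  assumes G: "dual_equation G" shows "strict_dual n G = hypersurface n F"
proof -
  obtain g where g: "homogeneous n g G" using G by (auto simp: dual_equation_def)
  interpret G: irreducible_hypersurface G n g
    by unfold_locales (use n g G in \<open>auto simp: dual_equation_def\<close>)
  obtain l where l: "l \<le> n" "\<not> F dvd \<Psi> G l" by (rule dual_equation_smooth[OF G])
  have l': "\<not> G dvd partial l G"
    using l G vars_partial[of l G] homogeneous_vars[OF g] by (auto simp: dual_equation_def)
  have hom: "homogeneous n (g - 1) (partial i G)" for i by (rule homogeneous_partial[OF g])
  have iff: "vanishes_on n (map_image n (hypersurface n G) (gauss_map G)) A \<longleftrightarrow> F dvd A"
    if A: "homogeneous n s A" for s A
  proof -
    have "vanishes_on n (map_image n (hypersurface n G) (gauss_map G)) A \<longleftrightarrow> G dvd msubst A (gauss_map G)"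
      by (rule G.vanishes_on_image_iff[OF _ l(1) _ A]) (use hom l' in \<open>auto simp: gauss_map_def\<close>)
    also have "\<dots> \<longleftrightarrow> F dvd msubst (msubst A (gauss_map G)) \<Gamma>"
      using G homogeneous_vars[OF homogeneous_msubst[OF A hom]]
      by (auto simp: dual_equation_def gauss_map_def)
    also have "\<dots> \<longleftrightarrow> F dvd A"
      by (simp add: msubst_msubst gauss_map_def dvd_msubst_\<Psi>_iff[OF G A])
    finally show ?thesis .
  qed
  show ?thesis unfolding strict_dual_def
  proof (rule closed_set_eqI[OF zariski_closure_subset_pspace hypersurface_subset_pspace])
    fix x :: "nat \<Rightarrow> 'a" assume x: "x \<in> hcoords n"
    show "ppoint x \<in> zariski_closure n (map_image n (hypersurface n G) (gauss_map G))
        \<longleftrightarrow> ppoint x \<in> hypersurface n F"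
      unfolding mem_zariski_closure_iff[OF x] in_hypersurface_iff[OF F(1) x]
      using iff F(1) by (auto elim!: dvdE simp: meval_hom)
  qed
qed

theorem gauss_comp_gauss_eq_frobenius:
  assumes G: "dual_equation G"
  shows "rational_map_eq n Y (rational_comp (gauss_map G) (gauss_map F)) (frobenius_map q)"
proof -
  obtain g where g: "homogeneous n g G" using G by (auto simp: dual_equation_def)
  have comp: "rational_comp (gauss_map G) (gauss_map F) = \<Psi> G"
    by (simp add: rational_comp_def gauss_map_def)
  have hom: "homogeneous n ((d - 1) * (g - 1)) (\<Psi> G i)" for i
    by (rule homogeneous_msubst[OF homogeneous_partial[OF g] homogeneous_\<Gamma>])
  have hom': "homogeneous n q (mvar i ^ q :: 'a mpol)" if "i \<le> n" for i
    using homogeneous_power[OF homogeneous_mvar[OF that], of q] by simp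
  obtain l where l: "l \<le> n" "\<not> F dvd \<Psi> G l" by (rule dual_equation_smooth[OF G])
  have "\<not> F dvd mvar l ^ q" using F_prime_power X[OF l(1)] by blast
  hence 1: "rational_map n Y (frobenius_map q)"
    unfolding rational_map_def frobenius_map_def using hom' l(1) vanishes_homogeneous_iff by blast
  have 2: "rational_map n Y (\<Psi> G)"
    unfolding rational_map_def using hom l vanishes_homogeneous_iff by blast
  have "vanishes_on n Y (\<Psi> G i * mvar j ^ q - \<Psi> G j * mvar i ^ q)" if ij: "i \<le> n" "j \<le> n" for i j
  proof -
    have "homogeneous n ((d - 1) * (g - 1) + q) (\<Psi> G i * mvar j ^ q - \<Psi> G j * mvar i ^ q)"
      by (intro homogeneous_diff homogeneous_mult hom hom' ij)
    moreover have "F dvd \<Psi> G i * mvar j ^ q - \<Psi> G j * mvar i ^ q"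
      using dual_tangent[OF G ij(2,1)] by (simp add: mult.commute)
    ultimately show ?thesis using vanishes_homogeneous_iff by blast
  qed
  thus ?thesis using 1 2 by (simp add: rational_map_eq_def comp frobenius_map_def)
qed

end

section \<open>The function field of a hypersurface\<close>

lemma Union_image_const: "A \<noteq> {} \<Longrightarrow> (\<And>a. a \<in> A \<Longrightarrow> f a = c) \<Longrightarrow> \<Union>(f ` A) = c"
  by auto

context irreducible_hypersurface
begin

abbreviation L :: "('a mpol \<times> 'a mpol) set ring" where "L \<equiv> function_field n Y"

definition fraction :: "'a mpol \<Rightarrow> 'a mpol \<Rightarrow> bool" where
  "fraction A B \<longleftrightarrow> (\<exists>g. homogeneous n g A \<and> homogeneous n g B) \<and> \<not> F dvd B"

definition fr :: "'a mpol \<Rightarrow> 'a mpol \<Rightarrow> ('a mpol \<times> 'a mpol) set" where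
  "fr A B = ff_class n Y (A, B)"

lemma F_prime_dvd: "F dvd A * B \<Longrightarrow> F dvd A \<or> F dvd B"
  by (rule prime_elem_dvd_multD[OF prime_equation])

lemma not_dvd_1: "\<not> F dvd 1"
  using prime_equation by (simp add: prime_elem_def)

lemma ff_pairs_iff: "(A, B) \<in> ff_pairs n Y \<longleftrightarrow> fraction A B"
  using vanishes_homogeneous_iff by (auto simp: ff_pairs_def fraction_def)

lemma ff_rel_iff: "((A, B), (C, D)) \<in> ff_rel n Y \<longleftrightarrow> fraction A B \<and> fraction C D \<and> F dvd A * D - C * B"
proof (cases "fraction A B \<and> fraction C D")
  case True
  then obtain g g' where "homogeneous n g A" "homogeneous n g B" "homogeneous n g' C" "homogeneous n g' D"
    by (auto simp: fraction_def)
  hence "homogeneous n (g + g') (A * D - C * B)"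
    using homogeneous_mult[of n g A g' D] homogeneous_mult[of n g' C g B]
    by (intro homogeneous_diff) (simp_all add: add.commute)
  thus ?thesis using True vanishes_homogeneous_iff by (simp add: ff_rel_def ff_pairs_iff)
qed (auto simp: ff_rel_def ff_pairs_iff)

lemma equiv_ff_rel: "equiv (ff_pairs n Y) (ff_rel n Y)"
proof (rule equivI)
  show "ff_rel n Y \<subseteq> ff_pairs n Y \<times> ff_pairs n Y"
    by (auto simp: ff_rel_def)
  show "refl_on (ff_pairs n Y) (ff_rel n Y)"
    by (auto simp: refl_on_def ff_rel_iff ff_pairs_iff)
  show "sym (ff_rel n Y)"
  proof (rule symI, clarify)
    fix A B C D assume "((A, B), (C, D)) \<in> ff_rel n Y"
    moreover have "C * B - A * D = - (A * D - C * B)" by simp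
    ultimately show "((C, D), (A, B)) \<in> ff_rel n Y" by (metis ff_rel_iff dvd_minus_iff)
  qed
  show "trans (ff_rel n Y)"
  proof (rule transI, clarify)
    fix A B C D E G
    assume *: "((A, B), (C, D)) \<in> ff_rel n Y" "((C, D), (E, G)) \<in> ff_rel n Y"
    have "D * (A * G - E * B) = G * (A * D - C * B) + B * (C * G - E * D)" by (simp add: algebra_simps)
    moreover have "F dvd G * (A * D - C * B) + B * (C * G - E * D)"
      using * by (intro dvd_add dvd_mult) (auto simp: ff_rel_iff)
    ultimately have "F dvd D * (A * G - E * B)" by metis
    hence "F dvd A * G - E * B" using * F_prime_dvd by (auto simp: ff_rel_iff fraction_def)
    thus "((A, B), (E, G)) \<in> ff_rel n Y" using * by (auto simp: ff_rel_iff)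
  qed
qed

lemma fr_eq_iff:
  assumes "fraction A B" "fraction C D" shows "fr A B = fr C D \<longleftrightarrow> F dvd A * D - C * B"
  unfolding fr_def ff_class_def
  using eq_equiv_class_iff[OF equiv_ff_rel, of "(A, B)" "(C, D)"] assms
  by (auto simp: ff_pairs_iff ff_rel_iff)

lemma carrier_L: "carrier L = {fr A B | A B. fraction A B}"
proof -
  have "carrier L = (\<lambda>p. ff_rel n Y `` {p}) ` ff_pairs n Y"
    by (auto simp: function_field_def quotient_def)
  also have "ff_pairs n Y = {(A, B). fraction A B}"
    using ff_pairs_iff by auto
  finally show ?thesis by (auto simp: fr_def ff_class_def image_iff)
qed

lemma fr_closed: "fraction A B \<Longrightarrow> fr A B \<in> carrier L"
  by (auto simp: carrier_L)

lemma mem_fr: "fraction A B \<Longrightarrow> (C, D) \<in> fr A B \<longleftrightarrow> fraction C D \<and> fr C D = fr A B"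
  using fr_eq_iff[of A B C D] by (auto simp: fr_def ff_class_def ff_rel_iff)

lemma fraction_mult:
  assumes "fraction A B" "fraction C D" shows "fraction (A * C) (B * D)"
proof -
  obtain g g' where "homogeneous n g A" "homogeneous n g B" "homogeneous n g' C" "homogeneous n g' D"
    using assms by (auto simp: fraction_def)
  hence "homogeneous n (g + g') (A * C)" "homogeneous n (g + g') (B * D)" by (auto intro: homogeneous_mult)
  thus ?thesis using assms F_prime_dvd by (auto simp: fraction_def)
qed

lemma fraction_add:
  assumes "fraction A B" "fraction C D" shows "fraction (A * D + C * B) (B * D)"
proof -
  obtain g g' where *: "homogeneous n g A" "homogeneous n g B" "homogeneous n g' C" "homogeneous n g' D"
    using assms by (auto simp: fraction_def)
  have "homogeneous n (g + g') (A * D + C * B)"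
    using homogeneous_mult[OF *(1,4)] homogeneous_mult[OF *(3,2)]
    by (intro homogeneous_add) (simp_all add: add.commute)
  moreover have "homogeneous n (g + g') (B * D)" using * by (auto intro: homogeneous_mult)
  ultimately show ?thesis using assms F_prime_dvd by (auto simp: fraction_def)
qed

lemma fraction_uminus: "fraction A B \<Longrightarrow> fraction (- A) B"
  unfolding fraction_def using homogeneous_uminus by blast

lemma fraction_0_1: "fraction 0 1" and fraction_1_1: "fraction 1 1"
  using not_dvd_1 homogeneous_one by (auto simp: fraction_def)

lemma L_mult:
  assumes "fraction A B" "fraction C D" shows "fr A B \<otimes>\<^bsub>L\<^esub> fr C D = fr (A * C) (B * D)"
proof -
  have c: "ff_class n Y (A' * C', B' * D') = fr (A * C) (B * D)"
    if "(A', B') \<in> fr A B" "(C', D') \<in> fr C D" for A' B' C' D'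
  proof -
    have *: "fraction A' B'" "fr A' B' = fr A B" "fraction C' D'" "fr C' D' = fr C D"
      using that mem_fr assms by auto
    have "A' * C' * (B * D) - A * C * (B' * D') = C' * D * (A' * B - A * B') + A * B' * (C' * D - C * D')"
      by (simp add: algebra_simps)
    moreover have "F dvd \<dots>" using * assms fr_eq_iff by (intro dvd_add dvd_mult) auto
    ultimately show ?thesis using fr_eq_iff[OF fraction_mult[OF *(1,3)] fraction_mult[OF assms]] by (simp add: fr_def)
  qed
  have "fr A B \<otimes>\<^bsub>L\<^esub> fr C D = (\<Union>(A', B')\<in>fr A B. \<Union>(C', D')\<in>fr C D. ff_class n Y (A' * C', B' * D'))"
    by (simp add: function_field_def)
  also have "\<dots> = fr (A * C) (B * D)"
    using mem_fr[OF assms(1)] mem_fr[OF assms(2)] assms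
    by (intro Union_image_const) (auto intro!: Union_image_const c split: prod.splits)
  finally show ?thesis .
qed

lemma L_add:
  assumes "fraction A B" "fraction C D" shows "fr A B \<oplus>\<^bsub>L\<^esub> fr C D = fr (A * D + C * B) (B * D)"
proof -
  have c: "ff_class n Y (A' * D' + C' * B', B' * D') = fr (A * D + C * B) (B * D)"
    if "(A', B') \<in> fr A B" "(C', D') \<in> fr C D" for A' B' C' D'
  proof -
    have *: "fraction A' B'" "fr A' B' = fr A B" "fraction C' D'" "fr C' D' = fr C D"
      using that mem_fr assms by auto
    have "(A' * D' + C' * B') * (B * D) - (A * D + C * B) * (B' * D')
      = D * D' * (A' * B - A * B') + B * B' * (C' * D - C * D')"
      by (simp add: algebra_simps)
    moreover have "F dvd \<dots>" using * assms fr_eq_iff by (intro dvd_add dvd_mult) auto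
    ultimately show ?thesis using fr_eq_iff[OF fraction_add[OF *(1,3)] fraction_add[OF assms]] by (simp add: fr_def)
  qed
  have "fr A B \<oplus>\<^bsub>L\<^esub> fr C D = (\<Union>(A', B')\<in>fr A B. \<Union>(C', D')\<in>fr C D. ff_class n Y (A' * D' + C' * B', B' * D'))"
    by (simp add: function_field_def)
  also have "\<dots> = fr (A * D + C * B) (B * D)"
    using mem_fr[OF assms(1)] mem_fr[OF assms(2)] assms
    by (intro Union_image_const) (auto intro!: Union_image_const c split: prod.splits)
  finally show ?thesis .
qed

lemma L_one: "\<one>\<^bsub>L\<^esub> = fr 1 1" and L_zero: "\<zero>\<^bsub>L\<^esub> = fr 0 1"
  by (simp_all add: function_field_def fr_def)

lemma fr_eq_zero_iff: "fraction A B \<Longrightarrow> fr A B = \<zero>\<^bsub>L\<^esub> \<longleftrightarrow> F dvd A"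
  using fr_eq_iff[OF _ fraction_0_1] by (simp add: L_zero)

lemma fraction_swap: "fraction A B \<Longrightarrow> \<not> F dvd A \<Longrightarrow> fraction B A"
  by (auto simp: fraction_def)

lemma field_L: "Ring.field L"
proof -
  have "abelian_group L"
  proof (rule abelian_groupI)
    fix x y assume "x \<in> carrier L" "y \<in> carrier L"
    then obtain A B C D where *: "fraction A B" "fraction C D" "x = fr A B" "y = fr C D" by (auto simp: carrier_L)
    show "x \<oplus>\<^bsub>L\<^esub> y \<in> carrier L" using * by (auto simp: L_add intro: fr_closed fraction_add)
    show "x \<oplus>\<^bsub>L\<^esub> y = y \<oplus>\<^bsub>L\<^esub> x" using * by (simp add: L_add mult.commute add.commute)
  next
    show "\<zero>\<^bsub>L\<^esub> \<in> carrier L" by (simp add: L_zero fr_closed fraction_0_1)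
  next
    fix x y z assume "x \<in> carrier L" "y \<in> carrier L" "z \<in> carrier L"
    then obtain A B C D E G where *: "fraction A B" "fraction C D" "fraction E G" "x = fr A B" "y = fr C D" "z = fr E G"
      by (auto simp: carrier_L)
    show "x \<oplus>\<^bsub>L\<^esub> y \<oplus>\<^bsub>L\<^esub> z = x \<oplus>\<^bsub>L\<^esub> (y \<oplus>\<^bsub>L\<^esub> z)"
      using * by (simp add: L_add fraction_add) (simp add: algebra_simps)
  next
    fix x assume "x \<in> carrier L"
    then obtain A B where *: "fraction A B" "x = fr A B" by (auto simp: carrier_L)
    show "\<zero>\<^bsub>L\<^esub> \<oplus>\<^bsub>L\<^esub> x = x" using * by (simp add: L_zero L_add fraction_0_1)
    have "fr (- A) B \<oplus>\<^bsub>L\<^esub> x = \<zero>\<^bsub>L\<^esub>"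
      using * fraction_add[OF fraction_uminus[OF *(1)] *(1)]
      by (simp add: L_add fraction_uminus fr_eq_zero_iff)
    thus "\<exists>y\<in>carrier L. y \<oplus>\<^bsub>L\<^esub> x = \<zero>\<^bsub>L\<^esub>" using * fr_closed fraction_uminus by blast
  qed
  moreover have "comm_monoid L"
  proof (rule comm_monoidI)
    fix x y assume "x \<in> carrier L" "y \<in> carrier L"
    then obtain A B C D where *: "fraction A B" "fraction C D" "x = fr A B" "y = fr C D" by (auto simp: carrier_L)
    show "x \<otimes>\<^bsub>L\<^esub> y \<in> carrier L" using * by (auto simp: L_mult intro: fr_closed fraction_mult)
    show "x \<otimes>\<^bsub>L\<^esub> y = y \<otimes>\<^bsub>L\<^esub> x" using * by (simp add: L_mult mult.commute)
  next
    show "\<one>\<^bsub>L\<^esub> \<in> carrier L" by (simp add: L_one fr_closed fraction_1_1)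
  next
    fix x y z assume "x \<in> carrier L" "y \<in> carrier L" "z \<in> carrier L"
    then obtain A B C D E G where *: "fraction A B" "fraction C D" "fraction E G" "x = fr A B" "y = fr C D" "z = fr E G"
      by (auto simp: carrier_L)
    show "x \<otimes>\<^bsub>L\<^esub> y \<otimes>\<^bsub>L\<^esub> z = x \<otimes>\<^bsub>L\<^esub> (y \<otimes>\<^bsub>L\<^esub> z)"
      using * by (simp add: L_mult fraction_mult mult.assoc)
  next
    fix x assume "x \<in> carrier L"
    then obtain A B where *: "fraction A B" "x = fr A B" by (auto simp: carrier_L)
    show "\<one>\<^bsub>L\<^esub> \<otimes>\<^bsub>L\<^esub> x = x" using * by (simp add: L_one L_mult fraction_1_1)
  qed
  ultimately have "cring L"
  proof (rule cringI)
    fix x y z assume "x \<in> carrier L" "y \<in> carrier L" "z \<in> carrier L"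
    then obtain A B C D E G where *: "fraction A B" "fraction C D" "fraction E G" "x = fr A B" "y = fr C D" "z = fr E G"
      by (auto simp: carrier_L)
    have f: "fraction ((A * D + C * B) * E) ((B * D) * G)"
      "fraction ((A * E) * (D * G) + (C * E) * (B * G)) ((B * G) * (D * G))"
      using fraction_mult[OF fraction_add[OF *(1,2)] *(3)]
        fraction_add[OF fraction_mult[OF *(1,3)] fraction_mult[OF *(2,3)]] by auto
    have "fr ((A * D + C * B) * E) ((B * D) * G) = fr ((A * E) * (D * G) + (C * E) * (B * G)) ((B * G) * (D * G))"
      unfolding fr_eq_iff[OF f] by (simp add: algebra_simps)
    thus "(x \<oplus>\<^bsub>L\<^esub> y) \<otimes>\<^bsub>L\<^esub> z = x \<otimes>\<^bsub>L\<^esub> z \<oplus>\<^bsub>L\<^esub> y \<otimes>\<^bsub>L\<^esub> z"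
      using * by (simp add: L_mult L_add fraction_mult fraction_add)
  qed
  thus ?thesis
  proof (rule cring.cring_fieldI2)
    show "\<zero>\<^bsub>L\<^esub> \<noteq> \<one>\<^bsub>L\<^esub>" using fr_eq_zero_iff[OF fraction_1_1] not_dvd_1 by (auto simp: L_one)
    fix a assume "a \<in> carrier L" "a \<noteq> \<zero>\<^bsub>L\<^esub>"
    then obtain A B where ab: "fraction A B" "a = fr A B" unfolding carrier_L by blast
    with \<open>a \<noteq> \<zero>\<^bsub>L\<^esub>\<close> have *: "fraction A B" "a = fr A B" "\<not> F dvd A" using fr_eq_zero_iff by auto
    have ba: "fraction B A" using fraction_swap * by blast
    have "fr (A * B) (B * A) = fr 1 1"
      unfolding fr_eq_iff[OF fraction_mult[OF *(1) ba] fraction_1_1] by (simp add: mult.commute)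
    hence "a \<otimes>\<^bsub>L\<^esub> fr B A = \<one>\<^bsub>L\<^esub>" using * ba by (simp add: L_mult L_one)
    thus "\<exists>b\<in>carrier L. a \<otimes>\<^bsub>L\<^esub> b = \<one>\<^bsub>L\<^esub>" using fr_closed[OF ba] by blast
  qed
qed

sublocale L: Ring.field L by (rule field_L)

lemma fr_cancel:
  assumes "fraction A B" "fraction E E" shows "fr (A * E) (B * E) = fr A B"
  by (subst fr_eq_iff) (use assms in \<open>auto intro: fraction_mult simp: mult_ac\<close>)

lemma fraction_add_same:
  assumes "fraction A B" "fraction C B" "homogeneous n g B" shows "fraction (A + C) B"
proof -
  have B0: "B \<noteq> 0" using assms(1) by (auto simp: fraction_def)
  have hom: "homogeneous n g D" if D: "fraction D B" for D
  proof -
    obtain g' where "homogeneous n g' D" "homogeneous n g' B" using D by (auto simp: fraction_def)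
    moreover from this have "g' = g" using homogeneous_degree_unique[OF _ assms(3) B0] by blast
    ultimately show ?thesis by simp
  qed
  have "homogeneous n g (A + C)" by (intro homogeneous_add hom assms)
  thus ?thesis using assms by (auto simp: fraction_def)
qed

lemma L_add_same:
  assumes "fraction A B" "fraction C B" shows "fr A B \<oplus>\<^bsub>L\<^esub> fr C B = fr (A + C) B" "fraction (A + C) B"
proof -
  obtain g where g: "homogeneous n g B" using assms by (auto simp: fraction_def)
  show f: "fraction (A + C) B" by (rule fraction_add_same[OF assms g])
  have "fraction B B" using assms by (auto simp: fraction_def)
  hence "fr ((A + C) * B) (B * B) = fr (A + C) B" by (rule fr_cancel[OF f])
  thus "fr A B \<oplus>\<^bsub>L\<^esub> fr C B = fr (A + C) B" using L_add[OF assms] by (simp add: algebra_simps)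
qed

lemma L_minus:
  assumes "fraction A B" shows "\<ominus>\<^bsub>L\<^esub> fr A B = fr (- A) B"
proof (rule L.minus_equality)
  show "fr (- A) B \<oplus>\<^bsub>L\<^esub> fr A B = \<zero>\<^bsub>L\<^esub>"
    using L_add_same[OF fraction_uminus[OF assms] assms] by (simp add: fr_eq_zero_iff)
qed (use assms fraction_uminus fr_closed in auto)

lemma fraction_power: "fraction A B \<Longrightarrow> fraction (A ^ k) (B ^ k)"
  by (induction k) (auto intro: fraction_1_1 fraction_mult)

lemma L_power: "fraction A B \<Longrightarrow> fr A B [^]\<^bsub>L\<^esub> (k::nat) = fr (A ^ k) (B ^ k)"
  by (induction k) (simp_all add: L_one L_mult fraction_power mult.commute)

lemma fraction_of_nat: "fraction A B \<Longrightarrow> fraction (of_nat k * A) B"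
  using homogeneous_mult[OF homogeneous_mconst, of n _ A "of_nat k"]
  unfolding fraction_def hom_of_nat[OF is_hom_mconst] add_0 by blast

lemma L_add_pow: "fraction A B \<Longrightarrow> add_pow L (k::nat) (fr A B) = fr (of_nat k * A) B"
proof (induction k)
  case 0
  have "fr 0 B = \<zero>\<^bsub>L\<^esub>" using fr_eq_zero_iff[of 0 B] 0 by (auto simp: fraction_def)
  thus ?case by simp
next
  case (Suc k)
  thus ?case using L_add_same(1)[OF fraction_of_nat[OF Suc.prems, of k] Suc.prems]
    by (simp add: algebra_simps)
qed

lemma L_inv:
  assumes "fraction A B" "\<not> F dvd A" shows "inv\<^bsub>L\<^esub> fr A B = fr B A"
proof (rule L.comm_inv_char)
  have ba: "fraction B A" using assms fraction_swap by blast
  have "fr (A * B) (B * A) = fr 1 1"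
    unfolding fr_eq_iff[OF fraction_mult[OF assms(1) ba] fraction_1_1] by (simp add: mult.commute)
  thus "fr A B \<otimes>\<^bsub>L\<^esub> fr B A = \<one>\<^bsub>L\<^esub>" using assms ba by (simp add: L_mult L_one)
qed (use assms fraction_swap fr_closed in auto)

section \<open>The function field of the image of a rational map\<close>

context
  fixes V :: "nat \<Rightarrow> 'a mpol" and e a :: nat
  assumes V: "\<And>i. i \<le> n \<Longrightarrow> homogeneous n e (V i)" and a: "a \<le> n" "\<not> F dvd V a"
begin

abbreviation KV :: "('a mpol \<times> 'a mpol) set set" where "KV \<equiv> pullback_field n Y V"

text \<open>
  A denominator \<open>B\<close> is allowed on the closure of the image iff \<open>B(V)\<close> does not vanish on the hypersurface,
  so the closure drops out.
\<close>

lemma KV_eq: "KV = {fr (msubst A V) (msubst B V) | A B.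
    (\<exists>g. homogeneous n g A \<and> homogeneous n g B) \<and> \<not> F dvd msubst B V}"
proof -
  have "(A, B) \<in> ff_pairs n (zariski_closure n (map_image n Y V)) \<longleftrightarrow>
     (\<exists>g. homogeneous n g A \<and> homogeneous n g B) \<and> \<not> F dvd msubst B V" for A B
  proof -
    have "vanishes_on n (zariski_closure n (map_image n Y V)) B \<longleftrightarrow> F dvd msubst B V"
      if B: "homogeneous n g B" for g
      using vanishes_on_zariski_closure_iff[OF B] vanishes_on_image_iff[where V = V, OF V a B] by simp
    thus ?thesis unfolding ff_pairs_def by blast
  qed
  thus ?thesis by (simp add: pullback_field_def fr_def)
qed

lemma KV_I:
  assumes "homogeneous n g A" "homogeneous n g B" "\<not> F dvd msubst B V"
  shows "fr (msubst A V) (msubst B V) \<in> KV"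
  using assms KV_eq by blast

lemma KV_E:
  assumes "x \<in> KV"
  obtains g A B where "homogeneous n g A" "homogeneous n g B" "\<not> F dvd msubst B V"
    "x = fr (msubst A V) (msubst B V)"
  using assms KV_eq by blast

lemma fraction_msubst:
  assumes "homogeneous n g A" "homogeneous n g B" "\<not> F dvd msubst B V"
  shows "fraction (msubst A V) (msubst B V)"
proof -
  have "homogeneous n (e * g) (msubst C V)" if C: "homogeneous n g C" for C
    by (rule homogeneous_msubst[OF C]) (rule V)
  thus ?thesis using assms unfolding fraction_def by blast
qed

lemma subfield_KV: "subfield KV L"
proof (rule L.subfieldI')
  show "subring KV L"
  proof (rule L.subringI)
    show "KV \<subseteq> carrier L" using fraction_msubst fr_closed by (auto elim!: KV_E)
    show "\<one>\<^bsub>L\<^esub> \<in> KV"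
      using KV_I[OF homogeneous_one homogeneous_one] not_dvd_1 by (simp add: L_one msubst_hom)
  next
    fix x assume "x \<in> KV"
    then obtain g A B where *: "homogeneous n g A" "homogeneous n g B" "\<not> F dvd msubst B V"
      "x = fr (msubst A V) (msubst B V)" by (rule KV_E)
    have "\<ominus>\<^bsub>L\<^esub> x = fr (msubst (- A) V) (msubst B V)"
      using L_minus[OF fraction_msubst[OF *(1-3)]] *(4) by (simp add: msubst_hom)
    thus "\<ominus>\<^bsub>L\<^esub> x \<in> KV" using KV_I[OF homogeneous_uminus[OF *(1)] *(2,3)] by simp
  next
    fix x y assume "x \<in> KV" "y \<in> KV"
    then obtain g A B g' C D where *: "homogeneous n g A" "homogeneous n g B" "\<not> F dvd msubst B V"
      "x = fr (msubst A V) (msubst B V)" "homogeneous n g' C" "homogeneous n g' D" "\<not> F dvd msubst D V"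
      "y = fr (msubst C V) (msubst D V)" by (elim KV_E) blast
    note f = fraction_msubst[OF *(1-3)] fraction_msubst[OF *(5-7)]
    have nd: "\<not> F dvd msubst (B * D) V" using * F_prime_dvd by (auto simp: msubst_hom)
    have "x \<otimes>\<^bsub>L\<^esub> y = fr (msubst (A * C) V) (msubst (B * D) V)"
      using f * by (simp add: L_mult msubst_hom)
    thus "x \<otimes>\<^bsub>L\<^esub> y \<in> KV"
      using KV_I[OF homogeneous_mult[OF *(1,5)] homogeneous_mult[OF *(2,6)] nd] by simp
    have "x \<oplus>\<^bsub>L\<^esub> y = fr (msubst (A * D + C * B) V) (msubst (B * D) V)"
      using f * by (simp add: L_add msubst_hom)
    moreover have "homogeneous n (g + g') (A * D + C * B)"
      using homogeneous_mult[OF *(1,6)] homogeneous_mult[OF *(5,2)]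
      by (intro homogeneous_add) (simp_all add: add.commute)
    ultimately show "x \<oplus>\<^bsub>L\<^esub> y \<in> KV"
      using KV_I[OF _ homogeneous_mult[OF *(2,6)] nd] by simp
  qed
next
  fix x assume x: "x \<in> KV - {\<zero>\<^bsub>L\<^esub>}"
  hence "x \<in> KV" by blast
  then obtain g A B where *: "homogeneous n g A" "homogeneous n g B" "\<not> F dvd msubst B V"
    "x = fr (msubst A V) (msubst B V)" by (rule KV_E)
  note f = fraction_msubst[OF *(1-3)]
  have nd: "\<not> F dvd msubst A V" using x fr_eq_zero_iff[OF f] * by auto
  show "inv\<^bsub>L\<^esub> x \<in> KV" using L_inv[OF f nd] KV_I[OF *(2,1) nd] *(4) by simp
qed

lemma KV_common_denominator:
  assumes "set l \<subseteq> KV"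
  shows "\<exists>g B C. homogeneous n g B \<and> \<not> F dvd msubst B V \<and>
    (\<forall>k<length l. homogeneous n g (C k) \<and> l ! k = fr (msubst (C k) V) (msubst B V))"
  using assms
proof (induction l)
  case Nil
  show ?case by (intro exI[of _ 0] exI[of _ 1]) (use homogeneous_one not_dvd_1 in \<open>auto simp: msubst_hom\<close>)
next
  case (Cons x l)
  hence "set l \<subseteq> KV" "x \<in> KV" by auto
  from Cons.IH[OF this(1)] obtain g B C where IH0: "homogeneous n g B" "\<not> F dvd msubst B V"
    "\<forall>k<length l. homogeneous n g (C k) \<and> l ! k = fr (msubst (C k) V) (msubst B V)" by blast
  hence IH: "homogeneous n g B" "\<not> F dvd msubst B V"
    "\<And>k. k < length l \<Longrightarrow> homogeneous n g (C k)" "\<And>k. k < length l \<Longrightarrow> l ! k = fr (msubst (C k) V) (msubst B V)" by auto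
  obtain g' A D where x: "homogeneous n g' A" "homogeneous n g' D" "\<not> F dvd msubst D V" "x = fr (msubst A V) (msubst D V)"
    using \<open>x \<in> KV\<close> by (rule KV_E)
  have BB: "fraction (msubst B V) (msubst B V)" and DD: "fraction (msubst D V) (msubst D V)"
    using fraction_msubst IH x by blast+
  define C' where "C' = (\<lambda>k. case k of 0 \<Rightarrow> A * B | Suc k \<Rightarrow> C k * D)"
  have nd: "\<not> F dvd msubst (D * B) V" using IH(2) x(3) F_prime_dvd unfolding msubst_hom by blast
  have "homogeneous n (g' + g) (C' k) \<and> (x # l) ! k = fr (msubst (C' k) V) (msubst (D * B) V)"
    if k: "k < length (x # l)" for k
  proof (cases k)
    case 0
    thus ?thesis using fr_cancel[OF fraction_msubst[OF x(1-3)] BB] homogeneous_mult[OF x(1) IH(1)] x(4)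
      by (simp add: C'_def msubst_hom)
  next
    case (Suc j)
    hence j: "j < length l" using k by simp
    show ?thesis using fr_cancel[OF fraction_msubst[OF IH(3)[OF j] IH(1,2)] DD] homogeneous_mult[OF IH(3)[OF j] x(2)] IH(4)[OF j]
      by (simp add: C'_def msubst_hom Suc mult.commute add.commute)
  qed
  thus ?case using nd homogeneous_mult[OF x(2) IH(1)] by blast
qed

end

text \<open>
  Powers of \<open>z\<close> are added to each summand such that all of them have the denominator \<open>b z\<^sup>N\<close>.
\<close>

lemma eval_common_denominator:
  assumes "\<And>k. k < length l \<Longrightarrow> rev l ! k = fr (c k) b" "\<And>k. k < length l \<Longrightarrow> fraction (c k) b"
    and b: "fraction b b" and xz: "fraction x z" and N: "length l \<le> Suc N"
  shows "L.eval l (fr x z) = fr (\<Sum>k<length l. c k * x ^ k * z ^ (N - k)) (b * z ^ N)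
     \<and> fraction (\<Sum>k<length l. c k * x ^ k * z ^ (N - k)) (b * z ^ N)"
  using assms(1,2,5)
proof (induction l)
  case Nil
  have zz: "fraction z z" using xz by (auto simp: fraction_def)
  have "fraction (b * z ^ N) (b * z ^ N)" using b zz by (intro fraction_mult fraction_power)
  hence f: "fraction 0 (b * z ^ N)" by (auto simp: fraction_def)
  show ?case using f fr_eq_zero_iff[OF f] by simp
next
  case (Cons y l)
  let ?m = "length l"
  let ?S = "\<Sum>k<?m. c k * x ^ k * z ^ (N - k)"
  have zz: "fraction z z" using xz by (auto simp: fraction_def)
  have y: "y = fr (c ?m) b" using Cons.prems(1)[of ?m] by (simp add: nth_append)
  have fc: "fraction (c ?m) b" using Cons.prems(2)[of ?m] by simp
  have "rev l ! k = fr (c k) b" "fraction (c k) b" if "k < ?m" for k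
    using Cons.prems(1,2)[of k] that by (simp_all add: nth_append)
  hence IH: "L.eval l (fr x z) = fr ?S (b * z ^ N)" "fraction ?S (b * z ^ N)"
    using Cons.IH Cons.prems(3) by auto
  have "y \<otimes>\<^bsub>L\<^esub> fr x z [^]\<^bsub>L\<^esub> ?m = fr (c ?m * x ^ ?m) (b * z ^ ?m)"
    unfolding y L_power[OF xz] by (rule L_mult[OF fc fraction_power[OF xz]])
  also have "\<dots> = fr (c ?m * x ^ ?m * z ^ (N - ?m)) (b * z ^ ?m * z ^ (N - ?m))"
    by (rule fr_cancel[symmetric]) (intro fraction_mult fc fraction_power xz zz)+
  also have "b * z ^ ?m * z ^ (N - ?m) = b * z ^ N"
    using Cons.prems(3) by (simp add: mult.assoc flip: power_add)
  finally have 1: "y \<otimes>\<^bsub>L\<^esub> fr x z [^]\<^bsub>L\<^esub> ?m = fr (c ?m * x ^ ?m * z ^ (N - ?m)) (b * z ^ N)" .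
  have "fraction (c ?m * x ^ ?m * z ^ (N - ?m)) (b * z ^ ?m * z ^ (N - ?m))"
    by (intro fraction_mult fc fraction_power xz zz)
  hence f1: "fraction (c ?m * x ^ ?m * z ^ (N - ?m)) (b * z ^ N)"
    using Cons.prems(3) by (simp add: mult.assoc flip: power_add)
  show ?case using L_add_same[OF f1 IH(2)] 1 IH(1) by (simp add: add.commute)
qed

end

context irreducible_hypersurface
begin

section \<open>Separability as a relation between polynomials\<close>

text \<open>
  The relation is the minimal polynomial of \<open>X\<^sub>i / X\<^sub>j\<close> with its denominators cleared.  If its derivative
  vanished at \<open>X\<^sub>i / X\<^sub>j\<close> too, then the minimal polynomial would be a common divisor of itself and its
  derivative, and hence a unit.
\<close>

lemma separable_relation:
  assumes V: "\<And>i. i \<le> n \<Longrightarrow> homogeneous n e (V i)" and a: "a \<le> n" "\<not> F dvd V a"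
    and sep: "separable_extension L (pullback_field n Y V)"
    and ij: "i \<le> n" "j \<le> n" and X: "\<not> F dvd mvar j"
  shows "\<exists>N g C. (\<forall>k\<le>N. homogeneous n g (C k))
        \<and> F dvd (\<Sum>k\<le>N. msubst (C k) V * (mvar i ^ k * mvar j ^ (N - k)))
        \<and> \<not> F dvd (\<Sum>k\<le>N. msubst (C k) V * (of_nat k * mvar i ^ (k - 1) * mvar j ^ (N - k)))"
proof -
  let ?K = "pullback_field n Y V"
  let ?KX = "univ_poly L ?K"
  define x where "x = fr (mvar i) (mvar j)"
  have fx: "fraction (mvar i) (mvar j)"
    unfolding fraction_def using homogeneous_mvar ij X by blast
  have x: "x \<in> carrier L" unfolding x_def by (rule fr_closed[OF fx])
  have K: "subfield ?K L" by (rule subfield_KV[where V = V and e = e and a = a, OF V a])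
  have K': "subring ?K L" by (rule subfieldE(1)[OF K])
  have KL: "?K \<subseteq> carrier L" by (rule subfieldE(3)[OF K])
  define m where "m = L.Irr ?K x"
  define m' where "m' = formal_deriv L m"
  have se: "L.algebraic ?K x" "isgcd ?KX \<one>\<^bsub>?KX\<^esub> m m'"
    using sep x by (auto simp: separable_extension_def separable_element_def m_def m'_def)
  have alg: "(L.algebraic over ?K) x" using se(1) by (simp add: over_def)
  have m: "m \<in> carrier ?KX" "L.eval m x = \<zero>\<^bsub>L\<^esub>"
    unfolding m_def using L.IrrE[OF K x alg] by auto
  have m_set: "set m \<subseteq> ?K" using m(1) by (auto simp: univ_poly_def polynomial_def)
  obtain g B C where C: "homogeneous n g B" "\<not> F dvd msubst B V"
    "\<forall>k<length (rev m). homogeneous n g (C k) \<and> rev m ! k = fr (msubst (C k) V) (msubst B V)"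
    using KV_common_denominator[where V = V and e = e and a = a and l = "rev m", OF V a] m_set by auto
  define b where "b = msubst B V"
  define c where "c = (\<lambda>k. msubst (C k) V)"
  have hC: "homogeneous n g (C k)" and mk: "rev m ! k = fr (c k) b" if "k < length m" for k
    using C(3) that by (auto simp: b_def c_def)
  have fc: "fraction (c k) b" if "k < length m" for k
    unfolding b_def c_def by (rule fraction_msubst[where V = V and e = e and a = a, OF V a hC[OF that] C(1,2)])
  have fb: "fraction b b" unfolding b_def by (rule fraction_msubst[where V = V and e = e and a = a, OF V a C(1,1,2)])
  define l' where "l' = map (\<lambda>i. add_pow L i (L.coeff m i)) (rev [1..<length m])"
  have coeff: "L.coeff m k = fr (c k) b" if "k < length m" for k
    using that mk by (simp add: L.coeff_nth rev_nth)
  have l'_nth: "rev l' ! k = fr (of_nat (Suc k) * c (Suc k)) b" if "k < length l'" for k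
  proof -
    have k: "Suc k < length m" using that by (simp add: l'_def)
    have "[1..<length m] ! k = Suc k" using nth_upt[of 1 k "length m"] k by simp
    hence "rev l' ! k = add_pow L (Suc k) (L.coeff m (Suc k))"
      using k by (simp add: l'_def rev_map del: L.add.nat_pow_Suc)
    also have "\<dots> = fr (of_nat (Suc k) * c (Suc k)) b" unfolding coeff[OF k] by (rule L_add_pow[OF fc[OF k]])
    finally show ?thesis .
  qed
  have l'_set: "set l' \<subseteq> ?K"
  proof
    fix y assume "y \<in> set l'"
    then obtain k where k: "k < length m" "y = add_pow L k (L.coeff m k)" by (auto simp: l'_def)
    have "homogeneous n (0 + g) (mconst (of_nat k) * C k)"
      by (rule homogeneous_mult[OF homogeneous_mconst hC[OF k(1)]])
    moreover have "y = fr (msubst (mconst (of_nat k) * C k) V) (msubst B V)"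
      unfolding k(2) coeff[OF k(1)] L_add_pow[OF fc[OF k(1)]]
      by (simp add: msubst_hom hom_of_nat[OF is_hom_mconst] msubst_hom b_def c_def)
    ultimately show "y \<in> ?K" using KV_I[where V = V and e = e and a = a, OF V a _ C(1,2)] by simp
  qed
  have l'_eq: "m' = L.normalize l'" by (simp add: m'_def formal_deriv_def l'_def)
  have m': "m' \<in> carrier ?KX"
    unfolding l'_eq univ_poly_carrier[symmetric] by (rule L.normalize_gives_polynomial[OF l'_set])
  have eval_m': "L.eval m' x = L.eval l' x"
    unfolding l'_eq by (rule L.eval_normalize) (use l'_set KL x in auto)
  have nz: "L.eval m' x \<noteq> \<zero>\<^bsub>L\<^esub>"
  proof
    assume "L.eval m' x = \<zero>\<^bsub>L\<^esub>"
    hence "m pdivides\<^bsub>L\<^esub> m'" unfolding m_def by (rule L.Irr_minimal[OF K x alg m'])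
    hence "m divides\<^bsub>?KX\<^esub> m'" using L.pdivides_iff_shell[OF K m(1) m'] by simp
    moreover have "m divides\<^bsub>?KX\<^esub> m"
    proof -
      interpret UP: domain ?KX by (rule L.univ_poly_is_domain[OF K'])
      show ?thesis using m(1) by (rule UP.divides_refl)
    qed
    ultimately have "m divides\<^bsub>?KX\<^esub> \<one>\<^bsub>?KX\<^esub>" using se(2) m(1) by (simp add: isgcd_def)
    then obtain s where s: "s \<in> carrier ?KX" "\<one>\<^bsub>?KX\<^esub> = m \<otimes>\<^bsub>?KX\<^esub> s" by (auto simp: factor_def)
    have hom: "(\<lambda>p. L.eval p x) \<in> ring_hom ?KX L" by (rule L.eval_is_hom[OF K' x])
    have "\<one>\<^bsub>L\<^esub> = L.eval m x \<otimes>\<^bsub>L\<^esub> L.eval s x"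
      using ring_hom_one[OF hom] ring_hom_mult[OF hom m(1) s(1)] s(2) by simp
    hence "\<one>\<^bsub>L\<^esub> = \<zero>\<^bsub>L\<^esub>" using m(2) ring_hom_closed[OF hom s(1)] by simp
    thus False by simp
  qed
  have "m \<noteq> []"
  proof
    assume "m = []"
    hence "m' = []" by (simp add: m'_def formal_deriv_def)
    thus False using nz by simp
  qed
  define N where "N = length m - 1"
  have N: "length m = Suc N" "length l' = N" using \<open>m \<noteq> []\<close> by (auto simp: N_def l'_def)
  have E1: "L.eval m x = fr (\<Sum>k<length m. c k * mvar i ^ k * mvar j ^ (N - k)) (b * mvar j ^ N)
     \<and> fraction (\<Sum>k<length m. c k * mvar i ^ k * mvar j ^ (N - k)) (b * mvar j ^ N)"
    unfolding x_def by (rule eval_common_denominator) (use mk fc fb fx N in auto)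
  have "F dvd (\<Sum>k<length m. c k * mvar i ^ k * mvar j ^ (N - k))"
    by (rule iffD1[OF fr_eq_zero_iff[OF conjunct2[OF E1]] trans[OF conjunct1[OF E1, symmetric] m(2)]])
  hence 1: "F dvd (\<Sum>k\<le>N. c k * (mvar i ^ k * mvar j ^ (N - k)))"
    by (simp add: N(1) lessThan_Suc_atMost mult.assoc)
  have E2: "L.eval l' x = fr (\<Sum>k<length l'. (of_nat (Suc k) * c (Suc k)) * mvar i ^ k * mvar j ^ (N - 1 - k)) (b * mvar j ^ (N - 1))
     \<and> fraction (\<Sum>k<length l'. (of_nat (Suc k) * c (Suc k)) * mvar i ^ k * mvar j ^ (N - 1 - k)) (b * mvar j ^ (N - 1))"
    unfolding x_def
  proof (rule eval_common_denominator[OF l'_nth _ fb fx])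
    show "fraction (of_nat (Suc k) * c (Suc k)) b" if "k < length l'" for k
      by (rule fraction_of_nat[OF fc]) (use that N in simp)
  qed (use N in auto)
  have "\<not> F dvd (\<Sum>k<N. (of_nat (Suc k) * c (Suc k)) * mvar i ^ k * mvar j ^ (N - 1 - k))"
    using nz[unfolded eval_m' conjunct1[OF E2] fr_eq_zero_iff[OF conjunct2[OF E2]]] unfolding N(2) .
  also have "(\<Sum>k<N. (of_nat (Suc k) * c (Suc k)) * mvar i ^ k * mvar j ^ (N - 1 - k))
    = (\<Sum>k\<le>N. c k * (of_nat k * mvar i ^ (k - 1) * mvar j ^ (N - k)))"
    by (simp add: sum.atMost_shift mult_ac)
  finally show ?thesis using hC 1 unfolding c_def N(1) by (intro exI[of _ N] exI[of _ g] exI[of _ C]) auto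
qed

section \<open>Finite generation of the function field\<close>

text \<open>
  Dividing numerator and denominator by a power of \<open>X\<^sub>0\<close> turns both into polynomials in the
  \<open>X\<^sub>i / X\<^sub>0\<close>.
\<close>

lemma function_field_generated:
  assumes E: "subfield E L" and X0: "\<not> F dvd mvar 0"
    and const: "\<And>c. fr (mconst c) 1 \<in> E" and vars: "\<And>i. i \<le> n \<Longrightarrow> fr (mvar i) (mvar 0) \<in> E"
  shows "carrier L \<subseteq> E"
proof
  note E' = subfieldE(1)[OF E]
  have fc: "fraction (mconst c) 1" for c
    unfolding fraction_def using homogeneous_mconst homogeneous_one not_dvd_1 by blast
  have fv: "fraction (mvar i) (mvar 0)" if "i \<le> n" for i
    unfolding fraction_def using homogeneous_mvar that X0 by blast
  have f0: "fraction 0 (mvar 0 ^ g)" for g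
    using fraction_power[OF fv[of 0], of g] by (auto simp: fraction_def)
  have monomial: "fr (\<Prod>i\<in>I. mvar i ^ s i) (mvar 0 ^ (\<Sum>i\<in>I. s i)) \<in> E
      \<and> fraction (\<Prod>i\<in>I. mvar i ^ s i) (mvar 0 ^ (\<Sum>i\<in>I. s i))"
    if "finite I" "I \<subseteq> {..n}" for I s
    using that
  proof (induction I rule: finite_induct)
    case empty
    show ?case using const[of 1] fraction_1_1 by simp
  next
    case (insert i I)
    hence IH: "fr (\<Prod>i\<in>I. mvar i ^ s i) (mvar 0 ^ (\<Sum>i\<in>I. s i)) \<in> E"
      "fraction (\<Prod>i\<in>I. mvar i ^ s i) (mvar 0 ^ (\<Sum>i\<in>I. s i))" and i: "i \<le> n" by auto
    have pw: "fr (mvar i) (mvar 0) [^]\<^bsub>L\<^esub> k \<in> E" for k :: nat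
      by (induction k) (use subringE(3,6)[OF E'] vars[OF i] in auto)
    have "fr (mvar i) (mvar 0) [^]\<^bsub>L\<^esub> s i \<otimes>\<^bsub>L\<^esub> fr (\<Prod>i\<in>I. mvar i ^ s i) (mvar 0 ^ (\<Sum>i\<in>I. s i)) \<in> E"
      by (rule subringE(6)[OF E' pw IH(1)])
    moreover have "fr (mvar i) (mvar 0) [^]\<^bsub>L\<^esub> s i \<otimes>\<^bsub>L\<^esub> fr (\<Prod>i\<in>I. mvar i ^ s i) (mvar 0 ^ (\<Sum>i\<in>I. s i))
       = fr (mvar i ^ s i * (\<Prod>i\<in>I. mvar i ^ s i)) (mvar 0 ^ s i * mvar 0 ^ (\<Sum>i\<in>I. s i))"
      unfolding L_power[OF fv[OF i]] by (rule L_mult[OF fraction_power[OF fv[OF i]] IH(2)])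
    moreover have "fraction (mvar i ^ s i * (\<Prod>i\<in>I. mvar i ^ s i)) (mvar 0 ^ s i * mvar 0 ^ (\<Sum>i\<in>I. s i))"
      by (rule fraction_mult[OF fraction_power[OF fv[OF i]] IH(2)])
    ultimately show ?case using insert.hyps by (simp add: power_add)
  qed
  have form: "fr A (mvar 0 ^ g) \<in> E \<and> fraction A (mvar 0 ^ g)" if A: "homogeneous n g A" for g A
  proof -
    let ?s = "\<lambda>m. single m (lookup A m)"
    have single: "fr (?s m) (mvar 0 ^ g) \<in> E \<and> fraction (?s m) (mvar 0 ^ g)" if m: "m \<in> keys A" for m
    proof -
      let ?p = "\<Prod>i\<in>keys m. mvar i ^ lookup m i :: 'a mpol"
      have "keys m \<subseteq> {..n}" using A m by (auto simp: homogeneous_def)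
      hence p: "fr ?p (mvar 0 ^ g) \<in> E" "fraction ?p (mvar 0 ^ g)"
        using monomial[of "keys m" "lookup m"] homogeneous_keys_degree[OF A m] by auto
      have "fr (mconst (lookup A m)) 1 \<otimes>\<^bsub>L\<^esub> fr ?p (mvar 0 ^ g) \<in> E"
        by (rule subringE(6)[OF E' const p(1)])
      thus ?thesis using L_mult[OF fc p(2)] fraction_mult[OF fc p(2)]
        by (simp add: mono_as_vars mono_eval_def)
    qed
    have "fr (\<Sum>m\<in>I. ?s m) (mvar 0 ^ g) \<in> E \<and> fraction (\<Sum>m\<in>I. ?s m) (mvar 0 ^ g)"
      if "finite I" "I \<subseteq> keys A" for I
      using that
    proof (induction I rule: finite_induct)
      case empty
      show ?case using f0[of g] fr_eq_zero_iff[OF f0[of g]] subringE(2)[OF E'] by simp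
    next
      case (insert m I)
      hence IH: "fr (\<Sum>m\<in>I. ?s m) (mvar 0 ^ g) \<in> E" "fraction (\<Sum>m\<in>I. ?s m) (mvar 0 ^ g)"
        and m: "fr (?s m) (mvar 0 ^ g) \<in> E" "fraction (?s m) (mvar 0 ^ g)" using single by auto
      show ?case using subringE(7)[OF E' m(1) IH(1)] L_add_same[OF m(2) IH(2)] insert.hyps by simp
    qed
    from this[of "keys A"] show ?thesis by (simp flip: mpol_expand)
  qed
  fix x assume "x \<in> carrier L"
  then obtain A B where AB: "fraction A B" "x = fr A B" unfolding carrier_L by blast
  then obtain g where g: "homogeneous n g A" "homogeneous n g B" by (auto simp: fraction_def)
  note fA = form[OF g(1)] and fB = form[OF g(2)]
  have nB: "\<not> F dvd B" using AB by (simp add: fraction_def)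
  have "fr B (mvar 0 ^ g) \<in> E - {\<zero>\<^bsub>L\<^esub>}" using fB nB fr_eq_zero_iff by auto
  hence "inv\<^bsub>L\<^esub> fr B (mvar 0 ^ g) \<in> E" using L.subfield_m_inv(1)[OF E] by blast
  hence "fr A (mvar 0 ^ g) \<otimes>\<^bsub>L\<^esub> fr (mvar 0 ^ g) B \<in> E"
    using L_inv[of B "mvar 0 ^ g"] fB nB subringE(6)[OF E'] fA by metis
  moreover have fBi: "fraction (mvar 0 ^ g) B" using fraction_swap fB nB by blast
  moreover have "fr A (mvar 0 ^ g) \<otimes>\<^bsub>L\<^esub> fr (mvar 0 ^ g) B = fr (A * mvar 0 ^ g) (mvar 0 ^ g * B)"
    using fA fBi by (simp add: L_mult)
  moreover have "\<dots> = fr A B"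
  proof -
    have "fraction (mvar 0 ^ g) (mvar 0 ^ g)" using fA by (auto simp: fraction_def)
    thus ?thesis using fr_cancel[OF AB(1)] by (metis mult.commute)
  qed
  ultimately show "x \<in> E" using AB(2) by simp
qed

end

context separable_power_gauss_map
begin

section \<open>The Gauss map is purely inseparable\<close>

text \<open>
  If \<open>A'\<close> and \<open>B'\<close> are the twists of \<open>A\<close> and \<open>B\<close>, then \<open>(A/B)\<^sup>q = A'(X\<^sub>0\<^sup>q, \<dots>) / B'(X\<^sub>0\<^sup>q, \<dots>)\<close>.  By proportionality this is
  \<open>A'(\<Psi>) / B'(\<Psi>)\<close>, and \<open>\<Psi>\<close> is a form in \<open>\<Gamma>\<close>.
\<close>

lemma power_q_in_pullback:
  assumes "x \<in> carrier L" shows "x [^]\<^bsub>L\<^esub> q \<in> pullback_field n Y \<Gamma>"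
proof -
  obtain a where a: "a \<le> n" "\<not> F dvd \<Gamma> a" using smooth by blast
  obtain G where G: "dual_equation G" using dual_equation_exists by blast
  obtain g where g: "homogeneous n g G" using G by (auto simp: dual_equation_def)
  obtain l where l: "l \<le> n" "\<not> F dvd \<Psi> G l" by (rule dual_equation_smooth[OF G])
  obtain A B where "fraction A B" and x: "x = fr A B" using assms unfolding carrier_L by blast
  then obtain s where AB: "homogeneous n s A" "homogeneous n s B" "\<not> F dvd B" "fraction A B"
    by (auto simp: fraction_def)
  let ?t = "map_coeffs (\<lambda>c::'a. c ^ q)"
  let ?h = "\<lambda>A. msubst (?t A) (\<lambda>i. partial i G)"
  have hom: "homogeneous n ((g - 1) * s) (?h A)" if "homogeneous n s A" for A
    by (rule homogeneous_msubst[OF homogeneous_map[OF that] homogeneous_partial[OF g]])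
  have h_\<Gamma>: "msubst (?h A) \<Gamma> = msubst (?t A) (\<Psi> G)" for A
    by (rule msubst_msubst)
  have nB: "\<not> F dvd msubst (?h B) \<Gamma>"
    unfolding h_\<Gamma> dvd_msubst_\<Psi>_iff[OF G homogeneous_map[OF AB(2)]] dvd_frobenius_twist by (rule AB(3))
  have f: "fraction (msubst (?h A) \<Gamma>) (msubst (?h B) \<Gamma>)"
    by (rule fraction_msubst[where V = \<Gamma> and e = "d - 1" and a = a, OF homogeneous_\<Gamma> a hom[OF AB(1)] hom[OF AB(2)] nB])
  have cmp: "F dvd (mvar l ^ q) ^ s * msubst (?h A) \<Gamma> - \<Psi> G l ^ s * A ^ q" if "homogeneous n s A" for A
    using compare_\<Psi>_frobenius[OF G homogeneous_map[OF that, of "\<lambda>c. c ^ q"] l(1)]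
    by (simp add: h_\<Gamma> msubst_frobenius_map)
  have eq: "(mvar l ^ q) ^ s * (A ^ q * msubst (?h B) \<Gamma> - msubst (?h A) \<Gamma> * B ^ q)
    = A ^ q * ((mvar l ^ q) ^ s * msubst (?h B) \<Gamma> - \<Psi> G l ^ s * B ^ q)
     - B ^ q * ((mvar l ^ q) ^ s * msubst (?h A) \<Gamma> - \<Psi> G l ^ s * A ^ q)"
    by (simp add: algebra_simps)
  have "F dvd (mvar l ^ q) ^ s * (A ^ q * msubst (?h B) \<Gamma> - msubst (?h A) \<Gamma> * B ^ q)"
    unfolding eq by (intro dvd_diff dvd_mult cmp AB)
  hence "F dvd A ^ q * msubst (?h B) \<Gamma> - msubst (?h A) \<Gamma> * B ^ q"
    using F_prime F_prime_power X[OF l(1)] by blast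
  hence "x [^]\<^bsub>L\<^esub> q = fr (msubst (?h A) \<Gamma>) (msubst (?h B) \<Gamma>)"
    unfolding x L_power[OF AB(4)] fr_eq_iff[OF fraction_power[OF AB(4)] f] .
  also have "\<dots> \<in> pullback_field n Y \<Gamma>"
    by (rule KV_I[where V = \<Gamma> and e = "d - 1" and a = a, OF homogeneous_\<Gamma> a hom[OF AB(1)] hom[OF AB(2)] nB])
  finally show ?thesis .
qed

text \<open>
  The function field is generated by the finitely many \<open>X\<^sub>i / X\<^sub>0\<close>, and each \<open>x\<close> in it is a root of
  \<open>T\<^sup>q - x\<^sup>q\<close> over the pullback field; so the extension is finite as well.
\<close>

theorem gauss_map_purely_inseparable: "purely_inseparable_map n Y (gauss_map F)"
proof -
  obtain a where a: "a \<le> n" "\<not> F dvd \<Gamma> a" using smooth by blast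
  let ?K = "pullback_field n Y \<Gamma>"
  have K: "subfield ?K L" by (rule subfield_KV[where V = \<Gamma> and e = "d - 1" and a = a, OF homogeneous_\<Gamma> a])
  note K' = subfieldE(1)[OF K]
  have alg: "(L.algebraic over ?K) x" if x: "x \<in> carrier L" for x
  proof -
    let ?c = "\<ominus>\<^bsub>L\<^esub> (x [^]\<^bsub>L\<^esub> q)"
    let ?l = "\<one>\<^bsub>L\<^esub> # (replicate (q - 1) \<zero>\<^bsub>L\<^esub> @ [?c])"
    have c: "?c \<in> ?K" using power_q_in_pullback[OF x] subringE(5)[OF K'] by blast
    hence cL: "?c \<in> carrier L" using subringE(1)[OF K'] by blast
    show ?thesis
    proof (rule L.algebraicI[of ?l])
      have "set ?l \<subseteq> ?K" using c subringE(2,3)[OF K'] by auto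
      thus "?l \<in> carrier (univ_poly L ?K)"
        unfolding univ_poly_carrier[symmetric] by (intro L.polynomialI) auto
      have "L.eval (replicate (q - 1) \<zero>\<^bsub>L\<^esub> @ [?c]) x = L.eval [?c] x"
        by (rule L.eval_replicate) (use cL x in auto)
      also have "\<dots> = ?c" using cL x by simp
      finally show "L.eval ?l x = \<zero>\<^bsub>L\<^esub>" using x q_pos by (simp add: L.r_neg)
    qed simp
  qed
  define xs where "xs = map (\<lambda>i. fr (mvar i) (mvar 0)) [0..<Suc n]"
  have X0: "\<not> F dvd mvar 0" by (rule X) simp
  have fv: "fraction (mvar i) (mvar 0)" if "i \<le> n" for i
    unfolding fraction_def using homogeneous_mvar that X0 by blast
  have xs: "set xs \<subseteq> carrier L" using fr_closed[OF fv] by (auto simp: xs_def less_Suc_eq_le)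
  have alg_xs: "(L.algebraic over ?K) x" if "x \<in> set xs" for x using alg xs that by blast
  let ?E = "L.finite_extension ?K xs"
  have E: "subfield ?E L" using L.finite_extension_is_subfield[OF K xs] alg_xs by blast
  have fin: "L.finite_dimension ?K ?E" using L.finite_extension_finite_dimension(1)[OF K xs] alg_xs by blast
  have "carrier L \<subseteq> ?E"
  proof (rule function_field_generated[OF E X0])
    fix c
    have "fr (msubst (mconst c) \<Gamma>) (msubst 1 \<Gamma>) \<in> ?K"
      by (rule KV_I[where V = \<Gamma> and e = "d - 1" and a = a, OF homogeneous_\<Gamma> a homogeneous_mconst homogeneous_one])
         (use F_not_unit in \<open>simp add: msubst_hom\<close>)
    hence "fr (mconst c) 1 \<in> ?K" by (simp add: msubst_hom)
    thus "fr (mconst c) 1 \<in> ?E" using L.finite_extension_incl[OF subringE(1)[OF K'] xs] by blast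
  next
    fix i assume "i \<le> n"
    hence "fr (mvar i) (mvar 0) \<in> set xs" unfolding xs_def set_map by (intro imageI) auto
    thus "fr (mvar i) (mvar 0) \<in> ?E" using L.finite_extension_mem[OF K' xs] by blast
  qed
  hence "?E = carrier L" using subfieldE(3)[OF E] by blast
  hence "generically_finite n Y (gauss_map F)" using fin by (simp add: generically_finite_def gauss_map_def)
  moreover have "purely_inseparable_extension CHAR('a) L ?K"
    unfolding purely_inseparable_extension_def
    using power_q_in_pullback by (auto intro!: exI[of _ h] simp: p simp flip: q)
  ultimately show ?thesis by (simp add: purely_inseparable_map_def gauss_map_def)
qed

end

section \<open>Finite fields\<close>

lemma CHAR_dvd_card_finite_field: "CHAR('k::finite_field) dvd card (UNIV :: 'k set)"
proof -
  \<comment> \<open>Translation by \<open>1\<close> permutes the field.\<close>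
  have "(\<Sum>x\<in>(UNIV::'k set). x) = (\<Sum>x\<in>(UNIV::'k set). x + 1)"
    by (rule sum.reindex_bij_witness[of _ "\<lambda>x. x + 1" "\<lambda>x. x - 1"]) auto
  also have "\<dots> = (\<Sum>x\<in>(UNIV::'k set). x) + of_nat (card (UNIV :: 'k set))"
    by (simp add: sum.distrib)
  finally show ?thesis by (simp add: of_nat_eq_0_iff_char_dvd)
qed

lemma base_change_frobenius:
  fixes F :: "'k::finite_field mpol"
  assumes "q = card (UNIV :: 'k set)"
  shows "map_coeffs (\<lambda>c. c ^ q) (base_change F) = base_change F"
proof (rule poly_mapping_eqI)
  fix m
  have "q > 0" using assms finite_UNIV_card_ge_0[where ?'a = 'k] by simp
  thus "lookup (map_coeffs (\<lambda>c. c ^ q) (base_change F)) m = lookup (base_change F) m"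
    by (simp add: base_change_def lookup_map finite_field_power_card_eq_same assms flip: to_ac_power)
qed

section \<open>Hypersurfaces over a finite field\<close>

lemma frobenius_nonclassical_imp_dvd:
  assumes F: "irreducible_hypersurface F n d" and nc: "frobenius_nonclassical n q F"
  shows "F dvd (\<Sum>i\<le>n. partial i F * mvar i ^ q)"
proof -
  interpret irreducible_hypersurface F n d by (rule F)
  let ?A = "\<Sum>i\<le>n. partial i F * mvar i ^ q"
  have "vars ?A \<subseteq> {..n}"
    using vars_partial[of _ F] homogeneous_vars[OF F_homogeneous]
    by (intro vars_sum vars_mult vars_power) (auto simp: vars_mvar)
  moreover have "vanishes_on n Y ?A"
    unfolding vanishes_on_hypersurface_iff[OF F_homogeneous]
  proof (intro ballI impI)
    fix x assume x: "x \<in> hcoords n" "meval F x = 0"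
    have eval: "meval ?A x = (\<Sum>i\<le>n. meval (partial i F) x * x i ^ q)"
      by (simp add: meval_hom)
    show "meval ?A x = 0"
    proof (cases "nonsingular_at n F x")
      case True
      hence "ppoint (\<lambda>i. x i ^ q) \<in> tangent_hyperplane n F x"
        using nc x by (auto simp: frobenius_nonclassical_def)
      then obtain y where y: "ppoint (\<lambda>i. x i ^ q) = ppoint y" "(\<Sum>i\<le>n. meval (partial i F) x * y i) = 0"
        by (auto simp: tangent_hyperplane_def)
      obtain c where c: "c \<noteq> 0" "y = (\<lambda>i. c * x i ^ q)" using ppoint_eqD[OF y(1)] by blast
      have "c * (\<Sum>i\<le>n. meval (partial i F) x * x i ^ q) = 0"
        using y(2) unfolding c(2) by (simp add: sum_distrib_left mult_ac)
      thus ?thesis using c(1) eval by simp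
    qed (simp add: eval nonsingular_at_def)
  qed
  ultimately show ?thesis using vanishes_iff by blast
qed

lemma nondegenerate_imp:
  assumes F: "irreducible_hypersurface F n d" and nd: "nondegenerate n (hypersurface n F)"
  shows "d \<ge> 2" and "i \<le> n \<Longrightarrow> \<not> F dvd mvar i"
proof -
  interpret irreducible_hypersurface F n d by (rule F)
  have F0: "F \<noteq> 0" "\<not> F dvd 1" using F_irreducible by (auto simp: irreducible_def)
  have "d \<noteq> 0"
  proof
    assume "d = 0"
    hence "tdeg F = 0" using tdeg_homogeneous[OF F_homogeneous F0(1)] by simp
    thus False using tdeg_0_imp_dvd_1 F0 by blast
  qed
  moreover have "d \<noteq> 1"
  proof
    assume "d = 1"
    hence "\<not> vanishes_on n Y F" using nd F_homogeneous F0 by (auto simp: nondegenerate_def)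
    thus False using vanishes_homogeneous_iff[OF F_homogeneous] by simp
  qed
  ultimately show "d \<ge> 2" by simp
  assume i: "i \<le> n"
  have "(mvar i :: 'a mpol) \<noteq> 0" using vars_mvar[of i, where 'a = 'a] by auto
  hence "\<not> vanishes_on n Y (mvar i)" using nd homogeneous_mvar[OF i] by (auto simp: nondegenerate_def)
  thus "\<not> F dvd mvar i" using vanishes_homogeneous_iff[OF homogeneous_mvar[OF i]] by simp
qed

theorem theorem5p3:
  fixes n p h q d r :: nat
    and F :: "'k::finite_field mpol"
    and U :: "nat \<Rightarrow> 'k alg_closure mpol"
  defines "FK \<equiv> base_change F"
  defines "S \<equiv> hypersurface n FK"
  assumes n: "n \<ge> 2"
    and q: "prime p" "h > 0" "q = p ^ h" "card (UNIV :: 'k set) = q"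
    and F_homogeneous: "homogeneous n d F"
    and S_irreducible: "irreducible_equation n FK S"
    and S_nondegenerate: "nondegenerate n S"
    and degree: "\<not> p dvd d"
    and nonzero: "(\<Sum>i\<le>n. partial i F * mvar i ^ q) \<noteq> 0"
    and S_nonclassical: "frobenius_nonclassical n q FK"
    and r: "r > 0" "p ^ r < q"
    and U_map: "rational_map n S U"
    and gauss_U: "rational_map_eq n S (gauss_map FK) (\<lambda>i. U i ^ (p ^ r))"
    and U_separable: "generically_finite n S U" "separable_map n S U"
  shows "purely_inseparable_map n S (gauss_map FK)
    \<and> (\<exists>G. irreducible_equation n G (strict_dual n FK))
    \<and> (\<forall>G. irreducible_equation n G (strict_dual n FK) \<longrightarrow>
          strict_dual n G = S
        \<and> rational_map_eq n S (rational_comp (gauss_map G) (gauss_map FK)) (frobenius_map q))"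
proof -
  have FK: "homogeneous n d FK" unfolding FK_def base_change_def by (rule homogeneous_map[OF F_homogeneous])
  have irr: "irreducible_hypersurface FK n d"
    by unfold_locales (use n FK S_irreducible in \<open>auto simp: irreducible_equation_def\<close>)
  then interpret FK: irreducible_hypersurface FK n d .
  have S: "FK.Y = S" by (simp add: S_def)
  have "CHAR('k) dvd p ^ h" using CHAR_dvd_card_finite_field[where 'k = 'k] q by simp
  moreover have "prime CHAR('k)" using prime_CHAR_semidom[where 'a = 'k] CHAR_pos[where 'a = 'k] by simp
  ultimately have "CHAR('k) = p" using q(1) by (metis prime_dvd_power primes_dvd_imp_eq)
  hence char: "CHAR('k alg_closure) = p" by simp
  have rh: "r < h" using r(2) q(1,3) prime_gt_1_nat[OF q(1)] by (simp add: power_strict_increasing_iff)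
  obtain e where e: "\<And>i. i \<le> n \<Longrightarrow> homogeneous n e (U i)" and e': "\<exists>i\<le>n. \<not> vanishes_on n S (U i)"
    using U_map by (auto simp: rational_map_def)
  have Ua: "\<exists>i\<le>n. \<not> FK dvd U i" using e e' FK.vanishes_homogeneous_iff unfolding S by blast
  then obtain a where a: "a \<le> n" "\<not> FK dvd U a" by blast
  have hp: "homogeneous n (d - 1) (partial i FK)" for i by (rule homogeneous_partial[OF FK])
  have smooth: "\<exists>i\<le>n. \<not> FK dvd partial i FK"
    using gauss_U hp FK.vanishes_homogeneous_iff[OF hp]
    unfolding rational_map_eq_def rational_map_def gauss_map_def S by blast
  have gU: "FK dvd partial i FK * U j ^ (p ^ r) - partial j FK * U i ^ (p ^ r)" if ij: "i \<le> n" "j \<le> n" for i j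
  proof -
    have "homogeneous n (d - 1 + e * p ^ r) (partial i FK * U j ^ (p ^ r) - partial j FK * U i ^ (p ^ r))"
      by (intro homogeneous_diff homogeneous_mult hp homogeneous_power e ij)
    moreover have "vanishes_on n S (partial i FK * U j ^ (p ^ r) - partial j FK * U i ^ (p ^ r))"
      using gauss_U ij by (auto simp: rational_map_eq_def gauss_map_def)
    ultimately show ?thesis using FK.vanishes_homogeneous_iff unfolding S by blast
  qed
  note nd = nondegenerate_imp[OF irr S_nondegenerate[unfolded S_def]]
  have sep: "separable_extension FK.L (pullback_field n FK.Y U)"
    using U_separable(2) by (simp add: separable_map_def S)
  interpret separable_power_gauss_map FK U n d p h r q "p ^ r" e
  proof unfold_locales
    fix i j assume ij: "i \<le> n" "j \<le> n"
    show "\<exists>N g C. (\<forall>k\<le>N. homogeneous n g (C k))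
        \<and> FK dvd (\<Sum>k\<le>N. msubst (C k) U * (mvar i ^ k * mvar j ^ (N - k)))
        \<and> \<not> FK dvd (\<Sum>k\<le>N. msubst (C k) U * (of_nat k * mvar i ^ (k - 1) * mvar j ^ (N - k)))"
      by (rule FK.separable_relation[where V = U and e = e and a = a, OF e a sep ij nd(2)[OF ij(2)]])
  qed (use n q char r(1) rh FK FK.F_irreducible nd frobenius_nonclassical_imp_dvd[OF irr S_nonclassical]
      e Ua smooth gU base_change_frobenius[OF q(4)[symmetric], of F] in \<open>auto simp: FK_def\<close>)
  show ?thesis
    using gauss_map_purely_inseparable dual_equation_exists dual_equation_irreducible_equation
      irreducible_equation_strict_dual bidual gauss_comp_gauss_eq_frobenius
    unfolding S_def by blast
qed

end
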